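(* Let $\mathfrak{s}=\mathfrak{s}_{\bar0}\oplus\mathfrak{s}_{\bar1}$ be a finite dimensional Lie superalgebra over a field $\Bbbk$, $\widetilde U=U(\mathfrak{s})$ and $U=U(\mathfrak{s}_{\bar0})$. Assume that $S\otimes E$ has finite type socle for every simple $U$-module $S$ and every finite dimensional $U$-module $E$. Then every simple $\widetilde U$-module is a quotient of a module of the form $\widetilde U\otimes_UL$, for some simple $U$-module $L$. This holds for either of the following two meanings of "simple $\widetilde U$-module": (I) a simple $\widetilde U$-module, without any reference to the $\mathbb{Z}_2$-grading; (II) a $\mathbb{Z}_2$-graded $\widetilde U$-module which has no proper graded submodules (in which case $L$ is a graded $U$-module and the quotient map respects the grading).
   Context: The socle $\mathrm{soc}(M)$ is the sum of all simple submodules of $M$ (zero if there are none). A submodule $N\subset M$ is essential if every submodule $K\subset M$ with $K\cap N=0$ is zero. $M$ has finite type socle if $\mathrm{soc}(M)$ has finite length and is essential in $M$. "No proper graded submodules" means that the module is non-zero and its only graded submodules are $0$ and itself. *)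

theory Defs
  imports
    Complex_Main
    "HOL-Library.Z2"
    "HOL-Library.Poly_Mapping"
    "HOL-Algebra.Module"
    "HOL-Algebra.QuotRing"
    "HOL-Algebra.Free_Abelian_Groups"
begin

section \<open>Modules over a not necessarily commutative ring\<close>

text \<open>
  The locale \<open>module\<close> of HOL-Algebra assumes a commutative ring of scalars. Its record type and
  its \<^const>\<open>submodule\<close> do not depend on that and are used here; as there, the
  multiplicative fields of the module record carry no information.
\<close>

locale left_module = R?: ring R + M?: abelian_group M
  for R (structure) and M (structure) +
  assumes smult_closed:
      "\<lbrakk>a \<in> carrier R; x \<in> carrier M\<rbrakk> \<Longrightarrow> a \<odot>\<^bsub>M\<^esub> x \<in> carrier M"
    and smult_l_distr:
      "\<lbrakk>a \<in> carrier R; b \<in> carrier R; x \<in> carrier M\<rbrakk> \<Longrightarrow>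
        (a \<oplus> b) \<odot>\<^bsub>M\<^esub> x = a \<odot>\<^bsub>M\<^esub> x \<oplus>\<^bsub>M\<^esub> b \<odot>\<^bsub>M\<^esub> x"
    and smult_r_distr:
      "\<lbrakk>a \<in> carrier R; x \<in> carrier M; y \<in> carrier M\<rbrakk> \<Longrightarrow>
        a \<odot>\<^bsub>M\<^esub> (x \<oplus>\<^bsub>M\<^esub> y) = a \<odot>\<^bsub>M\<^esub> x \<oplus>\<^bsub>M\<^esub> a \<odot>\<^bsub>M\<^esub> y"
    and smult_assoc:
      "\<lbrakk>a \<in> carrier R; b \<in> carrier R; x \<in> carrier M\<rbrakk> \<Longrightarrow>
        (a \<otimes> b) \<odot>\<^bsub>M\<^esub> x = a \<odot>\<^bsub>M\<^esub> (b \<odot>\<^bsub>M\<^esub> x)"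
    and smult_one:
      "x \<in> carrier M \<Longrightarrow> \<one> \<odot>\<^bsub>M\<^esub> x = x"

definition left_module_hom ::
    "('r, 'x) ring_scheme \<Rightarrow> ('r, 'a, 'y) module_scheme \<Rightarrow> ('r, 'b, 'z) module_scheme \<Rightarrow> ('a \<Rightarrow> 'b) set"
  where "left_module_hom R M N =
    {f \<in> hom (add_monoid M) (add_monoid N).
      \<forall>a\<in>carrier R. \<forall>x\<in>carrier M. f (a \<odot>\<^bsub>M\<^esub> x) = a \<odot>\<^bsub>N\<^esub> f x}"

definition simple_module :: "('r, 'x) ring_scheme \<Rightarrow> ('r, 'a, 'y) module_scheme \<Rightarrow> bool"
  where "simple_module R M \<longleftrightarrow>
    left_module R M \<and> carrier M \<noteq> {\<zero>\<^bsub>M\<^esub>} \<and>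
    (\<forall>N. submodule N R M \<longrightarrow> N = {\<zero>\<^bsub>M\<^esub>} \<or> N = carrier M)"

definition socle :: "('r, 'x) ring_scheme \<Rightarrow> ('r, 'a, 'y) module_scheme \<Rightarrow> 'a set"
  where "socle R M =
    generate (add_monoid M) (\<Union>{N. submodule N R M \<and> simple_module R (M\<lparr>carrier := N\<rparr>)})"

definition essential :: "('r, 'x) ring_scheme \<Rightarrow> ('r, 'a, 'y) module_scheme \<Rightarrow> 'a set \<Rightarrow> bool"
  where "essential R M N \<longleftrightarrow>
    submodule N R M \<and> (\<forall>K. submodule K R M \<and> K \<inter> N = {\<zero>\<^bsub>M\<^esub>} \<longrightarrow> K = {\<zero>\<^bsub>M\<^esub>})"

text \<open>Finite length: existence of a composition series \<open>C 0 \<subset> \<dots> \<subset> C n\<close>.\<close>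

definition finite_length :: "('r, 'x) ring_scheme \<Rightarrow> ('r, 'a, 'y) module_scheme \<Rightarrow> bool"
  where "finite_length R M \<longleftrightarrow>
    (\<exists>(n::nat) C. C 0 = {\<zero>\<^bsub>M\<^esub>} \<and> C n = carrier M \<and> (\<forall>i\<le>n. submodule (C i) R M) \<and>
      (\<forall>i<n. C i \<subset> C (Suc i) \<and>
        (\<forall>K. submodule K R M \<and> C i \<subseteq> K \<and> K \<subseteq> C (Suc i) \<longrightarrow> K = C i \<or> K = C (Suc i))))"

definition finite_type_socle :: "('r, 'x) ring_scheme \<Rightarrow> ('r, 'a, 'y) module_scheme \<Rightarrow> bool"
  where "finite_type_socle R M \<longleftrightarrow>
    finite_length R (M\<lparr>carrier := socle R M\<rparr>) \<and> essential R M (socle R M)"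

lemma (in left_module) smult_minus_one:
  assumes "x \<in> carrier M" shows "(\<ominus> \<one>) \<odot>\<^bsub>M\<^esub> x = \<ominus>\<^bsub>M\<^esub> x"
proof -
  have z: "\<zero> \<odot>\<^bsub>M\<^esub> x = \<zero>\<^bsub>M\<^esub>"
    using smult_l_distr[of \<zero> \<zero> x] assms smult_closed[OF R.zero_closed assms]
    by (metis M.add.l_cancel_one R.l_zero R.zero_closed)
  have "(\<ominus> \<one>) \<odot>\<^bsub>M\<^esub> x \<oplus>\<^bsub>M\<^esub> x = \<zero>\<^bsub>M\<^esub>"
    using smult_l_distr[of "\<ominus> \<one>" \<one> x] assms z by (simp add: smult_one R.l_neg)
  then show ?thesis
    using assms smult_closed by (metis M.minus_equality R.add.inv_closed R.one_closed)
qed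

lemma (in left_module) submodule_iff:
  "submodule N R M \<longleftrightarrow> N \<subseteq> carrier M \<and> \<zero>\<^bsub>M\<^esub> \<in> N \<and>
    (\<forall>x\<in>N. \<forall>y\<in>N. x \<oplus>\<^bsub>M\<^esub> y \<in> N) \<and> (\<forall>a\<in>carrier R. \<forall>x\<in>N. a \<odot>\<^bsub>M\<^esub> x \<in> N)"
  (is "?l \<longleftrightarrow> ?r")
proof
  assume ?l
  then interpret submodule N R M .
  show ?r using subset one_closed m_closed smult_closed by auto
next
  assume r: ?r
  have "inv\<^bsub>add_monoid M\<^esub> x \<in> N" if "x \<in> N" for x
    using r that smult_minus_one[of x] unfolding a_inv_def[of M, symmetric]
    by (metis R.add.inv_closed R.one_closed subsetD)
  then show ?l
    using r by (auto intro!: submodule.intro subgroup.intro submodule_axioms.intro)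
qed

definition transported_module :: "('a \<Rightarrow> 'b) \<Rightarrow> ('r, 'a, 'y) module_scheme \<Rightarrow> ('r, 'b) module"
  where "transported_module f M =
    (let g = the_inv_into (carrier M) f in
    \<lparr>carrier = f ` carrier M, mult = undefined, one = undefined, ring.zero = f \<zero>\<^bsub>M\<^esub>,
     add = (\<lambda>x y. f (g x \<oplus>\<^bsub>M\<^esub> g y)), smult = (\<lambda>a x. f (a \<odot>\<^bsub>M\<^esub> g x))\<rparr>)"

lemma (in left_module) transported:
  assumes inj: "inj_on f (carrier M)"
  shows "left_module R (transported_module f M)"
    and "f \<in> left_module_hom R M (transported_module f M)"
    and "bij_betw f (carrier M) (carrier (transported_module f M))"
proof -
  let ?M = "transported_module f M"
  have g: "the_inv_into (carrier M) f (f x) = x" if "x \<in> carrier M" for x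
    using the_inv_into_f_f[OF inj that] .
  have c: "carrier ?M = f ` carrier M" and z: "\<zero>\<^bsub>?M\<^esub> = f \<zero>\<^bsub>M\<^esub>"
    by (simp_all add: transported_module_def Let_def)
  have a: "f x \<oplus>\<^bsub>?M\<^esub> f y = f (x \<oplus>\<^bsub>M\<^esub> y)" if "x \<in> carrier M" "y \<in> carrier M" for x y
    using that by (simp add: transported_module_def Let_def g)
  have s: "r \<odot>\<^bsub>?M\<^esub> f x = f (r \<odot>\<^bsub>M\<^esub> x)" if "x \<in> carrier M" for x r
    using that by (simp add: transported_module_def Let_def g)
  have ab: "abelian_group ?M"
  proof (rule abelian_groupI)
    fix x assume "x \<in> carrier ?M"
    then obtain x' where x: "x = f x'" "x' \<in> carrier M" by (auto simp: c)
    then have "f (\<ominus>\<^bsub>M\<^esub> x') \<oplus>\<^bsub>?M\<^esub> x = \<zero>\<^bsub>?M\<^esub>" by (simp add: a z M.l_neg)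
    then show "\<exists>y\<in>carrier ?M. y \<oplus>\<^bsub>?M\<^esub> x = \<zero>\<^bsub>?M\<^esub>" using x by (auto simp: c)
  qed (auto simp: c z a M.a_ac)
  show "left_module R ?M"
    by (intro left_module.intro ab R.ring_axioms left_module_axioms.intro)
      (auto simp: c a s smult_closed smult_l_distr smult_r_distr smult_assoc smult_one)
  show "f \<in> left_module_hom R M ?M"
    by (auto simp: left_module_hom_def hom_def c a s)
  show "bij_betw f (carrier M) (carrier ?M)"
    using inj by (simp add: bij_betw_def c)
qed

lemma simple_module_iso:
  assumes M: "simple_module R M" and N: "left_module R N"
    and f: "f \<in> left_module_hom R M N" and b: "bij_betw f (carrier M) (carrier N)"
  shows "simple_module R N"
proof -
  interpret M: left_module R M using M by (simp add: simple_module_def)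
  interpret N: left_module R N by fact
  have add: "f (x \<oplus>\<^bsub>M\<^esub> y) = f x \<oplus>\<^bsub>N\<^esub> f y" if "x \<in> carrier M" "y \<in> carrier M" for x y
    using f that by (auto simp: left_module_hom_def hom_def)
  have smult: "f (a \<odot>\<^bsub>M\<^esub> x) = a \<odot>\<^bsub>N\<^esub> f x" if "a \<in> carrier R" "x \<in> carrier M" for x a
    using f that by (auto simp: left_module_hom_def)
  have im: "f ` carrier M = carrier N" and inj: "inj_on f (carrier M)"
    using b by (auto simp: bij_betw_def)
  then have cl: "f x \<in> carrier N" if "x \<in> carrier M" for x using that by blast
  have zero: "f \<zero>\<^bsub>M\<^esub> = \<zero>\<^bsub>N\<^esub>"
    using add[of "\<zero>\<^bsub>M\<^esub>" "\<zero>\<^bsub>M\<^esub>"] cl[of "\<zero>\<^bsub>M\<^esub>"] by simp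
  have "carrier N \<noteq> {\<zero>\<^bsub>N\<^esub>}"
  proof
    assume "carrier N = {\<zero>\<^bsub>N\<^esub>}"
    then have "x = \<zero>\<^bsub>M\<^esub>" if "x \<in> carrier M" for x
      using cl[OF that] inj_onD[OF inj _ that M.M.zero_closed] zero by simp
    then have "carrier M = {\<zero>\<^bsub>M\<^esub>}" by auto
    then show False using M by (simp add: simple_module_def)
  qed
  moreover have "K = {\<zero>\<^bsub>N\<^esub>} \<or> K = carrier N" if K: "submodule K R N" for K
  proof -
    let ?K = "{x \<in> carrier M. f x \<in> K}"
    have "submodule ?K R M"
      using K unfolding M.submodule_iff N.submodule_iff
      by (auto simp: add smult zero M.smult_closed)
    then have "?K = {\<zero>\<^bsub>M\<^esub>} \<or> ?K = carrier M" using M by (simp add: simple_module_def)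
    moreover have "K \<subseteq> f ` carrier M" using K im unfolding N.submodule_iff by simp
    then have "f ` ?K = K" by blast
    ultimately show ?thesis using zero im by auto
  qed
  ultimately show ?thesis using N by (simp add: simple_module_def)
qed


section \<open>Tensor products\<close>

text \<open>
  \<open>presented_module X N act\<close> is the quotient of the free abelian group on \<open>X\<close> by its
  subgroup \<open>N\<close>, on which a scalar \<open>a\<close> acts through \<open>act a\<close>. It is only used where \<open>act a\<close>
  maps \<open>N\<close> to \<open>N\<close>, so that the choice of the representative \<open>rep A\<close> is immaterial.
\<close>

definition rep :: "'a set \<Rightarrow> 'a"
  where "rep A = (SOME a. a \<in> A)"

definition presented_module ::
    "'a set \<Rightarrow> ('a \<Rightarrow>\<^sub>0 int) set \<Rightarrow> ('r \<Rightarrow> ('a \<Rightarrow>\<^sub>0 int) \<Rightarrow> ('a \<Rightarrow>\<^sub>0 int)) \<Rightarrow>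
      ('r, ('a \<Rightarrow>\<^sub>0 int) set) module"
  where "presented_module X N act =
    \<lparr>carrier = carrier (free_Abelian_group X Mod N), mult = undefined, one = undefined,
     ring.zero = N, add = (\<lambda>A B. A <#>\<^bsub>free_Abelian_group X\<^esub> B),
     smult = (\<lambda>a A. N #>\<^bsub>free_Abelian_group X\<^esub> act a (rep A))\<rparr>"

text \<open>
  The relations defining \<open>M \<otimes>\<^sub>C N\<close>, for scalars in \<open>C\<close> acting through \<open>ra\<close> on the
  right of \<open>M\<close> and through \<open>la\<close> on the left of \<open>N\<close>.
\<close>

definition tensor_null ::
    "'c set \<Rightarrow> ('m \<Rightarrow> 'c \<Rightarrow> 'm) \<Rightarrow> ('c \<Rightarrow> 'n \<Rightarrow> 'n) \<Rightarrow>
      ('m, 'x) ring_scheme \<Rightarrow> ('n, 'y) ring_scheme \<Rightarrow> ('m \<times> 'n \<Rightarrow>\<^sub>0 int) set"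
  where "tensor_null C ra la M N =
    generate (free_Abelian_group (carrier M \<times> carrier N))
     ({frag_of (m \<oplus>\<^bsub>M\<^esub> m', n) - frag_of (m, n) - frag_of (m', n) | m m' n.
        m \<in> carrier M \<and> m' \<in> carrier M \<and> n \<in> carrier N} \<union>
      {frag_of (m, n \<oplus>\<^bsub>N\<^esub> n') - frag_of (m, n) - frag_of (m, n') | m n n'.
        m \<in> carrier M \<and> n \<in> carrier N \<and> n' \<in> carrier N} \<union>
      {frag_of (ra m c, n) - frag_of (m, la c n) | m c n.
        m \<in> carrier M \<and> c \<in> C \<and> n \<in> carrier N})"

text \<open>
  The left \<open>A\<close>-module \<open>A \<otimes>\<^sub>R M\<close>, with \<open>A\<close> a right \<open>R\<close>-module along \<open>h : R \<rightarrow> A\<close>.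
\<close>

definition induced_null ::
    "('a, 'x) ring_scheme \<Rightarrow> ('r, 'y) ring_scheme \<Rightarrow> ('r \<Rightarrow> 'a) \<Rightarrow> ('r, 'm, 'z) module_scheme \<Rightarrow>
      ('a \<times> 'm \<Rightarrow>\<^sub>0 int) set"
  where "induced_null A R h M =
    tensor_null (carrier R) (\<lambda>a r. a \<otimes>\<^bsub>A\<^esub> h r) (\<lambda>r m. r \<odot>\<^bsub>M\<^esub> m) A M"

definition induced_module ::
    "('a, 'x) ring_scheme \<Rightarrow> ('r, 'y) ring_scheme \<Rightarrow> ('r \<Rightarrow> 'a) \<Rightarrow> ('r, 'm, 'z) module_scheme \<Rightarrow>
      ('a, ('a \<times> 'm \<Rightarrow>\<^sub>0 int) set) module"
  where "induced_module A R h M =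
    presented_module (carrier A \<times> carrier M) (induced_null A R h M)
      (\<lambda>a. frag_extend (\<lambda>(b, m). frag_of (a \<otimes>\<^bsub>A\<^esub> b, m)))"

definition induced_tensor ::
    "('a, 'x) ring_scheme \<Rightarrow> ('r, 'y) ring_scheme \<Rightarrow> ('r \<Rightarrow> 'a) \<Rightarrow> ('r, 'm, 'z) module_scheme \<Rightarrow>
      'a \<Rightarrow> 'm \<Rightarrow> ('a \<times> 'm \<Rightarrow>\<^sub>0 int) set"
  where "induced_tensor A R h M a m =
    induced_null A R h M #>\<^bsub>free_Abelian_group (carrier A \<times> carrier M)\<^esub> frag_of (a, m)"


section \<open>\<open>\<int>\<^sub>2\<close>-graded modules\<close>

definition group_grading :: "('a, 'x) ring_scheme \<Rightarrow> (bit \<Rightarrow> 'a set) \<Rightarrow> bool"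
  where "group_grading M G \<longleftrightarrow>
    (\<forall>i. subgroup (G i) (add_monoid M)) \<and> G 0 \<inter> G 1 = {\<zero>\<^bsub>M\<^esub>} \<and>
    (\<forall>x\<in>carrier M. \<exists>x0\<in>G 0. \<exists>x1\<in>G 1. x = x0 \<oplus>\<^bsub>M\<^esub> x1)"

text \<open>\<open>A\<close> is the grading of the ring \<open>R\<close>, and \<open>G\<close> that of the module \<open>M\<close>.\<close>

definition graded_module ::
    "('r, 'x) ring_scheme \<Rightarrow> (bit \<Rightarrow> 'r set) \<Rightarrow> ('r, 'a, 'y) module_scheme \<Rightarrow> (bit \<Rightarrow> 'a set) \<Rightarrow> bool"
  where "graded_module R A M G \<longleftrightarrow>
    left_module R M \<and> group_grading M G \<and>
    (\<forall>i j. \<forall>a\<in>A i. \<forall>x\<in>G j. a \<odot>\<^bsub>M\<^esub> x \<in> G (i + j))"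

definition graded_submodule ::
    "('r, 'x) ring_scheme \<Rightarrow> ('r, 'a, 'y) module_scheme \<Rightarrow> (bit \<Rightarrow> 'a set) \<Rightarrow> 'a set \<Rightarrow> bool"
  where "graded_submodule R M G N \<longleftrightarrow>
    submodule N R M \<and> (\<forall>x\<in>N. \<exists>x0\<in>N \<inter> G 0. \<exists>x1\<in>N \<inter> G 1. x = x0 \<oplus>\<^bsub>M\<^esub> x1)"

definition graded_simple_module ::
    "('r, 'x) ring_scheme \<Rightarrow> (bit \<Rightarrow> 'r set) \<Rightarrow> ('r, 'a, 'y) module_scheme \<Rightarrow> (bit \<Rightarrow> 'a set) \<Rightarrow> bool"
  where "graded_simple_module R A M G \<longleftrightarrow>
    graded_module R A M G \<and> carrier M \<noteq> {\<zero>\<^bsub>M\<^esub>} \<and>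
    (\<forall>N. graded_submodule R M G N \<longrightarrow> N = {\<zero>\<^bsub>M\<^esub>} \<or> N = carrier M)"

definition induced_grading ::
    "('a, 'x) ring_scheme \<Rightarrow> (bit \<Rightarrow> 'a set) \<Rightarrow> ('r, 'y) ring_scheme \<Rightarrow> ('r \<Rightarrow> 'a) \<Rightarrow>
      ('r, 'm, 'z) module_scheme \<Rightarrow> (bit \<Rightarrow> 'm set) \<Rightarrow> bit \<Rightarrow> ('a \<times> 'm \<Rightarrow>\<^sub>0 int) set set"
  where "induced_grading A AG R h M G i =
    generate (add_monoid (induced_module A R h M))
      {induced_tensor A R h M a m | a m j k. a \<in> AG j \<and> m \<in> G k \<and> j + k = i}"


section \<open>Lie superalgebras\<close>

text \<open>
  The underlying superspace is the internal direct sum \<^term>\<open>superspace L\<close> of two subspaces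
  of an ambient vector space, so that the even part is a Lie superalgebra on the same type.
\<close>

record ('k, 's) superalgebra =
  lscale :: "'k \<Rightarrow> 's \<Rightarrow> 's"
  part :: "bit \<Rightarrow> 's set"
  bracket :: "'s \<Rightarrow> 's \<Rightarrow> 's"
  square :: "'s \<Rightarrow> 's"

definition superspace :: "('k, 's::ab_group_add) superalgebra \<Rightarrow> 's set"
  where "superspace L = {x + y | x y. x \<in> part L 0 \<and> y \<in> part L 1}"

definition koszul :: "bit \<Rightarrow> bit \<Rightarrow> 'k::field"
  where "koszul i j = (if i = 1 \<and> j = 1 then - 1 else 1)"

text \<open>
  The axioms involving the bracket only. The last two follow from the preceding ones unless the
  characteristic is \<open>2\<close> and \<open>3\<close>, respectively.
\<close>

locale lie_superbracket = V?: vector_space "lscale L"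
  for L :: "('k::field, 's::ab_group_add) superalgebra" +
  assumes subspace_part: "subspace (part L i)"
    and part_Int: "part L 0 \<inter> part L 1 = {0}"
    and bracket_add_left: "\<lbrakk>x \<in> superspace L; y \<in> superspace L; z \<in> superspace L\<rbrakk> \<Longrightarrow>
      bracket L (x + y) z = bracket L x z + bracket L y z"
    and bracket_add_right: "\<lbrakk>x \<in> superspace L; y \<in> superspace L; z \<in> superspace L\<rbrakk> \<Longrightarrow>
      bracket L x (y + z) = bracket L x y + bracket L x z"
    and bracket_scale_left: "\<lbrakk>x \<in> superspace L; y \<in> superspace L\<rbrakk> \<Longrightarrow>
      bracket L (lscale L c x) y = lscale L c (bracket L x y)"
    and bracket_scale_right: "\<lbrakk>x \<in> superspace L; y \<in> superspace L\<rbrakk> \<Longrightarrow>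
      bracket L x (lscale L c y) = lscale L c (bracket L x y)"
    and bracket_part: "\<lbrakk>x \<in> part L i; y \<in> part L j\<rbrakk> \<Longrightarrow> bracket L x y \<in> part L (i + j)"
    and bracket_skew: "\<lbrakk>x \<in> part L i; y \<in> part L j\<rbrakk> \<Longrightarrow>
      bracket L x y = - lscale L (koszul i j) (bracket L y x)"
    and jacobi: "\<lbrakk>x \<in> part L i; y \<in> part L j; z \<in> part L k\<rbrakk> \<Longrightarrow>
      bracket L x (bracket L y z) =
        bracket L (bracket L x y) z + lscale L (koszul i j) (bracket L y (bracket L x z))"
    and bracket_even: "x \<in> part L 0 \<Longrightarrow> bracket L x x = 0"
    and bracket_odd: "x \<in> part L 1 \<Longrightarrow> bracket L x (bracket L x x) = 0"

text \<open>
  Over a field of arbitrary characteristic the structure includes the squaring map \<open>x \<mapsto> x\<^sup>2\<close>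
  on the odd part, with \<open>2 x\<^sup>2 = [x, x]\<close>. In characteristic other than \<open>2\<close> it is no
  additional datum: it is \<open>[x, x] / 2\<close>, and its axioms are consequences of those for the bracket;
  see \<open>square_eq\<close> and \<open>lie_superalgebra_char_not_2\<close> below.
\<close>

locale lie_superalgebra = lie_superbracket +
  assumes square_part: "x \<in> part L 1 \<Longrightarrow> square L x \<in> part L 0"
    and square_scale: "x \<in> part L 1 \<Longrightarrow> square L (lscale L c x) = lscale L (c ^ 2) (square L x)"
    and square_add: "\<lbrakk>x \<in> part L 1; y \<in> part L 1\<rbrakk> \<Longrightarrow>
      square L (x + y) = square L x + square L y + bracket L x y"
    and bracket_square: "\<lbrakk>x \<in> part L 1; y \<in> superspace L\<rbrakk> \<Longrightarrow>
      bracket L (square L x) y = bracket L x (bracket L x y)"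

lemma (in lie_superbracket) part_superspace: "x \<in> part L i \<Longrightarrow> x \<in> superspace L"
  using subspace_0[OF subspace_part, of 0] subspace_0[OF subspace_part, of 1]
  unfolding superspace_def by (cases i rule: bit.exhaust) force+

lemma (in lie_superalgebra) square_eq:
  assumes "(2 :: 'a) \<noteq> 0" and "x \<in> part L 1"
  shows "square L x = lscale L (1 / 2) (bracket L x x)"
proof -
  have two: "lscale L 2 y = y + y" for y
    by (metis one_add_one scale_left_distrib scale_one)
  have "lscale L (2^2) (square L x) = square L (x + x)"
    using square_scale[OF assms(2), of 2] two by simp
  also have "\<dots> = lscale L 2 (square L x) + bracket L x x"
    by (simp add: square_add assms two)
  finally have "bracket L x x = lscale L (2^2 - 2) (square L x)"
    unfolding scale_left_diff_distrib by (simp add: algebra_simps)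
  also have "2^2 - 2 = (2 :: 'a)"
    by simp
  finally show ?thesis
    using assms by simp
qed

lemma lie_superalgebra_char_not_2:
  fixes L :: "('k::field, 's::ab_group_add) superalgebra"
  assumes "lie_superbracket L" and two: "(2 :: 'k) \<noteq> 0"
  shows "lie_superalgebra (L\<lparr>square := \<lambda>x. lscale L (1 / 2) (bracket L x x)\<rparr>)"
proof -
  interpret lie_superbracket L by fact
  let ?L = "L\<lparr>square := \<lambda>x. lscale L (1 / 2) (bracket L x x)\<rparr>"
  have half: "lscale L (1 / 2) (y + y) = y" for y
  proof -
    have "lscale L (1 / 2) (y + y) = lscale L (1 / 2 + 1 / 2) y"
      by (simp only: scale_left_distrib scale_right_distrib)
    also have "1 / 2 + 1 / 2 = (1 :: 'k)" using two by (simp add: field_simps)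
    finally show ?thesis by simp
  qed
  have ss: "superspace ?L = superspace L" by (simp add: superspace_def)
  note ps = part_superspace
  have add: "x + y \<in> superspace L" if "x \<in> part L 1" "y \<in> part L 1" for x y
    using that ps subspace_add[OF subspace_part] by blast
  have fields: "lscale ?L = lscale L" "part ?L = part L" "bracket ?L = bracket L"
    by simp_all
  have br: "lie_superbracket ?L"
    using assms(1) unfolding lie_superbracket_def lie_superbracket_axioms_def fields ss .
  have hom: "bracket L (lscale L (1/2) (bracket L x x)) y = bracket L x (bracket L x y)"
    if x: "x \<in> part L 1" and y: "y \<in> part L j" for x y j
  proof -
    have xx: "bracket L x x \<in> part L 0" using bracket_part[OF x x] by simp
    have "bracket L x (bracket L x y) = bracket L (bracket L x x) y - bracket L x (bracket L x y)"
      using jacobi[OF x x y] by (simp add: koszul_def)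
    then have "bracket L (bracket L x x) y = bracket L x (bracket L x y) + bracket L x (bracket L x y)"
      by (simp add: algebra_simps)
    then show ?thesis
      using bracket_scale_left[OF ps[OF xx] ps[OF y]] half by simp
  qed
  have sq: "bracket L (lscale L (1/2) (bracket L x x)) y = bracket L x (bracket L x y)"
    if x: "x \<in> part L 1" and y: "y \<in> superspace L" for x y
  proof -
    obtain y0 y1 where y: "y = y0 + y1" "y0 \<in> part L 0" "y1 \<in> part L 1"
      using y by (auto simp: superspace_def)
    have xx: "lscale L (1/2) (bracket L x x) \<in> part L 0"
      using bracket_part[OF x x] subspace_scale[OF subspace_part] by simp
    have b: "bracket L x y0 \<in> part L 1" "bracket L x y1 \<in> part L 0"
      using bracket_part[OF x y(2)] bracket_part[OF x y(3)] by simp_all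
    show ?thesis
      using hom[OF x y(2)] hom[OF x y(3)] ps[OF x] ps[OF y(2)] ps[OF y(3)] ps[OF xx]
        ps[OF b(1)] ps[OF b(2)]
      by (simp add: y(1) bracket_add_right)
  qed
  have skew: "bracket L y x = bracket L x y" if "x \<in> part L 1" "y \<in> part L 1" for x y
    using bracket_skew[OF that] by (simp add: koszul_def)
  show ?thesis
  proof (intro lie_superalgebra.intro br lie_superalgebra_axioms.intro, goal_cases)
    case (1 x)
    then show ?case
      using bracket_part[of x 1 x 1] subspace_scale[OF subspace_part] by simp
  next
    case (2 x c)
    then have x: "x \<in> part L 1" by simp
    have cx: "lscale L c x \<in> superspace L" 
      using ps[OF subspace_scale[OF subspace_part x]] .
    show ?case
      using ps[OF x] cx by (simp add: bracket_scale_left bracket_scale_right power2_eq_square mult_ac)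
  next
    case (3 x y)
    then have xy: "x \<in> part L 1" "y \<in> part L 1" by simp_all
    have "bracket L (x + y) (x + y) = bracket L x x + bracket L y y + (bracket L x y + bracket L x y)"
      using ps[OF xy(1)] ps[OF xy(2)] add[OF xy]
      by (simp add: bracket_add_left bracket_add_right skew[OF xy] algebra_simps)
    then show ?case
      using half by (simp add: scale_right_distrib)
  next
    case (4 x y)
    then show ?case using sq by (simp add: ss)
  qed
qed

definition finite_dimensional :: "('k::field, 's::ab_group_add) superalgebra \<Rightarrow> bool"
  where "finite_dimensional L \<longleftrightarrow> (\<exists>B. finite B \<and> superspace L = module.span (lscale L) B)"

definition even_subalgebra :: "('k, 's::zero) superalgebra \<Rightarrow> ('k, 's) superalgebra"
  where "even_subalgebra L = L\<lparr>part := (\<lambda>i. if i = 0 then part L 0 else {0})\<rparr>"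


section \<open>Universal enveloping algebras\<close>

datatype 's monomial = Monomial (letters: "'s list")

instantiation monomial :: (type) monoid_add
begin

definition zero_monomial :: "'a monomial"
  where "0 = Monomial []"

definition plus_monomial :: "'a monomial \<Rightarrow> 'a monomial \<Rightarrow> 'a monomial"
  where "u + v = Monomial (letters u @ letters v)"

instance
  by standard (simp_all add: zero_monomial_def plus_monomial_def)

end

text \<open>Noncommutative polynomials in the elements of \<open>'s\<close>.\<close>

type_synonym ('k, 's) free_algebra = "'s monomial \<Rightarrow>\<^sub>0 'k"

type_synonym ('k, 's) env = "('k, 's) free_algebra set"

definition free_algebra :: "'s set \<Rightarrow> ('k::field, 's) free_algebra ring"
  where "free_algebra X =
    \<lparr>carrier = {p. \<forall>w\<in>Poly_Mapping.keys p. set (letters w) \<subseteq> X},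
     mult = (*), one = 1, ring.zero = 0, add = (+)\<rparr>"

definition gen :: "'s \<Rightarrow> ('k::field, 's) free_algebra"
  where "gen x = Poly_Mapping.single (Monomial [x]) 1"

definition const :: "'k \<Rightarrow> ('k::field, 's) free_algebra"
  where "const c = Poly_Mapping.single 0 c"

text \<open>
  The first two sets of relations turn the free algebra on the set \<^term>\<open>superspace L\<close> into the
  tensor algebra of that vector space.
\<close>

definition env_rels :: "('k::field, 's::ab_group_add) superalgebra \<Rightarrow> ('k, 's) free_algebra set"
  where "env_rels L =
    {gen (x + y) - gen x - gen y | x y. x \<in> superspace L \<and> y \<in> superspace L} \<union>
    {gen (lscale L c x) - const c * gen x | c x. x \<in> superspace L} \<union>
    {gen x * gen y - const (koszul i j) * gen y * gen x - gen (bracket L x y) | x y i j.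
      x \<in> part L i \<and> y \<in> part L j} \<union>
    {gen x * gen x - gen (square L x) | x. x \<in> part L 1}"

definition env_ideal :: "('k::field, 's::ab_group_add) superalgebra \<Rightarrow> ('k, 's) free_algebra set"
  where "env_ideal L = genideal (free_algebra (superspace L)) (env_rels L)"

definition env :: "('k::field, 's::ab_group_add) superalgebra \<Rightarrow> ('k, 's) env ring"
  where "env L = free_algebra (superspace L) Quot env_ideal L"

definition env_class ::
    "('k::field, 's::ab_group_add) superalgebra \<Rightarrow> ('k, 's) free_algebra \<Rightarrow> ('k, 's) env"
  where "env_class L p = env_ideal L +>\<^bsub>free_algebra (superspace L)\<^esub> p"

definition env_part :: "('k::field, 's::ab_group_add) superalgebra \<Rightarrow> bit \<Rightarrow> ('k, 's) env set"
  where "env_part L i = env_class L `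
    {p. \<forall>w\<in>Poly_Mapping.keys p. \<exists>ds. list_all2 (\<lambda>x d. x \<in> part L d) (letters w) ds \<and> sum_list ds = i}"

text \<open>The canonical map to \<^term>\<open>env L\<close> from the enveloping algebra of a subalgebra.\<close>

definition env_map :: "('k::field, 's::ab_group_add) superalgebra \<Rightarrow> ('k, 's) env \<Rightarrow> ('k, 's) env"
  where "env_map L u = env_class L (rep u)"

definition env_scale ::
    "('k::field, 's::ab_group_add) superalgebra \<Rightarrow> (('k, 's) env, 'a, 'y) module_scheme \<Rightarrow> 'k \<Rightarrow> 'a \<Rightarrow> 'a"
  where "env_scale L M c x = env_class L (const c) \<odot>\<^bsub>M\<^esub> x"

definition env_finite_dimensional ::
    "('k::field, 's::ab_group_add) superalgebra \<Rightarrow> (('k, 's) env, 'a, 'y) module_scheme \<Rightarrow> bool"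
  where "env_finite_dimensional L M \<longleftrightarrow>
    (\<exists>B. finite B \<and> B \<subseteq> carrier M \<and>
      (\<forall>x\<in>carrier M. \<exists>c. x = (\<Oplus>\<^bsub>M\<^esub>b\<in>B. env_scale L M (c b) b)))"

text \<open>
  Up to isomorphism, all simple and all finite dimensional modules over an enveloping algebra are
  found on the single type \<open>('k, 's) free_algebra\<close>.
\<close>

lemma simple_module_on_free_algebra:
  fixes L :: "('k::field, 's::ab_group_add) superalgebra"
  assumes S: "simple_module (env L) S"
  shows "\<exists>(S' :: (('k, 's) env, ('k, 's) free_algebra) module) f. simple_module (env L) S' \<and>
    f \<in> left_module_hom (env L) S S' \<and> bij_betw f (carrier S) (carrier S')"
proof -
  interpret left_module "env L" S using S by (simp add: simple_module_def)
  obtain s where s: "s \<in> carrier S" "s \<noteq> \<zero>\<^bsub>S\<^esub>"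
    using S M.zero_closed unfolding simple_module_def by blast
  let ?N = "(\<lambda>u. u \<odot>\<^bsub>S\<^esub> s) ` carrier (env L)"
  have z: "\<zero>\<^bsub>env L\<^esub> \<odot>\<^bsub>S\<^esub> s = \<zero>\<^bsub>S\<^esub>"
    using smult_l_distr[of "\<zero>\<^bsub>env L\<^esub>" "\<zero>\<^bsub>env L\<^esub>" s] s(1) smult_closed[OF R.zero_closed s(1)]
    by (metis M.add.l_cancel_one R.l_zero R.zero_closed)
  have "submodule ?N (env L) S"
    unfolding submodule_iff
  proof (intro conjI ballI)
    show "?N \<subseteq> carrier S" using s smult_closed by blast
    show "\<zero>\<^bsub>S\<^esub> \<in> ?N" using z by (metis R.zero_closed imageI)
  next
    fix x y assume "x \<in> ?N" "y \<in> ?N"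
    then obtain u v where "u \<in> carrier (env L)" "v \<in> carrier (env L)"
      "x = u \<odot>\<^bsub>S\<^esub> s" "y = v \<odot>\<^bsub>S\<^esub> s" by blast
    then show "x \<oplus>\<^bsub>S\<^esub> y \<in> ?N" using smult_l_distr s by (metis R.a_closed imageI)
  next
    fix a x assume "a \<in> carrier (env L)" "x \<in> ?N"
    moreover then obtain u where "u \<in> carrier (env L)" "x = u \<odot>\<^bsub>S\<^esub> s" by blast
    ultimately have "a \<otimes>\<^bsub>env L\<^esub> u \<in> carrier (env L)" "a \<odot>\<^bsub>S\<^esub> x = (a \<otimes>\<^bsub>env L\<^esub> u) \<odot>\<^bsub>S\<^esub> s"
      using smult_assoc s(1) by auto
    then show "a \<odot>\<^bsub>S\<^esub> x \<in> ?N" by blast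
  qed
  moreover have "s \<in> ?N" using smult_one s by (metis R.one_closed imageI)
  ultimately have N: "?N = carrier S" using S s by (auto simp: simple_module_def)
  define f where "f x = (SOME p. env_class L p \<odot>\<^bsub>S\<^esub> s = x)" for x
  have f: "env_class L (f x) \<odot>\<^bsub>S\<^esub> s = x" if "x \<in> carrier S" for x
  proof -
    have "x \<in> ?N" using that by (simp only: N)
    then obtain u where u: "u \<in> carrier (env L)" "x = u \<odot>\<^bsub>S\<^esub> s" by (rule imageE) auto
    from u(1) obtain p where "u = env_class L p"
      by (auto simp: env_def FactRing_def A_RCOSETS_def RCOSETS_def env_class_def a_r_coset_def)
    then have "env_class L p \<odot>\<^bsub>S\<^esub> s = x" using u(2) by simp
    then show ?thesis unfolding f_def by (rule someI)
  qed
  then have inj: "inj_on f (carrier S)" by (rule inj_on_inverseI)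
  show ?thesis
    using transported[OF inj] simple_module_iso[OF S] by blast
qed

lemma env_class_closed:
  assumes "p \<in> carrier (free_algebra (superspace L))"
  shows "env_class L p \<in> carrier (env L)"
  using assms by (auto simp: env_def FactRing_def A_RCOSETS_def RCOSETS_def env_class_def a_r_coset_def)

lemma const_closed: "const c \<in> carrier (free_algebra X)"
  by (simp add: free_algebra_def const_def zero_monomial_def)

lemma env_finite_dimensional_iso:
  assumes M: "left_module (env L) M" and N: "left_module (env L) N"
    and f: "f \<in> left_module_hom (env L) M N" and b: "bij_betw f (carrier M) (carrier N)"
    and fd: "env_finite_dimensional L M"
  shows "env_finite_dimensional L N"
proof -
  interpret M: left_module "env L" M by fact
  interpret N: left_module "env L" N by fact
  have inj: "inj_on f (carrier M)" using b by (simp add: bij_betw_def)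
  have cl: "f x \<in> carrier N" if "x \<in> carrier M" for x using that b by (auto simp: bij_betw_def)
  note k = env_class_closed[OF const_closed, of L]
  obtain B where B: "finite B" "B \<subseteq> carrier M"
    and ex: "\<And>x. x \<in> carrier M \<Longrightarrow> \<exists>c. x = (\<Oplus>\<^bsub>M\<^esub>b\<in>B. env_scale L M (c b) b)"
    using fd unfolding env_finite_dimensional_def by blast
  have add: "f (x \<oplus>\<^bsub>M\<^esub> y) = f x \<oplus>\<^bsub>N\<^esub> f y" if "x \<in> carrier M" "y \<in> carrier M" for x y
    using f that by (auto simp: left_module_hom_def hom_def)
  have zero: "f \<zero>\<^bsub>M\<^esub> = \<zero>\<^bsub>N\<^esub>"
    using add[of "\<zero>\<^bsub>M\<^esub>" "\<zero>\<^bsub>M\<^esub>"] cl[of "\<zero>\<^bsub>M\<^esub>"] by simp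
  have fsum: "f (\<Oplus>\<^bsub>M\<^esub>b\<in>A. h b) = (\<Oplus>\<^bsub>N\<^esub>b\<in>A. f (h b))" if "finite A" "h \<in> A \<rightarrow> carrier M" for A h
    using that
  proof (induction A rule: finite_induct)
    case empty
    then show ?case by (simp add: zero)
  next
    case (insert a A)
    have "f (h a \<oplus>\<^bsub>M\<^esub> (\<Oplus>\<^bsub>M\<^esub>b\<in>A. h b)) = f (h a) \<oplus>\<^bsub>N\<^esub> f (\<Oplus>\<^bsub>M\<^esub>b\<in>A. h b)"
      using insert.prems by (intro add M.M.finsum_closed) auto
    then show ?case
      using insert cl by (simp add: Pi_def)
  qed
  show ?thesis
    unfolding env_finite_dimensional_def
  proof (intro exI[of _ "f ` B"] conjI ballI)
    show "finite (f ` B)" "f ` B \<subseteq> carrier N" using B cl by auto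
    fix y assume "y \<in> carrier N"
    then obtain x where x: "x \<in> carrier M" "y = f x" using b by (auto simp: bij_betw_def)
    then obtain c where c: "x = (\<Oplus>\<^bsub>M\<^esub>b\<in>B. env_scale L M (c b) b)" using ex by blast
    have sc: "env_scale L M (c b) b \<in> carrier M" if "b \<in> B" for b
      using that B k by (auto simp: env_scale_def M.smult_closed)
    have injB: "inj_on f B" using inj B(2) by (rule inj_on_subset)
    have "y = (\<Oplus>\<^bsub>N\<^esub>b\<in>B. f (env_scale L M (c b) b))"
      unfolding x(2) c using B(1) sc by (intro fsum) auto
    also have "\<dots> = (\<Oplus>\<^bsub>N\<^esub>b\<in>B. env_scale L N (c (the_inv_into B f (f b))) (f b))"
      using f B k cl sc
      by (intro N.M.finsum_cong')
        (auto simp: env_scale_def left_module_hom_def subset_iff N.smult_closed the_inv_into_f_f[OF injB])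
    also have "\<dots> = (\<Oplus>\<^bsub>N\<^esub>b\<in>f ` B. env_scale L N (c (the_inv_into B f b)) b)"
      using B k cl injB
      by (intro N.M.add.finprod_reindex[symmetric]) (auto simp: env_scale_def subset_iff N.smult_closed)
    finally show "\<exists>c. y = (\<Oplus>\<^bsub>N\<^esub>b\<in>f ` B. env_scale L N (c b) b)"
      by (intro exI[of _ "\<lambda>b. c (the_inv_into B f b)"])
  qed
qed

lemma env_finite_dimensional_on_free_algebra:
  fixes L :: "('k::field, 's::ab_group_add) superalgebra"
  assumes E: "left_module (env L) E" and fd: "env_finite_dimensional L E"
  shows "\<exists>(E' :: (('k, 's) env, ('k, 's) free_algebra) module) f. left_module (env L) E' \<and>
    env_finite_dimensional L E' \<and> f \<in> left_module_hom (env L) E E' \<and> bij_betw f (carrier E) (carrier E')"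
proof -
  interpret left_module "env L" E by fact
  obtain B where B: "finite B" "B \<subseteq> carrier E"
    and ex: "\<forall>x\<in>carrier E. \<exists>c. x = (\<Oplus>\<^bsub>E\<^esub>b\<in>B. env_scale L E (c b) b)"
    using fd unfolding env_finite_dimensional_def by blast
  from ex obtain c where c: "\<And>x. x \<in> carrier E \<Longrightarrow> x = (\<Oplus>\<^bsub>E\<^esub>b\<in>B. env_scale L E (c x b) b)"
    by metis
  obtain i :: "_ \<Rightarrow> nat" where i: "inj_on i B"
    using finite_imp_inj_to_nat_seg[OF B(1)] by blast
  define w :: "_ \<Rightarrow> 's monomial" where "w b = Monomial (replicate (i b) 0)" for b
  have w: "w b = w b' \<longleftrightarrow> b = b'" if "b \<in> B" "b' \<in> B" for b b'
    using that i by (auto simp: w_def inj_on_def dest: arg_cong[where f = length])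
  define f :: "_ \<Rightarrow> ('k, 's) free_algebra"
    where "f x = (\<Sum>b\<in>B. Poly_Mapping.single (w b) (c x b))" for x
  have l: "Poly_Mapping.lookup (f x) (w b) = c x b" if "b \<in> B" for x b
  proof -
    have "Poly_Mapping.lookup (f x) (w b) = (\<Sum>b'\<in>B. if b' = b then c x b' else 0)"
      unfolding f_def lookup_sum by (intro sum.cong refl) (simp add: lookup_single when_def w that)
    then show ?thesis using that B(1) by simp
  qed
  have "inj_on f (carrier E)"
  proof (intro inj_onI)
    fix x y assume xy: "x \<in> carrier E" "y \<in> carrier E" "f x = f y"
    then have eq: "c x b = c y b" if "b \<in> B" for b
      using l[OF that, of x] l[OF that, of y] xy(3) by simp
    have "(\<Oplus>\<^bsub>E\<^esub>b\<in>B. env_scale L E (c x b) b) = (\<Oplus>\<^bsub>E\<^esub>b\<in>B. env_scale L E (c y b) b)"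
      using eq B(2) env_class_closed[OF const_closed, of L] by (intro M.finsum_cong') (auto simp: env_scale_def smult_closed)
    then show "x = y" using c[OF xy(1)] c[OF xy(2)] by simp
  qed
  then show ?thesis using transported env_finite_dimensional_iso[OF E _ _ _ fd] by blast
qed

text \<open>
  The module \<open>S \<otimes>\<^sub>k E\<close> over the enveloping algebra of a Lie algebra \<open>L\<close> (that is, the odd part
  of \<open>L\<close> is zero): an element \<open>x\<close> of \<open>L\<close> acts by \<open>s \<otimes> e \<mapsto> x s \<otimes> e + s \<otimes> x e\<close>, and a
  noncommutative polynomial acts by substituting these operators for its variables.
\<close>

definition tensor_leibniz ::
    "('k::field, 's::ab_group_add) superalgebra \<Rightarrow>
      (('k, 's) env, 'a, 'y) module_scheme \<Rightarrow> (('k, 's) env, 'b, 'z) module_scheme \<Rightarrow>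
      's \<Rightarrow> ('a \<times> 'b \<Rightarrow>\<^sub>0 int) \<Rightarrow> ('a \<times> 'b \<Rightarrow>\<^sub>0 int)"
  where "tensor_leibniz L S E x = frag_extend (\<lambda>(s, e).
    frag_of (env_class L (gen x) \<odot>\<^bsub>S\<^esub> s, e) + frag_of (s, env_class L (gen x) \<odot>\<^bsub>E\<^esub> e))"

definition tensor_action ::
    "('k::field, 's::ab_group_add) superalgebra \<Rightarrow>
      (('k, 's) env, 'a, 'y) module_scheme \<Rightarrow> (('k, 's) env, 'b, 'z) module_scheme \<Rightarrow>
      ('k, 's) free_algebra \<Rightarrow> ('a \<times> 'b \<Rightarrow>\<^sub>0 int) \<Rightarrow> ('a \<times> 'b \<Rightarrow>\<^sub>0 int)"
  where "tensor_action L S E p f =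
    (\<Sum>w\<in>Poly_Mapping.keys p.
      frag_extend (\<lambda>(s, e). frag_of (env_scale L S (Poly_Mapping.lookup p w) s, e))
        (foldr (tensor_leibniz L S E) (letters w) f))"

definition tensor_module ::
    "('k::field, 's::ab_group_add) superalgebra \<Rightarrow>
      (('k, 's) env, 'a, 'y) module_scheme \<Rightarrow> (('k, 's) env, 'b, 'z) module_scheme \<Rightarrow>
      (('k, 's) env, ('a \<times> 'b \<Rightarrow>\<^sub>0 int) set) module"
  where "tensor_module L S E =
    presented_module (carrier S \<times> carrier E)
      (tensor_null UNIV (\<lambda>s c. env_scale L S c s) (env_scale L E) S E)
      (\<lambda>u. tensor_action L S E (rep u))"

text \<open>\<open>U(\<ss>\<^sub>0)\<close>, and the module induced to \<open>U(\<ss>)\<close> with its grading.\<close>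

abbreviation env_even :: "('k::field, 's::ab_group_add) superalgebra \<Rightarrow> ('k, 's) env ring"
  where "env_even \<ss> \<equiv> env (even_subalgebra \<ss>)"

abbreviation env_induced ::
    "('k::field, 's::ab_group_add) superalgebra \<Rightarrow> (('k, 's) env, 'm, 'z) module_scheme \<Rightarrow>
      (('k, 's) env, (('k, 's) env \<times> 'm \<Rightarrow>\<^sub>0 int) set) module"
  where "env_induced \<ss> L \<equiv> induced_module (env \<ss>) (env_even \<ss>) (env_map \<ss>) L"

abbreviation env_induced_grading ::
    "('k::field, 's::ab_group_add) superalgebra \<Rightarrow> (('k, 's) env, 'm, 'z) module_scheme \<Rightarrow>
      (bit \<Rightarrow> 'm set) \<Rightarrow> bit \<Rightarrow> (('k, 's) env \<times> 'm \<Rightarrow>\<^sub>0 int) set set"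
  where "env_induced_grading \<ss> L H \<equiv>
    induced_grading (env \<ss>) (env_part \<ss>) (env_even \<ss>) (env_map \<ss>) L H"

end

theory Submission
  imports Defs
begin

text \<open>
  Let \<open>U\<close> be the enveloping algebra of the even part, and let \<open>M\<close> be a simple module over the
  enveloping algebra of \<open>\<ss>\<close>. By adjunction a homomorphism from an induced module to \<open>M\<close> is the same
  as a \<open>U\<close>-homomorphism \<open>L \<rightarrow> M\<close>, and a non-zero one is onto because \<open>M\<close> is simple. So all that is
  needed is a simple \<open>U\<close>-submodule \<open>L\<close> of \<open>M\<close> (\<open>induced_hom\<close>).

  It is found inside a tensor product with finite type socle. As in the Poincare-Birkhoff-Witt
  theorem, a word in odd basis elements that is longer than the dimension of the odd part contains a
  repeated letter; moving the two copies together and replacing \<open>x x\<close> by the even element \<open>x\<^sup>2\<close>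
  shortens it. Hence the enveloping algebra of \<open>\<ss>\<close> is \<open>U V\<close>, where \<open>V\<close> is the finite dimensional space
  spanned by the products of a bounded number of odd elements (\<open>Y_eq_F\<close>). This \<open>V\<close> is stable under
  commutators with even elements (\<open>V_ad\<close>). Consequently \<open>M\<close> is finitely generated over \<open>U\<close> and has a
  simple quotient \<open>f : M \<rightarrow> S\<close> over \<open>U\<close>, and the map
  \<open>m \<mapsto> (v \<mapsto> f (v m))\<close> is a \<open>U\<close>-homomorphism from \<open>M\<close> to \<open>Hom(V, S) = S \<otimes> V\<^sup>*\<close>, since the
  commutator of \<open>y\<close> and \<open>v\<close> is exactly what the dual action on \<open>V\<^sup>*\<close> accounts for (\<open>embed_hom\<close>). Its
  kernel consists of the vectors whose orbit under \<open>U V\<close> stays in the kernel of \<open>f\<close>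
  (\<open>embed_zeroD\<close> and \<open>even_submodule_contains_orbit\<close>), and these form a proper submodule of \<open>M\<close>,
  which is zero. So \<open>M\<close> embeds in \<open>S \<otimes> V\<^sup>*\<close>. There every non-zero submodule meets the socle, which has finite length,
  and therefore contains a simple submodule (\<open>restriction_has_simple_submodule\<close>). In fact this shows
  that every non-zero \<open>U\<close>-submodule of \<open>M\<close> contains a simple one.

  In the graded case \<open>M\<close> may fail to be simple without the grading. Choosing the kernel of \<open>f\<close> to
  contain one homogeneous component of \<open>M\<close> makes the kernel of the embedding a graded submodule
  (\<open>graded_core\<close>), and the simple \<open>U\<close>-submodule can be taken inside the other component.

  The argument works in every characteristic, because \<open>V\<close> is spanned by all words of bounded length
  instead of antisymmetrised products; \<open>word_basis\<close> selects a basis from the words.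
\<close>

section \<open>Modules\<close>

text \<open>
  The quotient of a group \<open>G\<close> by \<open>N\<close> on which a scalar \<open>a\<close> acts through \<open>act a\<close>. Both the presented
  modules and the quotient of a module by a submodule are of this form.
\<close>

definition coset_module ::
    "('a, 'x) monoid_scheme \<Rightarrow> 'a set \<Rightarrow> ('r \<Rightarrow> 'a \<Rightarrow> 'a) \<Rightarrow> ('r, 'a set) module"
  where "coset_module G N act =
    \<lparr>carrier = carrier (G Mod N), mult = undefined, one = undefined,
     ring.zero = N, add = (\<lambda>A B. A <#>\<^bsub>G\<^esub> B),
     smult = (\<lambda>a A. N #>\<^bsub>G\<^esub> act a (rep A))\<rparr>"

lemma presented_module_eq_coset_module:
  "presented_module X N act = coset_module (free_Abelian_group X) N act"
  by (simp add: presented_module_def coset_module_def)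

locale comm_group_mod = G?: comm_group G + subgroup N G for N and G (structure)
begin

lemma normal_N: "N \<lhd> G"
  using subgroup_imp_normal subgroup_axioms .

lemma coset_eq_iff:
  assumes "x \<in> carrier G" "y \<in> carrier G"
  shows "N #> x = N #> y \<longleftrightarrow> x \<otimes> inv y \<in> N"
proof
  assume "N #> x = N #> y"
  then have "x \<in> N #> y" using rcos_self[OF assms(1) subgroup_axioms] by simp
  then show "x \<otimes> inv y \<in> N" using rcos_module_imp[OF group_axioms assms(2)] by simp
next
  assume "x \<otimes> inv y \<in> N"
  then have "x \<in> N #> y" using rcos_module_rev[OF group_axioms assms(2) assms(1)] by simp
  then show "N #> x = N #> y" using repr_independence[OF _ assms(2) subgroup_axioms] by simp
qed

lemma coset_mult: 
  "x \<in> carrier G \<Longrightarrow> y \<in> carrier G \<Longrightarrow> (N #> x) <#> (N #> y) = N #> (x \<otimes> y)"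
  using normal.rcos_sum[OF normal_N] .

lemma coset_eq_N_iff: "x \<in> carrier G \<Longrightarrow> N #> x = N \<longleftrightarrow> x \<in> N"
  using coset_eq_iff[of x \<one>] coset_mult_one[OF subset] by simp

lemma cosetE:
  assumes "A \<in> carrier (coset_module G N act)"
  obtains g where "g \<in> carrier G" "A = N #> g"
  using assms by (auto simp: coset_module_def carrier_FactGroup)

lemma coset_closed: "g \<in> carrier G \<Longrightarrow> N #> g \<in> carrier (coset_module G N act)"
  by (auto simp: coset_module_def carrier_FactGroup)

lemma rep_coset:
  assumes "g \<in> carrier G"
  shows "rep (N #> g) \<in> carrier G" "N #> rep (N #> g) = N #> g"
proof -
  have "g \<in> N #> g" using rcos_self[OF assms subgroup_axioms] .
  then have r: "rep (N #> g) \<in> N #> g" unfolding rep_def by (rule someI)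
  show c: "rep (N #> g) \<in> carrier G" using elemrcos_carrier[OF group_axioms assms r] .
  show "N #> rep (N #> g) = N #> g"
    using repr_independence[OF r assms subgroup_axioms] by simp
qed

lemma zero_coset_module: "\<zero>\<^bsub>coset_module G N act\<^esub> = N"
  by (simp add: coset_module_def)

lemma add_coset:
  assumes "x \<in> carrier G" "y \<in> carrier G"
  shows "(N #> x) \<oplus>\<^bsub>coset_module G N act\<^esub> (N #> y) = N #> (x \<otimes> y)"
  using coset_mult[OF assms] by (simp add: coset_module_def)

lemma abelian_group_coset_module: "abelian_group (coset_module G N act)"
proof (rule abelian_groupI)
  fix x y assume "x \<in> carrier (coset_module G N act)" "y \<in> carrier (coset_module G N act)"
  then obtain g h where "g \<in> carrier G" "x = N #> g" "h \<in> carrier G" "y = N #> h"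
    by (elim cosetE)
  then show "x \<oplus>\<^bsub>coset_module G N act\<^esub> y \<in> carrier (coset_module G N act)"
    using coset_closed[OF G.m_closed] by (simp add: add_coset)
next
  show "\<zero>\<^bsub>coset_module G N act\<^esub> \<in> carrier (coset_module G N act)"
    using coset_closed[OF G.one_closed] coset_mult_one[OF subset]
    by (simp add: zero_coset_module)
next
  fix x y z assume "x \<in> carrier (coset_module G N act)" "y \<in> carrier (coset_module G N act)"
    "z \<in> carrier (coset_module G N act)"
  then show "x \<oplus>\<^bsub>coset_module G N act\<^esub> y \<oplus>\<^bsub>coset_module G N act\<^esub> z =
      x \<oplus>\<^bsub>coset_module G N act\<^esub> (y \<oplus>\<^bsub>coset_module G N act\<^esub> z)"
    by (elim cosetE) (simp add: add_coset m_assoc)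
next
  fix x y assume "x \<in> carrier (coset_module G N act)" "y \<in> carrier (coset_module G N act)"
  then show "x \<oplus>\<^bsub>coset_module G N act\<^esub> y = y \<oplus>\<^bsub>coset_module G N act\<^esub> x"
    by (elim cosetE) (simp add: add_coset m_comm)
next
  fix x assume "x \<in> carrier (coset_module G N act)"
  then obtain g where g: "g \<in> carrier G" "x = N #> g" by (elim cosetE)
  show "\<zero>\<^bsub>coset_module G N act\<^esub> \<oplus>\<^bsub>coset_module G N act\<^esub> x = x"
    using add_coset[OF G.one_closed g(1)] g coset_mult_one[OF subset]
    by (simp add: zero_coset_module)
  have "(N #> inv g) \<oplus>\<^bsub>coset_module G N act\<^esub> x = \<zero>\<^bsub>coset_module G N act\<^esub>"
    using add_coset[of "inv g" g] g coset_mult_one[OF subset]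
    by (simp add: zero_coset_module)
  then show "\<exists>y\<in>carrier (coset_module G N act).
      y \<oplus>\<^bsub>coset_module G N act\<^esub> x = \<zero>\<^bsub>coset_module G N act\<^esub>"
    using coset_closed[of "inv g"] g by blast
qed

lemma smult_coset_closed:
  assumes "\<And>g. g \<in> carrier G \<Longrightarrow> act a g \<in> carrier G" "A \<in> carrier (coset_module G N act)"
  shows "a \<odot>\<^bsub>coset_module G N act\<^esub> A \<in> carrier (coset_module G N act)"
proof -
  obtain g where g: "g \<in> carrier G" "A = N #> g" using assms(2) by (elim cosetE)
  then have "N #> act a (rep A) \<in> carrier (coset_module G N act)"
    using coset_closed assms(1) rep_coset by blast
  then show ?thesis by (simp add: coset_module_def)
qed

lemma smult_coset:
  assumes cl: "\<And>g. g \<in> carrier G \<Longrightarrow> act a g \<in> carrier G"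
    and mult: "\<And>g h. g \<in> carrier G \<Longrightarrow> h \<in> carrier G \<Longrightarrow> act a (g \<otimes> h) = act a g \<otimes> act a h"
    and N: "\<And>g. g \<in> N \<Longrightarrow> act a g \<in> N" and g: "g \<in> carrier G"
  shows "a \<odot>\<^bsub>coset_module G N act\<^esub> (N #> g) = N #> act a g"
proof -
  define r where "r = rep (N #> g)"
  have r: "r \<in> carrier G" "N #> r = N #> g" using rep_coset[OF g] by (auto simp: r_def)
  then have n: "r \<otimes> inv g \<in> N" using coset_eq_iff g by simp
  have "act a r = act a ((r \<otimes> inv g) \<otimes> g)" using r g by (simp add: m_assoc)
  also have "\<dots> = act a (r \<otimes> inv g) \<otimes> act a g" using r g mult by simp
  finally have "act a r \<otimes> inv (act a g) = act a (r \<otimes> inv g)"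
    using cl r g by (simp add: m_assoc)
  then have "N #> act a r = N #> act a g"
    using coset_eq_iff[OF cl cl] r g N[OF n] by simp
  then show ?thesis by (simp add: coset_module_def r_def)
qed

text \<open>
  The operators \<open>act a\<close> satisfy the module axioms only modulo \<open>N\<close>: on generators and relations a
  product of scalars need not act as the composite, only on the quotient it does.
\<close>

lemma left_module_coset_module:
  assumes R: "ring R"
    and cl: "\<And>a g. a \<in> carrier R \<Longrightarrow> g \<in> carrier G \<Longrightarrow> act a g \<in> carrier G"
    and mult: "\<And>a g h. a \<in> carrier R \<Longrightarrow> g \<in> carrier G \<Longrightarrow> h \<in> carrier G \<Longrightarrow>
      act a (g \<otimes> h) = act a g \<otimes> act a h"
    and N: "\<And>a g. a \<in> carrier R \<Longrightarrow> g \<in> N \<Longrightarrow> act a g \<in> N"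
    and add: "\<And>a b g. a \<in> carrier R \<Longrightarrow> b \<in> carrier R \<Longrightarrow> g \<in> carrier G \<Longrightarrow>
      N #> act (a \<oplus>\<^bsub>R\<^esub> b) g = N #> (act a g \<otimes> act b g)"
    and assoc: "\<And>a b g. a \<in> carrier R \<Longrightarrow> b \<in> carrier R \<Longrightarrow> g \<in> carrier G \<Longrightarrow>
      N #> act (a \<otimes>\<^bsub>R\<^esub> b) g = N #> act a (act b g)"
    and one: "\<And>g. g \<in> carrier G \<Longrightarrow> N #> act \<one>\<^bsub>R\<^esub> g = N #> g"
  shows "left_module R (coset_module G N act)"
proof -
  interpret R: ring R by fact
  let ?M = "coset_module G N act"
  have sc: "a \<odot>\<^bsub>?M\<^esub> (N #> g) = N #> act a g" if "a \<in> carrier R" "g \<in> carrier G" for a g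
    using that by (intro smult_coset cl mult N)
  have ac: "(N #> g) \<oplus>\<^bsub>?M\<^esub> (N #> h) = N #> (g \<otimes> h)" if "g \<in> carrier G" "h \<in> carrier G" for g h
    using add_coset[OF that] .
  show ?thesis
  proof (intro left_module.intro left_module_axioms.intro R abelian_group_coset_module)
    fix a x assume "a \<in> carrier R" "x \<in> carrier ?M"
    then show "a \<odot>\<^bsub>?M\<^esub> x \<in> carrier ?M" by (intro smult_coset_closed cl)
  next
    fix a b x assume ab: "a \<in> carrier R" "b \<in> carrier R" and "x \<in> carrier ?M"
    then obtain g where g: "g \<in> carrier G" "x = N #> g" by (elim cosetE)
    show "(a \<oplus>\<^bsub>R\<^esub> b) \<odot>\<^bsub>?M\<^esub> x = a \<odot>\<^bsub>?M\<^esub> x \<oplus>\<^bsub>?M\<^esub> b \<odot>\<^bsub>?M\<^esub> x"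
      unfolding g(2) sc[OF R.a_closed[OF ab] g(1)] sc[OF ab(1) g(1)] sc[OF ab(2) g(1)]
        ac[OF cl[OF ab(1) g(1)] cl[OF ab(2) g(1)]] add[OF ab g(1)] ..
  next
    fix a x y assume a: "a \<in> carrier R" and "x \<in> carrier ?M" "y \<in> carrier ?M"
    then obtain g h where g: "g \<in> carrier G" "x = N #> g" and h: "h \<in> carrier G" "y = N #> h"
      by (elim cosetE)
    show "a \<odot>\<^bsub>?M\<^esub> (x \<oplus>\<^bsub>?M\<^esub> y) = a \<odot>\<^bsub>?M\<^esub> x \<oplus>\<^bsub>?M\<^esub> a \<odot>\<^bsub>?M\<^esub> y"
      unfolding g(2) h(2) ac[OF g(1) h(1)] sc[OF a g(1)] sc[OF a h(1)]
        sc[OF a G.m_closed[OF g(1) h(1)]] mult[OF a g(1) h(1)] ac[OF cl[OF a g(1)] cl[OF a h(1)]] ..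
  next
    fix a b x assume ab: "a \<in> carrier R" "b \<in> carrier R" and "x \<in> carrier ?M"
    then obtain g where g: "g \<in> carrier G" "x = N #> g" by (elim cosetE)
    show "(a \<otimes>\<^bsub>R\<^esub> b) \<odot>\<^bsub>?M\<^esub> x = a \<odot>\<^bsub>?M\<^esub> (b \<odot>\<^bsub>?M\<^esub> x)"
      unfolding g(2) sc[OF R.m_closed[OF ab] g(1)] sc[OF ab(2) g(1)]
        sc[OF ab(1) cl[OF ab(2) g(1)]] assoc[OF ab g(1)] ..
  next
    fix x assume "x \<in> carrier ?M"
    then obtain g where g: "g \<in> carrier G" "x = N #> g" by (elim cosetE)
    show "\<one>\<^bsub>R\<^esub> \<odot>\<^bsub>?M\<^esub> x = x"
      unfolding g(2) sc[OF R.one_closed g(1)] one[OF g(1)] ..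
  qed
qed

lemma coset_lift:
  assumes M: "abelian_group M" and h: "h \<in> hom G (add_monoid M)"
    and N: "\<And>g. g \<in> N \<Longrightarrow> h g = \<zero>\<^bsub>M\<^esub>"
  shows "g \<in> carrier G \<Longrightarrow> h (rep (N #> g)) = h g"
    and "(\<lambda>A. h (rep A)) \<in> hom (add_monoid (coset_module G N act)) (add_monoid M)"
proof -
  interpret M: abelian_group M by fact
  have cl: "h g \<in> carrier M" if "g \<in> carrier G" for g using h that by (auto simp: hom_def)
  have mult: "h (x \<otimes> y) = h x \<oplus>\<^bsub>M\<^esub> h y" if "x \<in> carrier G" "y \<in> carrier G" for x y
    using h that by (auto simp: hom_def)
  show *: "h (rep (N #> g)) = h g" if g: "g \<in> carrier G" for g
  proof -
    define r where "r = rep (N #> g)"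
    have r: "r \<in> carrier G" "N #> r = N #> g" using rep_coset[OF g] by (auto simp: r_def)
    then have n: "r \<otimes> inv g \<in> N" using coset_eq_iff g by simp
    have "h r = h ((r \<otimes> inv g) \<otimes> g)" using r g by (simp add: m_assoc)
    also have "\<dots> = h (r \<otimes> inv g) \<oplus>\<^bsub>M\<^esub> h g" using r g by (intro mult) auto
    finally show ?thesis using N[OF n] cl g by (simp add: r_def)
  qed
  show "(\<lambda>A. h (rep A)) \<in> hom (add_monoid (coset_module G N act)) (add_monoid M)"
    by (auto simp: hom_def elim!: cosetE) (simp_all add: * add_coset cl mult)
qed

end


context left_module begin

lemma smult_zero_left: "x \<in> carrier M \<Longrightarrow> \<zero> \<odot>\<^bsub>M\<^esub> x = \<zero>\<^bsub>M\<^esub>"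
  using smult_l_distr[of \<zero> \<zero> x] smult_closed[OF R.zero_closed, of x]
  by (metis M.add.l_cancel_one R.l_zero R.zero_closed)

lemma smult_zero_right: "a \<in> carrier R \<Longrightarrow> a \<odot>\<^bsub>M\<^esub> \<zero>\<^bsub>M\<^esub> = \<zero>\<^bsub>M\<^esub>"
  using smult_r_distr[of a "\<zero>\<^bsub>M\<^esub>" "\<zero>\<^bsub>M\<^esub>"] smult_closed[of a "\<zero>\<^bsub>M\<^esub>"]
  by (metis M.add.l_cancel_one M.l_zero M.zero_closed)

lemma submodule_carrier: "submodule (carrier M) R M"
  by (auto simp: submodule_iff smult_closed)

lemma submodule_zero: "submodule {\<zero>\<^bsub>M\<^esub>} R M"
  by (auto simp: submodule_iff smult_zero_right)

lemma submodule_minus: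
  assumes "submodule N R M" "x \<in> N" shows "\<ominus>\<^bsub>M\<^esub> x \<in> N"
proof -
  interpret submodule N R M by fact
  show ?thesis using m_inv_closed[OF assms(2)] by (simp add: a_inv_def)
qed

lemma submodule_Int:
  "submodule K R M \<Longrightarrow> submodule N R M \<Longrightarrow> submodule (K \<inter> N) R M"
  unfolding submodule_iff by auto

lemma submodule_sum:
  assumes K: "submodule K R M" and N: "submodule N R M"
  shows "submodule {x \<oplus>\<^bsub>M\<^esub> y | x y. x \<in> K \<and> y \<in> N} R M"
proof -
  have K': "K \<subseteq> carrier M" and N': "N \<subseteq> carrier M" using K N by (auto simp: submodule_iff)
  show ?thesis
    unfolding submodule_iff
  proof (intro conjI ballI)
    show "{x \<oplus>\<^bsub>M\<^esub> y | x y. x \<in> K \<and> y \<in> N} \<subseteq> carrier M" using K' N' by auto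
    show "\<zero>\<^bsub>M\<^esub> \<in> {x \<oplus>\<^bsub>M\<^esub> y | x y. x \<in> K \<and> y \<in> N}"
      using K N by (intro CollectI exI[of _ "\<zero>\<^bsub>M\<^esub>"]) (simp add: submodule_iff)
  next
    fix u v assume "u \<in> {x \<oplus>\<^bsub>M\<^esub> y | x y. x \<in> K \<and> y \<in> N}" "v \<in> {x \<oplus>\<^bsub>M\<^esub> y | x y. x \<in> K \<and> y \<in> N}"
    then obtain x y x' y' where *: "u = x \<oplus>\<^bsub>M\<^esub> y" "v = x' \<oplus>\<^bsub>M\<^esub> y'" "x \<in> K" "y \<in> N" "x' \<in> K" "y' \<in> N"
      by auto
    then have "u \<oplus>\<^bsub>M\<^esub> v = (x \<oplus>\<^bsub>M\<^esub> x') \<oplus>\<^bsub>M\<^esub> (y \<oplus>\<^bsub>M\<^esub> y')"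
      using K' N' by (simp add: M.a_ac subset_iff)
    moreover have "x \<oplus>\<^bsub>M\<^esub> x' \<in> K" "y \<oplus>\<^bsub>M\<^esub> y' \<in> N" using * K N by (auto simp: submodule_iff)
    ultimately show "u \<oplus>\<^bsub>M\<^esub> v \<in> {x \<oplus>\<^bsub>M\<^esub> y | x y. x \<in> K \<and> y \<in> N}" by blast
  next
    fix a u assume a: "a \<in> carrier R" and "u \<in> {x \<oplus>\<^bsub>M\<^esub> y | x y. x \<in> K \<and> y \<in> N}"
    then obtain x y where *: "u = x \<oplus>\<^bsub>M\<^esub> y" "x \<in> K" "y \<in> N" by auto
    then have "a \<odot>\<^bsub>M\<^esub> u = a \<odot>\<^bsub>M\<^esub> x \<oplus>\<^bsub>M\<^esub> a \<odot>\<^bsub>M\<^esub> y" using a K' N' by (simp add: smult_r_distr subset_iff)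
    moreover have "a \<odot>\<^bsub>M\<^esub> x \<in> K" "a \<odot>\<^bsub>M\<^esub> y \<in> N" using * a K N by (auto simp: submodule_iff)
    ultimately show "a \<odot>\<^bsub>M\<^esub> u \<in> {x \<oplus>\<^bsub>M\<^esub> y | x y. x \<in> K \<and> y \<in> N}" by blast
  qed
qed

lemma left_module_submodule:
  assumes "submodule K R M" shows "left_module R (M\<lparr>carrier := K\<rparr>)"
proof -
  have K: "K \<subseteq> carrier M" using assms by (simp add: submodule_iff)
  have ab: "abelian_group (M\<lparr>carrier := K\<rparr>)"
  proof (rule abelian_groupI)
    fix x assume "x \<in> carrier (M\<lparr>carrier := K\<rparr>)"
    then show "\<exists>y\<in>carrier (M\<lparr>carrier := K\<rparr>). y \<oplus>\<^bsub>M\<lparr>carrier := K\<rparr>\<^esub> x = \<zero>\<^bsub>M\<lparr>carrier := K\<rparr>\<^esub>"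
      using submodule_minus[OF assms, of x] K by (auto simp: M.l_neg subset_iff intro!: bexI[of _ "\<ominus>\<^bsub>M\<^esub> x"])
  qed (use assms K in \<open>auto simp: submodule_iff subset_iff M.a_ac\<close>)
  show ?thesis
    by (intro left_module.intro left_module_axioms.intro ab R.ring_axioms)
      (use assms K in \<open>auto simp: submodule_iff subset_iff smult_l_distr smult_r_distr smult_assoc smult_one\<close>)
qed

lemma submodule_restrict_iff:
  assumes "submodule K R M"
  shows "submodule J R (M\<lparr>carrier := K\<rparr>) \<longleftrightarrow> submodule J R M \<and> J \<subseteq> K"
proof -
  interpret K: left_module R "M\<lparr>carrier := K\<rparr>" using left_module_submodule[OF assms] .
  have K: "K \<subseteq> carrier M" using assms by (simp add: submodule_iff)
  show ?thesis unfolding K.submodule_iff submodule_iff using K by auto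
qed

lemma simple_submodule_iff:
  assumes "submodule K R M"
  shows "simple_module R (M\<lparr>carrier := K\<rparr>) \<longleftrightarrow>
    K \<noteq> {\<zero>\<^bsub>M\<^esub>} \<and> (\<forall>J. submodule J R M \<and> J \<subseteq> K \<longrightarrow> J = {\<zero>\<^bsub>M\<^esub>} \<or> J = K)"
  using left_module_submodule[OF assms]
  by (auto simp: simple_module_def submodule_restrict_iff[OF assms])

text \<open>
  The first member of the composition series that meets \<open>N\<close> non-trivially meets it in a simple
  submodule, since that intersection embeds in a simple composition factor.
\<close>

lemma finite_length_imp_simple_submodule:
  assumes P: "submodule P R M" and fl: "finite_length R (M\<lparr>carrier := P\<rparr>)"
    and N: "submodule N R M" and NP: "N \<inter> P \<noteq> {\<zero>\<^bsub>M\<^esub>}"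
  shows "\<exists>L. submodule L R M \<and> L \<subseteq> N \<and> simple_module R (M\<lparr>carrier := L\<rparr>)"
proof -
  obtain n C where C0: "C (0::nat) = {\<zero>\<^bsub>M\<^esub>}" and Cn: "C n = P"
    and sub: "\<And>i. i \<le> n \<Longrightarrow> submodule (C i) R M"
    and step: "\<And>i. i < n \<Longrightarrow> C i \<subset> C (Suc i)"
    and max: "\<And>i K. i < n \<Longrightarrow> submodule K R M \<Longrightarrow> K \<subseteq> P \<Longrightarrow> C i \<subseteq> K \<Longrightarrow> K \<subseteq> C (Suc i) \<Longrightarrow> K = C i \<or> K = C (Suc i)"
    using fl unfolding finite_length_def submodule_restrict_iff[OF P] by auto
  have CP: "C i \<subseteq> P" if "i \<le> n" for i
    using that
  proof (induction rule: inc_induct)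
    case (step i)
    then show ?case using \<open>\<And>i. i < n \<Longrightarrow> C i \<subset> C (Suc i)\<close> by blast
  qed (simp add: Cn)
  define i where "i = (LEAST i. N \<inter> C i \<noteq> {\<zero>\<^bsub>M\<^esub>})"
  have i: "N \<inter> C i \<noteq> {\<zero>\<^bsub>M\<^esub>}" unfolding i_def by (rule LeastI[of _ n]) (use NP Cn in simp)
  have i_least: "N \<inter> C j = {\<zero>\<^bsub>M\<^esub>}" if "j < i" for j using not_less_Least[of j] that unfolding i_def by blast
  have "i \<le> n" unfolding i_def by (rule Least_le) (use NP Cn in simp)
  have "i \<noteq> 0"
  proof
    assume "i = 0"
    then have "N \<inter> C i = {\<zero>\<^bsub>M\<^esub>}" using C0 N by (auto simp: submodule_iff)
    then show False using i by simp
  qed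
  then obtain j where j: "i = Suc j" "j < n" using \<open>i \<le> n\<close> by (cases i) auto
  have Nj: "N \<inter> C j = {\<zero>\<^bsub>M\<^esub>}" using i_least j by simp
  note Cj = sub[of j] and Ci = sub[of "Suc j"]
  have L: "submodule (N \<inter> C i) R M" using submodule_Int[OF N] Ci j by simp
  have "K = {\<zero>\<^bsub>M\<^esub>} \<or> K = N \<inter> C i" if K: "submodule K R M" "K \<subseteq> N \<inter> C i" for K
  proof (rule disjCI)
    assume "K \<noteq> N \<inter> C i"
    let ?S = "{x \<oplus>\<^bsub>M\<^esub> y | x y. x \<in> C j \<and> y \<in> K}"
    have S: "submodule ?S R M" using submodule_sum[OF Cj K(1)] j by simp
    have Km: "K \<subseteq> carrier M" "\<zero>\<^bsub>M\<^esub> \<in> K" using K(1) by (auto simp: submodule_iff)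
    have Cm: "C j \<subseteq> carrier M" "\<zero>\<^bsub>M\<^esub> \<in> C j" using Cj j by (auto simp: submodule_iff)
    have CS: "C j \<subseteq> ?S" using Km Cm by (force intro: M.r_zero[symmetric])
    have KS: "K \<subseteq> ?S" using Km Cm by (force intro: M.l_zero[symmetric])
    have SC: "?S \<subseteq> C (Suc j)" 
    proof
      fix z assume "z \<in> ?S"
      then obtain x y where xy: "z = x \<oplus>\<^bsub>M\<^esub> y" "x \<in> C (Suc j)" "y \<in> C (Suc j)"
        using step[OF j(2)] K(2) j(1) by blast
      moreover have "submodule (C (Suc j)) R M" using Ci j(2) by simp
      ultimately show "z \<in> C (Suc j)" unfolding submodule_iff by blast
    qed
    have "?S = C j \<or> ?S = C (Suc j)"
      using max[OF j(2) S _ CS SC] SC CP[of "Suc j"] j(2) by auto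
    then show "K = {\<zero>\<^bsub>M\<^esub>}"
    proof
      assume "?S = C j"
      then have "K \<subseteq> N \<inter> C j" using KS K(2) by auto
      then show ?thesis using Nj Km by auto
    next
      assume S': "?S = C (Suc j)"
      have "N \<inter> C i \<subseteq> K"
      proof
        fix z assume z: "z \<in> N \<inter> C i"
        then have "z \<in> ?S" using S' j by simp
        then obtain x y where xy: "z = x \<oplus>\<^bsub>M\<^esub> y" "x \<in> C j" "y \<in> K" by auto
        have c: "x \<in> carrier M" "y \<in> carrier M" using xy Km Cm by auto
        have "x = z \<oplus>\<^bsub>M\<^esub> \<ominus>\<^bsub>M\<^esub> y" using xy(1) c by (simp add: M.a_assoc M.r_neg)
        moreover have "\<ominus>\<^bsub>M\<^esub> y \<in> N" using xy K(2) by (intro submodule_minus[OF N]) auto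
        ultimately have "x \<in> N" using z N by (auto simp: submodule_iff)
        then have "x = \<zero>\<^bsub>M\<^esub>" using xy(2) Nj by auto
        then show "z \<in> K" using xy c by simp
      qed
      then show ?thesis using \<open>K \<noteq> N \<inter> C i\<close> K(2) by blast
    qed
  qed
  then show ?thesis using simple_submodule_iff[OF L] i L by (intro exI[of _ "N \<inter> C i"]) auto
qed

lemma finite_type_socle_imp_simple_submodule:
  assumes T: "finite_type_socle R M" and N: "submodule N R M" "N \<noteq> {\<zero>\<^bsub>M\<^esub>}"
  shows "\<exists>L. submodule L R M \<and> L \<subseteq> N \<and> simple_module R (M\<lparr>carrier := L\<rparr>)"
  using T N unfolding finite_type_socle_def essential_def
  by (intro finite_length_imp_simple_submodule[of "socle R M"]) auto

end

lemma left_module_homD: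
  assumes "f \<in> left_module_hom R M N"
  shows "\<And>x. x \<in> carrier M \<Longrightarrow> f x \<in> carrier N"
    and "\<And>x y. x \<in> carrier M \<Longrightarrow> y \<in> carrier M \<Longrightarrow> f (x \<oplus>\<^bsub>M\<^esub> y) = f x \<oplus>\<^bsub>N\<^esub> f y"
    and "\<And>a x. a \<in> carrier R \<Longrightarrow> x \<in> carrier M \<Longrightarrow> f (a \<odot>\<^bsub>M\<^esub> x) = a \<odot>\<^bsub>N\<^esub> f x"
  using assms by (auto simp: left_module_hom_def hom_def)

lemma left_module_hom_zero:
  assumes "left_module R M" "left_module R N" "f \<in> left_module_hom R M N"
  shows "f \<zero>\<^bsub>M\<^esub> = \<zero>\<^bsub>N\<^esub>"
proof -
  interpret M: left_module R M by fact
  interpret N: left_module R N by fact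
  show ?thesis
    using left_module_homD[OF assms(3)] M.M.zero_closed
    by (metis M.M.l_zero N.M.add.l_cancel_one)
qed

lemma submodule_vimage:
  assumes M: "left_module R M" and N: "left_module R N" and f: "f \<in> left_module_hom R M N"
    and K: "submodule K R N"
  shows "submodule {x \<in> carrier M. f x \<in> K} R M"
proof -
  interpret M: left_module R M by fact
  interpret N: left_module R N by fact
  show ?thesis using K left_module_homD[OF f] left_module_hom_zero[OF M N f]
    unfolding M.submodule_iff N.submodule_iff by (auto simp: M.smult_closed)
qed

lemma submodule_image:
  assumes M: "left_module R M" and N: "left_module R N" and f: "f \<in> left_module_hom R M N"
    and K: "submodule K R M"
  shows "submodule (f ` K) R N"
proof -
  interpret M: left_module R M by fact
  interpret N: left_module R N by fact
  note h = left_module_homD[OF f] and z = left_module_hom_zero[OF M N f]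
  have KM: "K \<subseteq> carrier M" "\<zero>\<^bsub>M\<^esub> \<in> K" using K by (auto simp: M.submodule_iff)
  show ?thesis
    unfolding N.submodule_iff
  proof (intro conjI ballI)
    show "f ` K \<subseteq> carrier N" using KM h(1) by auto
    show "\<zero>\<^bsub>N\<^esub> \<in> f ` K" using z KM by force
  next
    fix x y assume "x \<in> f ` K" "y \<in> f ` K"
    then obtain u v where uv: "x = f u" "y = f v" "u \<in> K" "v \<in> K" by auto
    then have "u \<oplus>\<^bsub>M\<^esub> v \<in> K" using K by (simp add: M.submodule_iff)
    moreover have "f (u \<oplus>\<^bsub>M\<^esub> v) = x \<oplus>\<^bsub>N\<^esub> y" using h(2)[of u v] uv KM by auto
    ultimately show "x \<oplus>\<^bsub>N\<^esub> y \<in> f ` K" by (metis imageI)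
  next
    fix a x assume a: "a \<in> carrier R" "x \<in> f ` K"
    then obtain u where u: "x = f u" "u \<in> K" by auto
    then have "a \<odot>\<^bsub>M\<^esub> u \<in> K" using K a by (simp add: M.submodule_iff)
    moreover have "f (a \<odot>\<^bsub>M\<^esub> u) = a \<odot>\<^bsub>N\<^esub> x" using h(3)[of a u] a u KM by auto
    ultimately show "a \<odot>\<^bsub>N\<^esub> x \<in> f ` K" by (metis imageI)
  qed
qed

context left_module begin

lemma submodule_cyclic:
  assumes x: "x \<in> carrier M" shows "submodule ((\<lambda>a. a \<odot>\<^bsub>M\<^esub> x) ` carrier R) R M"
  unfolding submodule_iff
proof (intro conjI ballI)
  show "(\<lambda>a. a \<odot>\<^bsub>M\<^esub> x) ` carrier R \<subseteq> carrier M" using smult_closed x by auto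
  show "\<zero>\<^bsub>M\<^esub> \<in> (\<lambda>a. a \<odot>\<^bsub>M\<^esub> x) ` carrier R"
    using smult_zero_left[OF x] by (metis R.zero_closed imageI)
next
  fix u v assume "u \<in> (\<lambda>a. a \<odot>\<^bsub>M\<^esub> x) ` carrier R" "v \<in> (\<lambda>a. a \<odot>\<^bsub>M\<^esub> x) ` carrier R"
  then obtain a b where "a \<in> carrier R" "b \<in> carrier R" "u = a \<odot>\<^bsub>M\<^esub> x" "v = b \<odot>\<^bsub>M\<^esub> x" by auto
  then show "u \<oplus>\<^bsub>M\<^esub> v \<in> (\<lambda>a. a \<odot>\<^bsub>M\<^esub> x) ` carrier R"
    using smult_l_distr[of a b x] x by (intro image_eqI[of _ _ "a \<oplus> b"]) auto
next
  fix a u assume "a \<in> carrier R" "u \<in> (\<lambda>a. a \<odot>\<^bsub>M\<^esub> x) ` carrier R"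
  then obtain b where "a \<in> carrier R" "b \<in> carrier R" "u = b \<odot>\<^bsub>M\<^esub> x" by auto
  then show "a \<odot>\<^bsub>M\<^esub> u \<in> (\<lambda>a. a \<odot>\<^bsub>M\<^esub> x) ` carrier R"
    using smult_assoc[of a b x] x by (intro image_eqI[of _ _ "a \<otimes> b"]) auto
qed

lemma submodule_Union_chain:
  assumes C: "subset.chain {K. submodule K R M} C" "C \<noteq> {}"
  shows "submodule (\<Union>C) R M"
  unfolding submodule_iff
proof (intro conjI ballI)
  have sub: "submodule K R M" if "K \<in> C" for K using C that by (auto simp: subset.chain_def)
  show "\<Union>C \<subseteq> carrier M" using sub unfolding submodule_iff by blast
  show "\<zero>\<^bsub>M\<^esub> \<in> \<Union>C" using sub C(2) unfolding submodule_iff by blast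
  show "a \<odot>\<^bsub>M\<^esub> x \<in> \<Union>C" if "a \<in> carrier R" "x \<in> \<Union>C" for a x
    using that sub unfolding submodule_iff by blast
  fix x y assume "x \<in> \<Union>C" "y \<in> \<Union>C"
  then obtain A B where AB: "A \<in> C" "B \<in> C" "x \<in> A" "y \<in> B" by auto
  then have "A \<subseteq> B \<or> B \<subseteq> A" using C(1) by (auto simp: subset_chain_def)
  then obtain D where "D \<in> C" "x \<in> D" "y \<in> D" using AB by blast
  then show "x \<oplus>\<^bsub>M\<^esub> y \<in> \<Union>C" using sub unfolding submodule_iff by blast
qed

text \<open>
  Zorn's lemma: a chain of submodules whose union contains the finite generating set \<open>X\<close> has a
  member that contains it, so the union of a chain of proper submodules is proper.
\<close>

lemma exists_maximal_submodule:
  assumes X: "finite X" "X \<subseteq> carrier M" "\<And>N. submodule N R M \<Longrightarrow> X \<subseteq> N \<Longrightarrow> N = carrier M"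
    and K0: "submodule K0 R M" "K0 \<noteq> carrier M"
  shows "\<exists>K. submodule K R M \<and> K0 \<subseteq> K \<and> K \<noteq> carrier M \<and>
    (\<forall>N. submodule N R M \<and> K \<subseteq> N \<longrightarrow> N = K \<or> N = carrier M)"
proof -
  let ?A = "{K. submodule K R M \<and> K0 \<subseteq> K \<and> \<not> X \<subseteq> K}"
  have "\<exists>K\<in>?A. \<forall>N\<in>?A. K \<subseteq> N \<longrightarrow> N = K"
  proof (rule subset_Zorn_nonempty)
    show "?A \<noteq> {}" using K0 X(3) by blast
    fix C assume C: "C \<noteq> {}" "subset.chain ?A C"
    then have "subset.chain {K. submodule K R M} C" by (auto simp: subset.chain_def)
    then have "submodule (\<Union>C) R M" using C submodule_Union_chain by blast
    moreover have "K0 \<subseteq> \<Union>C" using C unfolding subset.chain_def by blast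
    moreover have "\<not> X \<subseteq> \<Union>C"
      using finite_subset_Union_chain[OF X(1) _ C(1) C(2)] C by (auto simp: subset.chain_def)
    ultimately show "\<Union>C \<in> ?A" by simp
  qed
  then obtain K where KA: "K \<in> ?A" and KA_max: "\<And>N. N \<in> ?A \<Longrightarrow> K \<subseteq> N \<Longrightarrow> N = K"
    by (elim bexE) auto
  from KA have K: "submodule K R M" "K0 \<subseteq> K" "\<not> X \<subseteq> K" by auto
  have max: "N = K \<or> N = carrier M" if N: "submodule N R M" "K \<subseteq> N" for N
    using KA_max[of N] X(3)[OF N(1)] N K(2) by auto
  have "K \<noteq> carrier M" using K(3) X(2) by blast
  then show ?thesis using K max by (intro exI[of _ K]) simp
qed

lemma simple_quotient:
  assumes K: "submodule K R M" "K \<noteq> carrier M"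
    and max: "\<And>N. submodule N R M \<Longrightarrow> K \<subseteq> N \<Longrightarrow> N = K \<or> N = carrier M"
  shows "\<exists>(S :: ('a, 'c set) module) f. simple_module R S \<and> f \<in> left_module_hom R M S \<and>
    f ` carrier M = carrier S \<and> (\<forall>x\<in>carrier M. f x = \<zero>\<^bsub>S\<^esub> \<longleftrightarrow> x \<in> K)"
proof -
  have "subgroup K (add_monoid M)" using K(1) by (simp add: submodule_def)
  then interpret C: comm_group_mod K "add_monoid M"
    by (intro comm_group_mod.intro M.a_comm_group)
  let ?S = "coset_module (add_monoid M) K (\<lambda>a x. a \<odot>\<^bsub>M\<^esub> x)"
  let ?f = "\<lambda>x. K #>\<^bsub>add_monoid M\<^esub> x"
  have KM: "K \<subseteq> carrier M" using K(1) by (simp add: submodule_iff)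
  have aK: "a \<odot>\<^bsub>M\<^esub> x \<in> K" if "a \<in> carrier R" "x \<in> K" for a x
    using that K(1) by (auto simp: submodule_iff)
  have S: "left_module R ?S"
    by (rule C.left_module_coset_module[OF R.ring_axioms])
      (use aK in \<open>auto simp: smult_closed smult_l_distr smult_r_distr smult_assoc smult_one\<close>)
  have f: "?f \<in> left_module_hom R M ?S"
    unfolding left_module_hom_def hom_def
  proof (intro CollectI conjI ballI funcsetI)
    fix x y assume "x \<in> carrier (add_monoid M)" "y \<in> carrier (add_monoid M)"
    then show "?f (x \<otimes>\<^bsub>add_monoid M\<^esub> y) = ?f x \<otimes>\<^bsub>add_monoid ?S\<^esub> ?f y"
      by (simp add: C.add_coset)
  next
    fix a x assume "a \<in> carrier R" "x \<in> carrier M"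
    then show "?f (a \<odot>\<^bsub>M\<^esub> x) = a \<odot>\<^bsub>?S\<^esub> ?f x"
      using aK by (intro C.smult_coset[symmetric]) (auto simp: smult_closed smult_r_distr)
  qed (use C.coset_closed in simp)
  have surj: "?f ` carrier M = carrier ?S" by (auto simp: coset_module_def carrier_FactGroup)
  have ker: "?f x = \<zero>\<^bsub>?S\<^esub> \<longleftrightarrow> x \<in> K" if "x \<in> carrier M" for x
    using C.coset_eq_N_iff[of x] that by (simp add: C.zero_coset_module)
  have "carrier ?S \<noteq> {\<zero>\<^bsub>?S\<^esub>}"
  proof
    assume "carrier ?S = {\<zero>\<^bsub>?S\<^esub>}"
    then have "x \<in> K" if "x \<in> carrier M" for x using ker[OF that] surj that by blast
    then show False using K(2) KM by blast
  qed
  moreover have "N = {\<zero>\<^bsub>?S\<^esub>} \<or> N = carrier ?S" if N: "submodule N R ?S" for N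
  proof -
    interpret S: left_module R ?S by (rule S)
    let ?N = "{x \<in> carrier M. ?f x \<in> N}"
    have N': "N \<subseteq> carrier ?S" "\<zero>\<^bsub>?S\<^esub> \<in> N" using N by (auto simp: S.submodule_iff)
    have "x \<in> ?N" if "x \<in> K" for x using ker[of x] KM N'(2) that by (simp add: subset_iff)
    then have "K \<subseteq> ?N" by blast
    then have "?N = K \<or> ?N = carrier M"
      using max[OF submodule_vimage[OF left_module_axioms S f N]] by blast
    moreover have "N = ?f ` ?N"
    proof
      show "N \<subseteq> ?f ` ?N"
      proof
        fix A assume A: "A \<in> N"
        then have "A \<in> ?f ` carrier M" using N'(1) unfolding surj by (rule subsetD[rotated])
        then show "A \<in> ?f ` ?N" using A by (elim imageE) auto
      qed
    qed auto
    ultimately show ?thesis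
    proof (elim disjE)
      assume n: "?N = K" "N = ?f ` ?N"
      have "?f x = \<zero>\<^bsub>?S\<^esub>" if "x \<in> K" for x using ker[of x] KM that by (simp add: subset_iff)
      then have "N \<subseteq> {\<zero>\<^bsub>?S\<^esub>}" using n by auto
      then show ?thesis using N'(2) by blast
    next
      assume "?N = carrier M" "N = ?f ` ?N" then show ?thesis using surj by auto
    qed
  qed
  ultimately have "simple_module R ?S" using S by (simp add: simple_module_def)
  then show ?thesis using f surj ker by (intro exI[of _ ?S] exI[of _ ?f]) auto
qed

lemma left_module_restrict_scalars:
  assumes R': "ring R'" and h: "h \<in> ring_hom R' R"
  shows "left_module R' (M\<lparr>smult := \<lambda>a x. h a \<odot>\<^bsub>M\<^esub> x\<rparr>)"
proof -
  have "abelian_group (M\<lparr>smult := \<lambda>a x. h a \<odot>\<^bsub>M\<^esub> x\<rparr>)"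
    by (rule abelian_groupI) (auto simp: M.a_ac intro: M.l_neg intro!: bexI[of _ "\<ominus>\<^bsub>M\<^esub> _"])
  then show ?thesis
    using h by (intro left_module.intro left_module_axioms.intro R')
      (auto simp: smult_closed smult_l_distr smult_r_distr smult_assoc smult_one
        ring_hom_def Pi_def)
qed

end

text \<open>
  A simple submodule of the image of \<open>N\<close> pulls back along the injection \<open>f\<close>.
\<close>

lemma injective_hom_reflects_simple_submodule:
  assumes M: "left_module R M" and T: "left_module R T" and f: "f \<in> left_module_hom R M T"
    and inj: "\<And>x. x \<in> carrier M \<Longrightarrow> f x = \<zero>\<^bsub>T\<^esub> \<Longrightarrow> x = \<zero>\<^bsub>M\<^esub>"
    and T': "finite_type_socle R T"
    and N: "submodule N R M" "N \<noteq> {\<zero>\<^bsub>M\<^esub>}"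
  shows "\<exists>L. submodule L R M \<and> L \<subseteq> N \<and> simple_module R (M\<lparr>carrier := L\<rparr>)"
proof -
  interpret M: left_module R M by fact
  interpret T: left_module R T by fact
  note h = left_module_homD[OF f] and z = left_module_hom_zero[OF M T f]
  have NM: "N \<subseteq> carrier M" "\<zero>\<^bsub>M\<^esub> \<in> N" using N by (auto simp: M.submodule_iff)
  have fN: "submodule (f ` N) R T" using submodule_image[OF M T f N(1)] .
  have "f ` N \<noteq> {\<zero>\<^bsub>T\<^esub>}" using N(2) NM inj by blast
  then obtain L where L: "submodule L R T" "L \<subseteq> f ` N" "simple_module R (T\<lparr>carrier := L\<rparr>)"
    using T.finite_type_socle_imp_simple_submodule[OF T' fN] by blast
  let ?L = "{x \<in> carrier M. f x \<in> L} \<inter> N"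
  have sL: "submodule ?L R M" using M.submodule_Int[OF submodule_vimage[OF M T f L(1)] N(1)] .
  have fL: "f ` ?L = L" using L(2) NM by auto
  have "?L \<noteq> {\<zero>\<^bsub>M\<^esub>}"
    using fL z L(3) T.simple_submodule_iff[OF L(1)] by auto
  moreover have "K = {\<zero>\<^bsub>M\<^esub>} \<or> K = ?L" if K: "submodule K R M" "K \<subseteq> ?L" for K
  proof -
    have K0: "\<zero>\<^bsub>M\<^esub> \<in> K" using K(1) by (simp add: M.submodule_iff)
    have "submodule (f ` K) R T" "f ` K \<subseteq> L" using submodule_image[OF M T f K(1)] K(2) by auto
    then have "f ` K = {\<zero>\<^bsub>T\<^esub>} \<or> f ` K = L" using T.simple_submodule_iff[OF L(1)] L(3) by blast
    then show ?thesis
    proof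
      assume "f ` K = {\<zero>\<^bsub>T\<^esub>}"
      then show ?thesis using inj K K0 by blast
    next
      assume fK: "f ` K = L"
      have "?L \<subseteq> K"
      proof
        fix x assume x: "x \<in> ?L"
        then obtain y where y: "y \<in> K" "f x = f y" using fK by auto
        have c: "x \<in> carrier M" "y \<in> carrier M" using x y K by auto
        have ny: "\<ominus>\<^bsub>M\<^esub> y \<in> K" using M.submodule_minus[OF K(1) y(1)] .
        have "f (x \<oplus>\<^bsub>M\<^esub> \<ominus>\<^bsub>M\<^esub> y) = f (y \<oplus>\<^bsub>M\<^esub> \<ominus>\<^bsub>M\<^esub> y)" using c y(2) h(2) by simp
        then have "f (x \<oplus>\<^bsub>M\<^esub> \<ominus>\<^bsub>M\<^esub> y) = \<zero>\<^bsub>T\<^esub>" using z c by (simp add: M.M.r_neg)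
        then have "x \<oplus>\<^bsub>M\<^esub> \<ominus>\<^bsub>M\<^esub> y = \<zero>\<^bsub>M\<^esub>" using inj c by simp
        then have "x = y" using c by (metis M.M.add.inv_closed M.M.minus_equality M.M.minus_minus)
        then show "x \<in> K" using y by simp
      qed
      then show ?thesis using K(2) by blast
    qed
  qed
  ultimately show ?thesis using M.simple_submodule_iff[OF sL] sL by blast
qed

section \<open>Congruences and tensor products of abelian groups\<close>

locale subgroup_cong =
  fixes N :: "'x::ab_group_add set"
  assumes N_zero: "0 \<in> N" and N_diff: "f \<in> N \<Longrightarrow> g \<in> N \<Longrightarrow> f - g \<in> N"
begin

definition cong :: "'x \<Rightarrow> 'x \<Rightarrow> bool" (infix \<open>\<doteq>\<close> 50)
  where "f \<doteq> g \<longleftrightarrow> f - g \<in> N"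

lemma N_minus: "f \<in> N \<Longrightarrow> - f \<in> N" using N_diff[OF N_zero] by simp

lemma N_add: "f \<in> N \<Longrightarrow> g \<in> N \<Longrightarrow> f + g \<in> N" using N_diff[OF _ N_minus, of f g] by simp

lemma cong_refl: "f \<doteq> f" using N_zero by (simp add: cong_def)

lemma cong_sym: "f \<doteq> g \<Longrightarrow> g \<doteq> f" unfolding cong_def using N_minus by fastforce

lemma cong_trans [trans]: "f \<doteq> g \<Longrightarrow> g \<doteq> h \<Longrightarrow> f \<doteq> h"
  unfolding cong_def using N_add by fastforce

lemma cong_add: "f \<doteq> g \<Longrightarrow> f' \<doteq> g' \<Longrightarrow> f + f' \<doteq> g + g'"
  unfolding cong_def using N_add[of "f - g" "f' - g'"] by (simp add: algebra_simps)

lemma cong_diff: "f \<doteq> g \<Longrightarrow> f' \<doteq> g' \<Longrightarrow> f - f' \<doteq> g - g'"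
  unfolding cong_def using N_diff[of "f - g" "f' - g'"] by (simp add: algebra_simps)

lemma cong_sum: "(\<And>i. i \<in> A \<Longrightarrow> f i \<doteq> g i) \<Longrightarrow> sum f A \<doteq> sum g A"
  by (induction A rule: infinite_finite_induct) (auto simp: cong_refl cong_add)

lemma cong_zero_iff: "f \<doteq> 0 \<longleftrightarrow> f \<in> N" by (simp add: cong_def)

end

text \<open>
  Integral combinations of pairs, modulo the relations \<open>null\<close> of the tensor product over \<open>K\<close>.
  Computing with representatives modulo \<open>null\<close> allows finite sums of the ambient type instead of
  sums in the carrier of a quotient group.
\<close>

locale balanced_tensor = M: abelian_group M + N: abelian_group N
  for M :: "('m, 'x) ring_scheme" and N :: "('n, 'y) ring_scheme" +
  fixes K :: "'c set" and ra :: "'m \<Rightarrow> 'c \<Rightarrow> 'm" and la :: "'c \<Rightarrow> 'n \<Rightarrow> 'n"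
  assumes ra_closed: "m \<in> carrier M \<Longrightarrow> c \<in> K \<Longrightarrow> ra m c \<in> carrier M"
    and la_closed: "c \<in> K \<Longrightarrow> n \<in> carrier N \<Longrightarrow> la c n \<in> carrier N"
begin

abbreviation "X \<equiv> carrier M \<times> carrier N"

abbreviation "C \<equiv> carrier (free_Abelian_group X)"

definition null :: "('m \<times> 'n \<Rightarrow>\<^sub>0 int) set"
  where "null = tensor_null K ra la M N"

lemma C_closed: "frag_of (m, n) \<in> C \<longleftrightarrow> m \<in> carrier M \<and> n \<in> carrier N"
  "0 \<in> C" "f \<in> C \<Longrightarrow> g \<in> C \<Longrightarrow> f + g \<in> C" "f \<in> C \<Longrightarrow> g \<in> C \<Longrightarrow> f - g \<in> C"
  using Poly_Mapping.keys_add[of f g] keys_diff[of f g] by auto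

lemma null_subsetI:
  assumes H: "subgroup H (free_Abelian_group X)"
    and l: "\<And>m m' n. m \<in> carrier M \<Longrightarrow> m' \<in> carrier M \<Longrightarrow> n \<in> carrier N \<Longrightarrow>
      frag_of (m \<oplus>\<^bsub>M\<^esub> m', n) - (frag_of (m, n) + frag_of (m', n)) \<in> H"
    and r: "\<And>m n n'. m \<in> carrier M \<Longrightarrow> n \<in> carrier N \<Longrightarrow> n' \<in> carrier N \<Longrightarrow>
      frag_of (m, n \<oplus>\<^bsub>N\<^esub> n') - (frag_of (m, n) + frag_of (m, n')) \<in> H"
    and b: "\<And>m c n. m \<in> carrier M \<Longrightarrow> c \<in> K \<Longrightarrow> n \<in> carrier N \<Longrightarrow>
      frag_of (ra m c, n) - frag_of (m, la c n) \<in> H"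
  shows "null \<subseteq> H"
  unfolding null_def tensor_null_def
proof (rule group.generate_subgroup_incl[OF group_free_Abelian_group _ H], intro Un_least subsetI)
  fix x assume "x \<in> {frag_of (m \<oplus>\<^bsub>M\<^esub> m', n) - frag_of (m, n) - frag_of (m', n) | m m' n.
        m \<in> carrier M \<and> m' \<in> carrier M \<and> n \<in> carrier N}"
  then show "x \<in> H" by (elim CollectE exE conjE) (simp add: l diff_diff_eq)
next
  fix x assume "x \<in> {frag_of (m, n \<oplus>\<^bsub>N\<^esub> n') - frag_of (m, n) - frag_of (m, n') | m n n'.
        m \<in> carrier M \<and> n \<in> carrier N \<and> n' \<in> carrier N}"
  then show "x \<in> H" by (elim CollectE exE conjE) (simp add: r diff_diff_eq)
next
  fix x assume "x \<in> {frag_of (ra m c, n) - frag_of (m, la c n) | m c n.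
        m \<in> carrier M \<and> c \<in> K \<and> n \<in> carrier N}"
  then show "x \<in> H" by (elim CollectE exE conjE) (simp add: b)
qed

lemma subgroup_freeI:
  assumes "H \<subseteq> C" "0 \<in> H" "\<And>f g. f \<in> H \<Longrightarrow> g \<in> H \<Longrightarrow> f - g \<in> H"
  shows "subgroup H (free_Abelian_group X)"
proof -
  have m: "- f \<in> H" if "f \<in> H" for f using assms(3)[OF assms(2) that] by simp
  have "f + g \<in> H" if "f \<in> H" "g \<in> H" for f g using assms(3)[OF that(1) m[OF that(2)]] by simp
  moreover have "inv\<^bsub>free_Abelian_group X\<^esub> f \<in> H" if "f \<in> H" for f
    using m[OF that] subsetD[OF assms(1) that] by simp
  ultimately show ?thesis using assms(1,2) by (intro subgroup.intro) auto
qed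

lemma null_subgroup: "subgroup null (free_Abelian_group X)"
  unfolding null_def tensor_null_def
  by (rule group.generate_is_subgroup[OF group_free_Abelian_group])
    (auto simp del: carrier_free_Abelian_group_iff simp: C_closed(1) ra_closed la_closed intro!: C_closed(4))

sublocale quot: comm_group_mod null "free_Abelian_group X"
  by (intro comm_group_mod.intro abelian_free_Abelian_group null_subgroup)

lemma null_C: "null \<subseteq> C"
  using subgroup.subset[OF null_subgroup] .

sublocale subgroup_cong null
proof
  show "0 \<in> null" using subgroup.one_closed[OF null_subgroup] by simp
  fix f g assume fg: "f \<in> null" "g \<in> null"
  then have "f \<otimes>\<^bsub>free_Abelian_group X\<^esub> inv\<^bsub>free_Abelian_group X\<^esub> g \<in> null"
    using subgroup.m_closed[OF null_subgroup] subgroup.m_inv_closed[OF null_subgroup] by blast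
  moreover have "Poly_Mapping.keys g \<subseteq> X" using subsetD[OF null_C fg(2)] by simp
  ultimately show "f - g \<in> null" by simp
qed

notation cong (infix \<open>\<doteq>\<close> 50)

lemma tensor_add_left:
  assumes "m \<in> carrier M" "m' \<in> carrier M" "n \<in> carrier N"
  shows "frag_of (m \<oplus>\<^bsub>M\<^esub> m', n) \<doteq> frag_of (m, n) + frag_of (m', n)"
proof -
  have "frag_of (m \<oplus>\<^bsub>M\<^esub> m', n) - frag_of (m, n) - frag_of (m', n) \<in> null"
    unfolding null_def tensor_null_def using assms by (intro generate.incl) blast
  then show ?thesis by (simp add: cong_def diff_diff_eq)
qed

lemma tensor_add_right:
  assumes "m \<in> carrier M" "n \<in> carrier N" "n' \<in> carrier N"
  shows "frag_of (m, n \<oplus>\<^bsub>N\<^esub> n') \<doteq> frag_of (m, n) + frag_of (m, n')"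
proof -
  have "frag_of (m, n \<oplus>\<^bsub>N\<^esub> n') - frag_of (m, n) - frag_of (m, n') \<in> null"
    unfolding null_def tensor_null_def using assms by (intro generate.incl) blast
  then show ?thesis by (simp add: cong_def diff_diff_eq)
qed

lemma tensor_balanced:
  assumes "m \<in> carrier M" "c \<in> K" "n \<in> carrier N"
  shows "frag_of (ra m c, n) \<doteq> frag_of (m, la c n)"
proof -
  have "frag_of (ra m c, n) - frag_of (m, la c n) \<in> null"
    unfolding null_def tensor_null_def using assms
    by (intro generate.incl UnI2 CollectI exI[of _ m] exI[of _ c] exI[of _ n]) simp
  then show ?thesis by (simp add: cong_def)
qed

text \<open>
  Hence an additive operator on combinations of pairs that respects the three kinds of relations
  descends to the tensor product.
\<close>

lemma null_preserved:
  assumes diff: "\<And>f g. \<phi> (f - g) = \<phi> f - \<phi> g"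
    and l: "\<And>m m' n. m \<in> carrier M \<Longrightarrow> m' \<in> carrier M \<Longrightarrow> n \<in> carrier N \<Longrightarrow>
      \<phi> (frag_of (m \<oplus>\<^bsub>M\<^esub> m', n)) \<doteq> \<phi> (frag_of (m, n)) + \<phi> (frag_of (m', n))"
    and r: "\<And>m n n'. m \<in> carrier M \<Longrightarrow> n \<in> carrier N \<Longrightarrow> n' \<in> carrier N \<Longrightarrow>
      \<phi> (frag_of (m, n \<oplus>\<^bsub>N\<^esub> n')) \<doteq> \<phi> (frag_of (m, n)) + \<phi> (frag_of (m, n'))"
    and b: "\<And>m n c. m \<in> carrier M \<Longrightarrow> c \<in> K \<Longrightarrow> n \<in> carrier N \<Longrightarrow>
      \<phi> (frag_of (ra m c, n)) \<doteq> \<phi> (frag_of (m, la c n))"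
    and f: "f \<in> null"
  shows "\<phi> f \<in> null"
proof -
  have \<phi>0: "\<phi> 0 = 0" using diff[of 0 0] by simp
  have add: "\<phi> (f + g) = \<phi> f + \<phi> g" for f g using diff[of f "0 - g"] diff[of 0 g] by (simp add: \<phi>0)
  let ?H = "{f \<in> C. \<phi> f \<in> null}"
  have sub: "subgroup ?H (free_Abelian_group X)"
    by (rule subgroup_freeI) (use C_closed N_diff N_zero in \<open>simp_all del: carrier_free_Abelian_group_iff add: diff \<phi>0\<close>)
  have "null \<subseteq> ?H"
    using l r b
    by (intro null_subsetI[OF sub])
      (simp_all del: carrier_free_Abelian_group_iff add: cong_def diff add C_closed ra_closed la_closed)
  then show ?thesis using f by blast
qed

lemma frag_cong_ext:
  assumes "f \<in> C" and "\<And>f g. \<phi> (f - g) = \<phi> f - \<phi> g" and "\<And>f g. \<psi> (f - g) = \<psi> f - \<psi> g"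
    and "\<And>m n. m \<in> carrier M \<Longrightarrow> n \<in> carrier N \<Longrightarrow> \<phi> (frag_of (m, n)) \<doteq> \<psi> (frag_of (m, n))"
  shows "\<phi> f \<doteq> \<psi> f"
proof -
  have "Poly_Mapping.keys f \<subseteq> X" using assms(1) by simp
  then show ?thesis
  proof (induction f rule: frag_induction)
    case zero
    show ?case using assms(2)[of 0 0] assms(3)[of 0 0] by (simp add: cong_refl)
  next
    case (one x)
    then show ?case using assms(4) by (cases x) auto
  next
    case (diff a b)
    then show ?case by (simp add: assms(2,3) cong_diff)
  qed
qed

lemma coset_eqI:
  assumes "f \<in> C" "g \<in> C" "f \<doteq> g"
  shows "null #>\<^bsub>free_Abelian_group X\<^esub> f = null #>\<^bsub>free_Abelian_group X\<^esub> g"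
  using quot.coset_eq_iff[OF assms(1,2)] assms by (simp add: cong_def)

text \<open>The universal property: a balanced biadditive map factors through the tensor product.\<close>

lemma balanced_lift:
  assumes A: "abelian_group A"
    and \<beta>: "\<And>m n. m \<in> carrier M \<Longrightarrow> n \<in> carrier N \<Longrightarrow> \<beta> m n \<in> carrier A"
    and l: "\<And>m m' n. m \<in> carrier M \<Longrightarrow> m' \<in> carrier M \<Longrightarrow> n \<in> carrier N \<Longrightarrow>
      \<beta> (m \<oplus>\<^bsub>M\<^esub> m') n = \<beta> m n \<oplus>\<^bsub>A\<^esub> \<beta> m' n"
    and r: "\<And>m n n'. m \<in> carrier M \<Longrightarrow> n \<in> carrier N \<Longrightarrow> n' \<in> carrier N \<Longrightarrow>
      \<beta> m (n \<oplus>\<^bsub>N\<^esub> n') = \<beta> m n \<oplus>\<^bsub>A\<^esub> \<beta> m n'"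
    and b: "\<And>m c n. m \<in> carrier M \<Longrightarrow> c \<in> K \<Longrightarrow> n \<in> carrier N \<Longrightarrow> \<beta> (ra m c) n = \<beta> m (la c n)"
  obtains h where "h \<in> hom (free_Abelian_group X) (add_monoid A)"
    and "\<And>m n. m \<in> carrier M \<Longrightarrow> n \<in> carrier N \<Longrightarrow> h (frag_of (m, n)) = \<beta> m n"
    and "\<And>f g. f \<in> C \<Longrightarrow> g \<in> C \<Longrightarrow> h (f + g) = h f \<oplus>\<^bsub>A\<^esub> h g"
    and "\<And>f g. f \<in> C \<Longrightarrow> g \<in> C \<Longrightarrow> h (f - g) = h f \<oplus>\<^bsub>A\<^esub> \<ominus>\<^bsub>A\<^esub> h g"
    and "\<And>f. f \<in> C \<Longrightarrow> h f \<in> carrier A" and "h 0 = \<zero>\<^bsub>A\<^esub>" and "\<And>f. f \<in> null \<Longrightarrow> h f = \<zero>\<^bsub>A\<^esub>"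
proof -
  interpret A: abelian_group A by fact
  have "(\<lambda>(m, n). \<beta> m n) ` X \<subseteq> carrier (add_monoid A)" using \<beta> by auto
  from comm_group.free_Abelian_group_universal[OF A.a_comm_group this]
  obtain h where h: "h \<in> hom (free_Abelian_group X) (add_monoid A)"
    and hX: "\<And>x. x \<in> X \<Longrightarrow> h (frag_of x) = (\<lambda>(m, n). \<beta> m n) x" by blast
  interpret H: group_hom "free_Abelian_group X" "add_monoid A" h
    by (intro group_hom.intro group_free_Abelian_group comm_group.axioms(2)[OF A.a_comm_group]
        group_hom_axioms.intro h)
  have hg: "h (frag_of (m, n)) = \<beta> m n" if "m \<in> carrier M" "n \<in> carrier N" for m n
    using hX[of "(m, n)"] that by simp
  have h_closed: "h f \<in> carrier A" if "f \<in> C" for f using H.hom_closed[OF that] by simp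
  have h_add: "h (f + g) = h f \<oplus>\<^bsub>A\<^esub> h g" if "f \<in> C" "g \<in> C" for f g
    using H.hom_mult[OF that] by simp
  have h_zero: "h 0 = \<zero>\<^bsub>A\<^esub>" using H.hom_one by simp
  have h_minus: "h (f - g) = h f \<oplus>\<^bsub>A\<^esub> \<ominus>\<^bsub>A\<^esub> h g" if "f \<in> C" "g \<in> C" for f g
  proof -
    have "h f = h (f - g) \<oplus>\<^bsub>A\<^esub> h g" using h_add[OF C_closed(4)[OF that] that(2)] by simp
    then show ?thesis using h_closed[OF C_closed(4)[OF that]] h_closed[OF that(2)]
      by (simp add: A.a_assoc A.r_neg)
  qed
  have ker: "f - g \<in> kernel (free_Abelian_group X) (add_monoid A) h"
    if "f \<in> C" "g \<in> C" "h f = h g" for f g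
    using h_minus[OF that(1,2)] C_closed(4)[OF that(1,2)] h_closed[OF that(2)] that(3)
    by (simp del: carrier_free_Abelian_group_iff add: kernel_def A.r_neg)
  have "null \<subseteq> kernel (free_Abelian_group X) (add_monoid A) h"
    by (intro null_subsetI[OF H.subgroup_kernel] ker)
      (simp_all del: carrier_free_Abelian_group_iff
        add: C_closed h_add hg l r b ra_closed la_closed)
  then have "h f = \<zero>\<^bsub>A\<^esub>" if "f \<in> null" for f using that by (auto simp: kernel_def)
  then show thesis using that[OF h hg h_add h_minus h_closed h_zero] by blast
qed

end

section \<open>Enveloping algebras\<close>

lemma free_algebra_simps [simp]:
  "\<zero>\<^bsub>free_algebra X\<^esub> = 0" "\<one>\<^bsub>free_algebra X\<^esub> = 1"
  "p \<oplus>\<^bsub>free_algebra X\<^esub> q = p + q" "p \<otimes>\<^bsub>free_algebra X\<^esub> q = p * q"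
  by (simp_all add: free_algebra_def)

lemma mem_free_algebra_iff:
  "p \<in> carrier (free_algebra X) \<longleftrightarrow> (\<forall>w\<in>Poly_Mapping.keys p. set (letters w) \<subseteq> X)"
  by (simp add: free_algebra_def)

lemma free_algebra_closed:
  "0 \<in> carrier (free_algebra X)" "1 \<in> carrier (free_algebra X)"
  "const c \<in> carrier (free_algebra X)"
  "x \<in> X \<Longrightarrow> gen x \<in> carrier (free_algebra X)"
  "p \<in> carrier (free_algebra X) \<Longrightarrow> q \<in> carrier (free_algebra X) \<Longrightarrow> p + q \<in> carrier (free_algebra X)"
  "p \<in> carrier (free_algebra X) \<Longrightarrow> q \<in> carrier (free_algebra X) \<Longrightarrow> p * q \<in> carrier (free_algebra X)"
  "p \<in> carrier (free_algebra X) \<Longrightarrow> - p \<in> carrier (free_algebra X)"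
  "p \<in> carrier (free_algebra X) \<Longrightarrow> q \<in> carrier (free_algebra X) \<Longrightarrow> p - q \<in> carrier (free_algebra X)"
proof -
  show m: "- p \<in> carrier (free_algebra X)" if "p \<in> carrier (free_algebra X)" for p
    using that by (simp add: mem_free_algebra_iff Poly_Mapping.keys_def)
  show a: "p + q \<in> carrier (free_algebra X)"
    if "p \<in> carrier (free_algebra X)" "q \<in> carrier (free_algebra X)" for p q
    using that Poly_Mapping.keys_add[of p q] unfolding mem_free_algebra_iff by blast
  show "p - q \<in> carrier (free_algebra X)"
    if "p \<in> carrier (free_algebra X)" "q \<in> carrier (free_algebra X)" for p q
    using a[OF that(1) m[OF that(2)]] by simp
  show "p * q \<in> carrier (free_algebra X)"
    if "p \<in> carrier (free_algebra X)" "q \<in> carrier (free_algebra X)" for p q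
    unfolding mem_free_algebra_iff
  proof
    fix w assume "w \<in> Poly_Mapping.keys (p * q)"
    then obtain u v where "u \<in> Poly_Mapping.keys p" "v \<in> Poly_Mapping.keys q" "w = u + v"
      using keys_mult[of p q] by auto
    then show "set (letters w) \<subseteq> X"
      using that unfolding mem_free_algebra_iff by (auto simp: plus_monomial_def)
  qed
qed (auto simp: mem_free_algebra_iff gen_def const_def zero_monomial_def)

lemma ring_free_algebra: "ring (free_algebra X)"
proof (rule ringI)
  show "abelian_group (free_algebra X)"
  proof (rule abelian_groupI)
    fix p assume "p \<in> carrier (free_algebra X)"
    then show "\<exists>q\<in>carrier (free_algebra X). q \<oplus>\<^bsub>free_algebra X\<^esub> p = \<zero>\<^bsub>free_algebra X\<^esub>"
      using free_algebra_closed(7) by (intro bexI[of _ "- p"]) simp_all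
  qed (auto simp: free_algebra_closed algebra_simps)
  show "Group.monoid (free_algebra X)"
    by (rule monoidI) (auto simp: free_algebra_closed algebra_simps)
qed (auto simp: free_algebra_closed algebra_simps)

lemma const_simps: "const 0 = 0" "const 1 = 1" "const (c + d) = const c + const d"
  "const (c * d) = const c * const d" "const (- c) = - const c"
  by (simp_all add: const_def single_add mult_single single_uminus)

lemma poly_eq_sum: "(p :: 'w \<Rightarrow>\<^sub>0 'c::comm_monoid_add) =
    (\<Sum>w\<in>Poly_Mapping.keys p. Poly_Mapping.single w (Poly_Mapping.lookup p w))"
proof (rule poly_mapping_eqI)
  fix w
  have "(\<Sum>v\<in>Poly_Mapping.keys p. Poly_Mapping.lookup (Poly_Mapping.single v (Poly_Mapping.lookup p v)) w) =
      (\<Sum>v\<in>Poly_Mapping.keys p. if v = w then Poly_Mapping.lookup p w else 0)"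
    by (intro sum.cong) (auto simp: lookup_single when_def)
  also have "\<dots> = Poly_Mapping.lookup p w" by (simp add: sum.delta in_keys_iff)
  finally show "Poly_Mapping.lookup p w =
      Poly_Mapping.lookup (\<Sum>w\<in>Poly_Mapping.keys p. Poly_Mapping.single w (Poly_Mapping.lookup p w)) w"
    by (simp add: lookup_sum)
qed

lemma poly_sum_induct [consumes 1, case_names zero add single]:
  fixes p :: "'w \<Rightarrow>\<^sub>0 'c::comm_monoid_add"
  assumes "Poly_Mapping.keys p \<subseteq> W" and "P 0"
    and "\<And>p q. Poly_Mapping.keys p \<subseteq> W \<Longrightarrow> Poly_Mapping.keys q \<subseteq> W \<Longrightarrow> P p \<Longrightarrow> P q \<Longrightarrow> P (p + q)"
    and "\<And>w c. w \<in> W \<Longrightarrow> P (Poly_Mapping.single w c)"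
  shows "P p"
proof -
  let ?s = "\<lambda>w. Poly_Mapping.single w (Poly_Mapping.lookup p w)"
  have "Poly_Mapping.keys (sum ?s A) \<subseteq> W \<and> P (sum ?s A)" if "finite A" "A \<subseteq> W" for A
    using that
  proof (induction A rule: finite_induct)
    case (insert a A)
    then have "Poly_Mapping.keys (?s a) \<subseteq> W" by simp
    moreover from this have "P (?s a + sum ?s A)" using insert assms(3,4) by auto
    moreover have "Poly_Mapping.keys (?s a + sum ?s A) \<subseteq> W"
      using calculation insert Poly_Mapping.keys_add[of "?s a" "sum ?s A"] by auto
    ultimately show ?case using insert by simp
  qed (simp add: assms(2))
  from this[of "Poly_Mapping.keys p"] assms(1) show ?thesis by (simp add: poly_eq_sum[symmetric])
qed

lemma single_Cons:
  "Poly_Mapping.single (Monomial (x # xs)) c = gen x * Poly_Mapping.single (Monomial xs) c"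
  by (simp add: gen_def mult_single plus_monomial_def)

lemma single_append:
  "Poly_Mapping.single (Monomial (xs @ ys)) c =
    Poly_Mapping.single (Monomial xs) 1 * Poly_Mapping.single (Monomial ys) (c :: 'k::field)"
  by (simp add: mult_single plus_monomial_def)

lemma single_Nil: "Poly_Mapping.single (Monomial []) c = const c"
  by (simp add: const_def zero_monomial_def)

text \<open>
  A word is built from a constant by putting letters in front of it, so an induction over
  noncommutative polynomials needs only left multiplication by single letters.
\<close>

lemma free_algebra_induct [consumes 1, case_names const add gen]:
  fixes p :: "('k::field, 's) free_algebra"
  assumes "p \<in> carrier (free_algebra X)" and c: "\<And>c. P (const c)"
    and add: "\<And>p q. p \<in> carrier (free_algebra X) \<Longrightarrow> q \<in> carrier (free_algebra X) \<Longrightarrow> P p \<Longrightarrow> P q \<Longrightarrow> P (p + q)"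
    and gen: "\<And>x p. x \<in> X \<Longrightarrow> p \<in> carrier (free_algebra X) \<Longrightarrow> P p \<Longrightarrow> P (gen x * p)"
  shows "P p"
proof -
  let ?W = "{w. set (letters w) \<subseteq> X}"
  have W: "Poly_Mapping.keys q \<subseteq> ?W \<longleftrightarrow> q \<in> carrier (free_algebra X)" for q :: "('k, 's) free_algebra"
    by (auto simp: mem_free_algebra_iff)
  have s: "P (Poly_Mapping.single (Monomial xs) c)" if "set xs \<subseteq> X" for xs c
    using that
  proof (induction xs)
    case (Cons x xs)
    then show ?case unfolding single_Cons by (intro gen) (auto simp: mem_free_algebra_iff)
  qed (simp add: single_Nil c)
  have "Poly_Mapping.keys p \<subseteq> ?W" using assms(1) W by blast
  then show ?thesis
  proof (induction p rule: poly_sum_induct)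
    case zero
    then show ?case using c[of 0] by (simp add: const_simps)
  next
    case (single w d)
    then show ?case using s[of "letters w" d] by simp
  qed (auto simp: W add)
qed

lemma const_commute: "const c * p = p * const c"
proof -
  have "p \<in> carrier (free_algebra UNIV)" by (simp add: mem_free_algebra_iff)
  then show ?thesis
  proof (induction rule: free_algebra_induct)
    case (const d)
    show ?case by (simp add: const_simps(4)[symmetric] mult.commute)
  next
    case (gen x p)
    have "const c * gen x = gen x * const c" by (simp add: const_def gen_def mult_single)
    have "const c * (gen x * p) = gen x * (const c * p)" by (simp only: mult.assoc[symmetric] \<open>const c * gen x = _\<close>)
    then show ?case by (simp only: gen.IH mult.assoc)
  qed (simp add: algebra_simps)
qed

lemma const_mult_single: "const c * Poly_Mapping.single w d = Poly_Mapping.single w (c * d)"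
  by (simp add: const_def mult_single)

lemma sum_closed:
  assumes "0 \<in> A" "\<And>x y. x \<in> A \<Longrightarrow> y \<in> A \<Longrightarrow> x + y \<in> A" "\<And>i. i \<in> I \<Longrightarrow> f i \<in> A"
  shows "sum f I \<in> A"
  using assms(3) by (induction I rule: infinite_finite_induct) (auto simp: assms(1,2))

context lie_superalgebra begin

lemma part_zero: "0 \<in> part L i"
  using subspace_0[OF subspace_part] .

lemma zero_superspace: "0 \<in> superspace L"
  using part_superspace[OF part_zero] .

lemma superspace_add: "x \<in> superspace L \<Longrightarrow> y \<in> superspace L \<Longrightarrow> x + y \<in> superspace L"
proof -
  assume "x \<in> superspace L" "y \<in> superspace L"
  then obtain a b c d where "x = a + b" "y = c + d" "a \<in> part L 0" "c \<in> part L 0" "b \<in> part L 1" "d \<in> part L 1"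
    by (auto simp: superspace_def)
  then have "x + y = (a + c) + (b + d)" "a + c \<in> part L 0" "b + d \<in> part L 1"
    using subspace_add[OF subspace_part] by (auto simp: algebra_simps)
  then show ?thesis unfolding superspace_def by blast
qed

lemma superspace_scale: "x \<in> superspace L \<Longrightarrow> lscale L c x \<in> superspace L"
  using subspace_scale[OF subspace_part] unfolding superspace_def by (force simp: scale_right_distrib)

text \<open>
  \<open>F\<close> and \<open>I\<close> are the free algebra and the ideal of which the enveloping algebra is the quotient.
  Most computations take place in \<open>F\<close> modulo \<open>I\<close>, where the ring operations are those of a type.
\<close>

abbreviation "F \<equiv> carrier (free_algebra (superspace L)) :: ('a, 'b) free_algebra set"

abbreviation "I \<equiv> env_ideal L"

lemma env_rels_closed: "env_rels L \<subseteq> F"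
  unfolding env_rels_def
  by (auto intro!: free_algebra_closed superspace_add superspace_scale
    intro: part_superspace bracket_part square_part)

lemma ideal_I: "ideal I (free_algebra (superspace L))"
  unfolding env_ideal_def by (rule ring.genideal_ideal[OF ring_free_algebra env_rels_closed])

lemma rels_I: "p \<in> env_rels L \<Longrightarrow> p \<in> I"
  unfolding env_ideal_def using ring.genideal_self[OF ring_free_algebra env_rels_closed] by blast

lemma I_closed:
  shows I_F: "p \<in> I \<Longrightarrow> p \<in> F"
    and I_zero: "0 \<in> I"
    and I_add: "p \<in> I \<Longrightarrow> q \<in> I \<Longrightarrow> p + q \<in> I"
    and I_lmult: "p \<in> F \<Longrightarrow> q \<in> I \<Longrightarrow> p * q \<in> I"
    and I_rmult: "p \<in> I \<Longrightarrow> q \<in> F \<Longrightarrow> p * q \<in> I"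
proof -
  interpret ideal I "free_algebra (superspace L)" by (rule ideal_I)
  show "p \<in> I \<Longrightarrow> p \<in> F" using a_subset by blast
  show "0 \<in> I" using additive_subgroup.zero_closed[OF additive_subgroup_axioms] by simp
  show "p \<in> I \<Longrightarrow> q \<in> I \<Longrightarrow> p + q \<in> I"
    using additive_subgroup.a_closed[OF additive_subgroup_axioms, of p q] by simp
  show "p \<in> F \<Longrightarrow> q \<in> I \<Longrightarrow> p * q \<in> I" using I_l_closed[of q p] by simp
  show "p \<in> I \<Longrightarrow> q \<in> F \<Longrightarrow> p * q \<in> I" using I_r_closed[of p q] by simp
qed


lemma I_minus: "p \<in> I \<Longrightarrow> - p \<in> I"
  using I_lmult[of "- 1" p] by (simp add: free_algebra_closed)

lemma I_diff: "p \<in> I \<Longrightarrow> q \<in> I \<Longrightarrow> p - q \<in> I"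
  using I_add[OF _ I_minus, of p q] by simp

lemma ring_env: "ring (env L)"
  unfolding env_def by (rule ideal.quotient_is_ring[OF ideal_I])

lemma env_class_hom: "env_class L \<in> ring_hom (free_algebra (superspace L)) (env L)"
  using ideal.rcos_ring_hom[OF ideal_I] by (simp add: env_class_def[abs_def] env_def)

lemma env_class_in: "p \<in> F \<Longrightarrow> env_class L p \<in> carrier (env L)"
  using ring_hom_closed[OF env_class_hom] .

lemma env_class_add: "p \<in> F \<Longrightarrow> q \<in> F \<Longrightarrow> env_class L (p + q) = env_class L p \<oplus>\<^bsub>env L\<^esub> env_class L q"
  using ring_hom_add[OF env_class_hom] by simp

lemma env_class_mult: "p \<in> F \<Longrightarrow> q \<in> F \<Longrightarrow> env_class L (p * q) = env_class L p \<otimes>\<^bsub>env L\<^esub> env_class L q"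
  using ring_hom_mult[OF env_class_hom] by simp

lemma env_class_one: "env_class L 1 = \<one>\<^bsub>env L\<^esub>"
  using ring_hom_one[OF env_class_hom] by simp

lemma env_class_zero: "env_class L 0 = \<zero>\<^bsub>env L\<^esub>"
  using ring_hom_zero[OF env_class_hom ring_free_algebra ring_env] by simp

lemma env_class_eq_iff:
  assumes "p \<in> F" "q \<in> F" shows "env_class L p = env_class L q \<longleftrightarrow> p - q \<in> I"
proof -
  interpret R: ring "free_algebra (superspace L)" by (rule ring_free_algebra)
  have "\<ominus>\<^bsub>free_algebra (superspace L)\<^esub> q = - q"
    using assms free_algebra_closed by (intro R.minus_equality) auto
  then show ?thesis
    using R.quotient_eq_iff_same_a_r_cos[OF ideal_I assms]
    by (simp add: env_class_def a_minus_def)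
qed

lemma env_class_eqI: "p \<in> F \<Longrightarrow> q \<in> F \<Longrightarrow> p - q \<in> I \<Longrightarrow> env_class L p = env_class L q"
  using env_class_eq_iff by blast

lemma env_carrierE:
  assumes "u \<in> carrier (env L)" obtains p where "p \<in> F" "u = env_class L p"
  using assms
  by (auto simp: env_def FactRing_def A_RCOSETS_def RCOSETS_def env_class_def a_r_coset_def)

lemma rep_env:
  assumes "u \<in> carrier (env L)"
  shows rep_env_closed: "rep u \<in> F" and env_class_rep: "env_class L (rep u) = u"
proof -
  obtain p where p: "p \<in> F" "u = env_class L p" using assms by (rule env_carrierE)
  have u: "u = {h + p | h. h \<in> I}"
    unfolding p(2) env_class_def by (auto simp: a_r_coset_def r_coset_def)
  have "0 + p \<in> u" unfolding u using I_zero by blast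
  then have "rep u \<in> u" unfolding rep_def by (rule someI)
  then obtain h where h: "h \<in> I" "rep u = h + p" unfolding u by blast
  show "rep u \<in> F" unfolding h(2) using p(1) h(1) by (simp add: I_F free_algebra_closed)
  then have "env_class L (rep u) = env_class L p"
    using p(1) h by (intro env_class_eqI) simp_all
  then show "env_class L (rep u) = u" by (simp add: p(2))
qed

lemma rep_env_class:
  assumes "p \<in> F" shows "rep (env_class L p) \<in> F" "rep (env_class L p) - p \<in> I"
  using rep_env[OF env_class_in[OF assms]] env_class_eq_iff assms by auto

lemma env_ideal_subsetI:
  assumes J: "J \<subseteq> F" "0 \<in> J" "\<And>p q. p \<in> J \<Longrightarrow> q \<in> J \<Longrightarrow> p + q \<in> J"
    "\<And>p q. p \<in> F \<Longrightarrow> q \<in> J \<Longrightarrow> p * q \<in> J" "\<And>p q. p \<in> J \<Longrightarrow> q \<in> F \<Longrightarrow> p * q \<in> J"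
    and rels: "env_rels L \<subseteq> J"
  shows "I \<subseteq> J"
proof -
  interpret R: ring "free_algebra (superspace L)" by (rule ring_free_algebra)
  have "subgroup J (add_monoid (free_algebra (superspace L)))"
  proof (rule subgroup.intro)
    fix p assume p: "p \<in> J"
    have "\<ominus>\<^bsub>free_algebra (superspace L)\<^esub> p = - p"
      using p J(1) free_algebra_closed(7)[of p] by (intro R.minus_equality) auto
    moreover have "- p \<in> J" using J(4)[of "- 1" p] p by (simp add: free_algebra_closed)
    ultimately show "inv\<^bsub>add_monoid (free_algebra (superspace L))\<^esub> p \<in> J" by (simp add: a_inv_def)
  qed (use J in auto)
  then have "ideal J (free_algebra (superspace L))"
    using J by (intro idealI ring_free_algebra) auto
  then show ?thesis unfolding env_ideal_def using rels by (rule R.genideal_minimal)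
qed

lemma bracket_zero_left: "y \<in> superspace L \<Longrightarrow> bracket L 0 y = 0"
  using bracket_add_left[OF zero_superspace zero_superspace, of y] by simp

lemma bracket_zero_right: "y \<in> superspace L \<Longrightarrow> bracket L y 0 = 0"
  using bracket_add_right[OF _ zero_superspace zero_superspace, of y] by simp

lemma square_zero: "square L 0 = 0"
  using square_scale[OF part_zero, of 0] by simp

lemma part_even_subalgebra: "part (even_subalgebra L) i = (if i = 0 then part L 0 else {0})"
  by (simp add: even_subalgebra_def)

lemma even_subalgebra_simps [simp]:
  "lscale (even_subalgebra L) = lscale L" "bracket (even_subalgebra L) = bracket L"
  "square (even_subalgebra L) = square L" "part (even_subalgebra L) 0 = part L 0"
  by (simp_all add: even_subalgebra_def)

lemma part_even_subset: "x \<in> part (even_subalgebra L) i \<Longrightarrow> x \<in> part L i"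
  using part_zero by (auto simp: part_even_subalgebra split: if_splits)

lemma superspace_even [simp]: "superspace (even_subalgebra L) = part L 0"
  by (auto simp: superspace_def part_even_subalgebra)

lemma lie_superalgebra_even: "lie_superalgebra (even_subalgebra L)"
proof -
  have sub: "\<And>x. x \<in> part L 0 \<Longrightarrow> x \<in> superspace L" using part_superspace .
  note p = part_even_subset
  have br: "bracket L x y \<in> part (even_subalgebra L) (i + j)"
    if xy: "x \<in> part (even_subalgebra L) i" "y \<in> part (even_subalgebra L) j" for x y i j
  proof (cases "i = 0 \<and> j = 0")
    case True
    then show ?thesis using bracket_part[of x 0 y 0] xy by simp
  next
    case False
    then have "x = 0 \<or> y = 0" using xy by (auto simp: part_even_subalgebra split: if_splits)
    then have "bracket L x y = 0"
      using bracket_zero_left bracket_zero_right part_superspace[OF p[OF xy(1)]]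
        part_superspace[OF p[OF xy(2)]] by auto
    then show ?thesis using part_zero[of 0] by (simp add: part_even_subalgebra)
  qed
  show ?thesis
  proof (intro lie_superalgebra.intro lie_superbracket.intro lie_superbracket_axioms.intro
      lie_superalgebra_axioms.intro, unfold even_subalgebra_simps superspace_even, goal_cases)
    case 1 then show ?case by (rule vector_space_axioms)
  next
    case (2 i) then show ?case using subspace_part[of 0] subspace_0 by (simp add: part_even_subalgebra)
  next
    case 3 then show ?case using part_zero[of 0] by (simp add: part_even_subalgebra)
  next
    case (8 x i y j) then show ?case by (rule br)
  next
    case (9 x i y j) then show ?case using bracket_skew p by blast
  next
    case (10 x i y j z k) then show ?case using jacobi p by blast
  next
    case (11 x) then show ?case by (rule bracket_even)
  next
    case (12 x) then show ?case using bracket_odd p by blast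
  next
    case (13 x) then show ?case using part_zero[of 0] by (simp add: part_even_subalgebra square_zero)
  next
    case (14 x c) then show ?case using square_scale p by blast
  next
    case (15 x y) then show ?case using square_add p by blast
  next
    case (16 x y) then show ?case using bracket_square p sub by blast
  qed (simp_all add: sub bracket_add_left bracket_add_right bracket_scale_left bracket_scale_right)
qed

abbreviation "F0 \<equiv> carrier (free_algebra (part L 0)) :: ('a, 'b) free_algebra set"

lemma F0_subset: "F0 \<subseteq> F"
  using part_superspace by (force simp: mem_free_algebra_iff)

lemma env_rels_even_subset: "env_rels (even_subalgebra L) \<subseteq> env_rels L"
  unfolding env_rels_def even_subalgebra_simps superspace_even
  using part_even_subset part_superspace by blast

lemma env_ideal_even_subset: "env_ideal (even_subalgebra L) \<subseteq> I"
proof -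
  interpret L0: lie_superalgebra "even_subalgebra L" by (rule lie_superalgebra_even)
  have "env_ideal (even_subalgebra L) \<subseteq> F0 \<inter> I"
  proof (rule L0.env_ideal_subsetI)
    show "env_rels (even_subalgebra L) \<subseteq> F0 \<inter> I"
      using env_rels_even_subset rels_I L0.env_rels_closed by auto
  qed (use F0_subset in \<open>auto simp: free_algebra_closed I_add I_lmult I_rmult I_zero\<close>)
  then show ?thesis by blast
qed

text \<open>
  The canonical map does not depend on representatives, because the relations of the even
  subalgebra are among those of \<open>L\<close>.
\<close>

lemma env_map_class:
  assumes "p \<in> F0"
  shows "env_map L (env_class (even_subalgebra L) p) = env_class L p"
proof -
  interpret L0: lie_superalgebra "even_subalgebra L" by (rule lie_superalgebra_even)
  have "rep (env_class (even_subalgebra L) p) \<in> F0"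
    "rep (env_class (even_subalgebra L) p) - p \<in> I"
    using L0.rep_env_class[of p] assms env_ideal_even_subset by auto
  then show ?thesis unfolding env_map_def using assms F0_subset by (intro env_class_eqI) auto
qed

lemma env_map_hom: "env_map L \<in> ring_hom (env_even L) (env L)"
proof -
  interpret L0: lie_superalgebra "even_subalgebra L" by (rule lie_superalgebra_even)
  note F = subsetD[OF F0_subset]
  show ?thesis
  proof (rule ring_hom_memI)
    fix u assume "u \<in> carrier (env_even L)"
    then show "env_map L u \<in> carrier (env L)"
      by (elim L0.env_carrierE) (simp add: env_map_class env_class_in F)
  next
    fix u v assume "u \<in> carrier (env_even L)" "v \<in> carrier (env_even L)"
    then obtain p q where pq: "p \<in> F0" "q \<in> F0" and u: "u = env_class (even_subalgebra L) p" and v: "v = env_class (even_subalgebra L) q"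
      by (metis L0.env_carrierE superspace_even)
    note cl = free_algebra_closed(5,6)[OF pq]
    have m: "u \<otimes>\<^bsub>env_even L\<^esub> v = env_class (even_subalgebra L) (p * q)"
      and a: "u \<oplus>\<^bsub>env_even L\<^esub> v = env_class (even_subalgebra L) (p + q)"
      using pq L0.env_class_mult L0.env_class_add by (simp_all add: u v)
    show "env_map L (u \<otimes>\<^bsub>env_even L\<^esub> v) = env_map L u \<otimes>\<^bsub>env L\<^esub> env_map L v"
      unfolding m unfolding u v using pq cl by (simp add: env_map_class env_class_mult F)
    show "env_map L (u \<oplus>\<^bsub>env_even L\<^esub> v) = env_map L u \<oplus>\<^bsub>env L\<^esub> env_map L v"
      unfolding a unfolding u v using pq cl by (simp add: env_map_class env_class_add F)
  next
    show "env_map L \<one>\<^bsub>env_even L\<^esub> = \<one>\<^bsub>env L\<^esub>"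
      unfolding L0.env_class_one[symmetric] by (simp add: env_map_class free_algebra_closed env_class_one)
  qed
qed

end

section \<open>Representations of the even part\<close>

text \<open>
  Operators \<open>ac x\<close>, for \<open>x\<close> in the even part, on the quotient of \<open>C\<close> by \<open>N\<close> that satisfy the
  relations of the Lie algebra. By the universal property of the enveloping algebra they
  extend to an action of it on \<open>C / N\<close>, and \<open>act\<close> is that extension.
\<close>

locale even_operators = lie_superalgebra L + subgroup_cong N
  for L :: "('k::field, 's::ab_group_add) superalgebra" and N :: "'x::ab_group_add set" +
  fixes C :: "'x set" and sc :: "'k \<Rightarrow> 'x \<Rightarrow> 'x" and ac :: "'s \<Rightarrow> 'x \<Rightarrow> 'x"
  assumes C_zero: "0 \<in> C" and C_add: "f \<in> C \<Longrightarrow> g \<in> C \<Longrightarrow> f + g \<in> C"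
    and sc_C: "f \<in> C \<Longrightarrow> sc c f \<in> C" and sc_N: "f \<in> N \<Longrightarrow> sc c f \<in> N"
    and sc_add: "sc c (f + g) = sc c f + sc c g"
    and ac_C: "x \<in> part L 0 \<Longrightarrow> f \<in> C \<Longrightarrow> ac x f \<in> C"
    and ac_N: "x \<in> part L 0 \<Longrightarrow> f \<in> N \<Longrightarrow> ac x f \<in> N"
    and ac_add: "ac x (f + g) = ac x f + ac x g"
    and sc_plus: "f \<in> C \<Longrightarrow> sc (c + d) f - (sc c f + sc d f) \<in> N"
    and sc_mult: "f \<in> C \<Longrightarrow> sc (c * d) f - sc c (sc d f) \<in> N"
    and sc_one: "f \<in> C \<Longrightarrow> sc 1 f - f \<in> N"
    and sc_ac: "x \<in> part L 0 \<Longrightarrow> f \<in> C \<Longrightarrow> sc c (ac x f) - ac x (sc c f) \<in> N"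
    and ac_plus: "x \<in> part L 0 \<Longrightarrow> y \<in> part L 0 \<Longrightarrow> f \<in> C \<Longrightarrow> ac (x + y) f - (ac x f + ac y f) \<in> N"
    and ac_scale: "x \<in> part L 0 \<Longrightarrow> f \<in> C \<Longrightarrow> ac (lscale L c x) f - sc c (ac x f) \<in> N"
    and ac_bracket: "x \<in> part L 0 \<Longrightarrow> y \<in> part L 0 \<Longrightarrow> f \<in> C \<Longrightarrow>
      ac x (ac y f) - (ac y (ac x f) + ac (bracket L x y) f) \<in> N"
begin

definition act :: "('k, 's) free_algebra \<Rightarrow> 'x \<Rightarrow> 'x"
  where "act p f = (\<Sum>w\<in>Poly_Mapping.keys p. sc (Poly_Mapping.lookup p w) (foldr ac (letters w) f))"

abbreviation "words \<equiv> {w. set (letters w) \<subseteq> part L 0}"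

lemma words_iff: "Poly_Mapping.keys p \<subseteq> words \<longleftrightarrow> p \<in> F0"
  by (auto simp: mem_free_algebra_iff)

lemma sc_zero: "sc c 0 = 0" using sc_add[of c 0 0] by simp

lemma ac_zero: "ac x 0 = 0" using ac_add[of x 0 0] by simp

lemma sc_diff: "sc c (f - g) = sc c f - sc c g" using sc_add[of c "f - g" g] by (simp add: algebra_simps)

lemma ac_diff: "ac x (f - g) = ac x f - ac x g" using ac_add[of x "f - g" g] by (simp add: algebra_simps)

lemma sc_cong: "f \<doteq> g \<Longrightarrow> sc c f \<doteq> sc c g"
  using sc_N by (simp add: cong_def sc_diff[symmetric])

lemma ac_cong: "x \<in> part L 0 \<Longrightarrow> f \<doteq> g \<Longrightarrow> ac x f \<doteq> ac x g"
  using ac_N by (simp add: cong_def ac_diff[symmetric])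

lemma sc_zero_left: "f \<in> C \<Longrightarrow> sc 0 f \<doteq> 0"
  using sc_plus[of f 0 0] N_minus by (fastforce simp: cong_def)

lemma foldr_C: "set xs \<subseteq> part L 0 \<Longrightarrow> f \<in> C \<Longrightarrow> foldr ac xs f \<in> C"
  by (induction xs) (auto simp: ac_C)

lemma foldr_N: "set xs \<subseteq> part L 0 \<Longrightarrow> f \<in> N \<Longrightarrow> foldr ac xs f \<in> N"
  by (induction xs) (auto simp: ac_N)

lemma foldr_add: "foldr ac xs (f + g) = foldr ac xs f + foldr ac xs g"
  by (induction xs) (auto simp: ac_add)

lemma act_C: "p \<in> F0 \<Longrightarrow> f \<in> C \<Longrightarrow> act p f \<in> C"
  unfolding act_def
  by (intro sum_closed C_zero C_add sc_C foldr_C) (auto simp: mem_free_algebra_iff)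

lemma act_N: "p \<in> F0 \<Longrightarrow> f \<in> N \<Longrightarrow> act p f \<in> N"
  unfolding act_def
  by (intro sum_closed N_zero N_add sc_N foldr_N) (auto simp: mem_free_algebra_iff)

lemma act_add: "act p (f + g) = act p f + act p g"
  unfolding act_def by (simp add: foldr_add sc_add sum.distrib)

lemma act_zero_left: "act 0 f = 0"
  by (simp add: act_def)

lemma act_diff: "act p (f - g) = act p f - act p g"
  using act_add[of p "f - g" g] by (simp add: algebra_simps)

lemma act_cong: "p \<in> F0 \<Longrightarrow> f \<doteq> g \<Longrightarrow> act p f \<doteq> act p g"
  using act_N by (simp add: cong_def act_diff[symmetric])

text \<open>
  Summing over a set of words that does not depend on \<open>p\<close> makes the action visibly additive in \<open>p\<close>;
  the new summands have coefficient \<open>0\<close> and vanish modulo \<open>N\<close>.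
\<close>

lemma act_superset:
  assumes "Poly_Mapping.keys p \<subseteq> A" "finite A" "A \<subseteq> words" "f \<in> C"
  shows "act p f \<doteq> (\<Sum>w\<in>A. sc (Poly_Mapping.lookup p w) (foldr ac (letters w) f))"
proof -
  let ?g = "\<lambda>w. sc (Poly_Mapping.lookup p w) (foldr ac (letters w) f)"
  have "sum ?g (A - Poly_Mapping.keys p) \<doteq> sum (\<lambda>_. 0) (A - Poly_Mapping.keys p)"
    using assms(3,4) by (intro cong_sum) (auto simp: in_keys_iff intro!: sc_zero_left foldr_C)
  moreover have "sum ?g A = sum ?g (A - Poly_Mapping.keys p) + sum ?g (Poly_Mapping.keys p)"
    using assms by (intro sum.subset_diff) auto
  ultimately show ?thesis
    using cong_add[OF cong_sym cong_refl, of 0 _ "act p f"] by (simp add: act_def cong_sym cong_refl)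
qed

lemma act_plus:
  assumes "p \<in> F0" "q \<in> F0" "f \<in> C" shows "act (p + q) f \<doteq> act p f + act q f"
proof -
  let ?A = "Poly_Mapping.keys p \<union> Poly_Mapping.keys q"
  have A: "?A \<subseteq> words" "finite ?A" using assms by (auto simp: mem_free_algebra_iff)
  have "act (p + q) f \<doteq> (\<Sum>w\<in>?A. sc (Poly_Mapping.lookup (p + q) w) (foldr ac (letters w) f))"
    using A assms Poly_Mapping.keys_add[of p q] by (intro act_superset) auto
  also have "\<dots> \<doteq> (\<Sum>w\<in>?A. sc (Poly_Mapping.lookup p w) (foldr ac (letters w) f) +
      sc (Poly_Mapping.lookup q w) (foldr ac (letters w) f))"
    using A assms(3) unfolding lookup_add
    by (intro cong_sum) (auto simp: cong_def intro!: sc_plus foldr_C)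
  also have "\<dots> \<doteq> act p f + act q f"
    unfolding sum.distrib using A assms by (intro cong_add cong_sym[OF act_superset]) auto
  finally show ?thesis .
qed

lemma act_single:
  assumes "set (letters w) \<subseteq> part L 0" "f \<in> C"
  shows "act (Poly_Mapping.single w c) f \<doteq> sc c (foldr ac (letters w) f)"
  using act_superset[of "Poly_Mapping.single w c" "{w}" f] assms by simp

lemma act_const_mult:
  assumes "p \<in> F0" "f \<in> C" shows "act (const c * p) f \<doteq> sc c (act p f)"
proof -
  have "Poly_Mapping.keys p \<subseteq> words" using assms words_iff by simp
  then show ?thesis
  proof (induction p rule: poly_sum_induct)
    case zero
    show ?case by (simp add: act_zero_left sc_zero cong_refl)
  next
    case (add p q)
    then have pq: "p \<in> F0" "q \<in> F0" by (simp_all add: words_iff)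
    have "act (const c * (p + q)) f \<doteq> act (const c * p) f + act (const c * q) f"
      unfolding distrib_left using pq assms(2) by (intro act_plus free_algebra_closed)
    also have "\<dots> \<doteq> sc c (act p f) + sc c (act q f)" using add by (intro cong_add)
    also have "\<dots> = sc c (act p f + act q f)" by (simp add: sc_add)
    also have "\<dots> \<doteq> sc c (act (p + q) f)" using pq assms(2) by (intro sc_cong cong_sym[OF act_plus])
    finally show ?case .
  next
    case (single w d)
    then have w: "set (letters w) \<subseteq> part L 0" by simp
    have "act (const c * Poly_Mapping.single w d) f \<doteq> sc (c * d) (foldr ac (letters w) f)"
      unfolding const_mult_single using act_single[OF w assms(2)] by simp
    also have "\<dots> \<doteq> sc c (sc d (foldr ac (letters w) f))"
      using sc_mult[OF foldr_C[OF w assms(2)]] by (simp add: cong_def)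
    also have "\<dots> \<doteq> sc c (act (Poly_Mapping.single w d) f)"
      by (rule sc_cong[OF cong_sym[OF act_single[OF w assms(2)]]])
    finally show ?case .
  qed
qed

lemma act_gen_mult:
  assumes "x \<in> part L 0" "p \<in> F0" "f \<in> C" shows "act (gen x * p) f \<doteq> ac x (act p f)"
proof -
  have "Poly_Mapping.keys p \<subseteq> words" using assms words_iff by simp
  then show ?thesis
  proof (induction p rule: poly_sum_induct)
    case zero
    show ?case by (simp add: act_zero_left ac_zero cong_refl)
  next
    case (add p q)
    then have pq: "p \<in> F0" "q \<in> F0" by (simp_all add: words_iff)
    have "act (gen x * (p + q)) f \<doteq> act (gen x * p) f + act (gen x * q) f"
      unfolding distrib_left using pq assms by (intro act_plus free_algebra_closed)
    also have "\<dots> \<doteq> ac x (act p f) + ac x (act q f)" using add by (intro cong_add)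
    also have "\<dots> = ac x (act p f + act q f)" by (simp add: ac_add)
    also have "\<dots> \<doteq> ac x (act (p + q) f)" using pq assms by (intro ac_cong cong_sym[OF act_plus])
    finally show ?case .
  next
    case (single w d)
    then have w: "set (letters w) \<subseteq> part L 0" by simp
    obtain xs where xs: "w = Monomial xs" by (cases w)
    have "act (gen x * Poly_Mapping.single w d) f \<doteq> sc d (ac x (foldr ac (letters w) f))"
      using act_single[of "Monomial (x # xs)" f d] w assms by (simp add: xs single_Cons)
    also have "\<dots> \<doteq> ac x (sc d (foldr ac (letters w) f))"
      using sc_ac[OF assms(1) foldr_C[OF w assms(3)]] by (simp add: cong_def)
    also have "\<dots> \<doteq> ac x (act (Poly_Mapping.single w d) f)"
      by (rule ac_cong[OF assms(1) cong_sym[OF act_single[OF w assms(3)]]])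
    finally show ?case .
  qed
qed

lemma act_one: "f \<in> C \<Longrightarrow> act 1 f \<doteq> f"
  using cong_trans[OF act_single[of "Monomial []" f 1], of f] sc_one[of f]
  by (simp add: single_Nil const_simps cong_def[of _ f])

lemma act_const: "f \<in> C \<Longrightarrow> act (const c) f \<doteq> sc c f"
  using act_single[of "Monomial []" f c] by (simp add: single_Nil)

lemma act_gen: "x \<in> part L 0 \<Longrightarrow> f \<in> C \<Longrightarrow> act (gen x) f \<doteq> ac x f"
  using cong_trans[OF act_gen_mult[of x 1 f] ac_cong[OF _ act_one]] by (simp add: free_algebra_closed)

lemma act_mult:
  assumes "p \<in> F0" "q \<in> F0" "f \<in> C" shows "act (p * q) f \<doteq> act p (act q f)"
  using assms(1)
proof (induction p rule: free_algebra_induct)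
  case (const c)
  show ?case
    using cong_trans[OF act_const_mult[OF assms(2,3)] cong_sym[OF act_const[OF act_C[OF assms(2,3)]]]] .
next
  case (add p p')
  have "act ((p + p') * q) f \<doteq> act (p * q) f + act (p' * q) f"
    unfolding distrib_right using add assms by (intro act_plus free_algebra_closed)
  also have "\<dots> \<doteq> act p (act q f) + act p' (act q f)" using add by (intro cong_add)
  also have "\<dots> \<doteq> act (p + p') (act q f)" using add assms by (intro cong_sym[OF act_plus] act_C)
  finally show ?case .
next
  case (gen x p)
  have "act (gen x * p * q) f \<doteq> ac x (act (p * q) f)"
    unfolding mult.assoc using gen assms by (intro act_gen_mult free_algebra_closed)
  also have "\<dots> \<doteq> ac x (act p (act q f))" using gen by (intro ac_cong)
  also have "\<dots> \<doteq> act (gen x * p) (act q f)" using gen assms by (intro cong_sym[OF act_gen_mult] act_C)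
  finally show ?case .
qed

lemma act_minus: "p \<in> F0 \<Longrightarrow> f \<in> C \<Longrightarrow> act (- p) f \<doteq> - act p f"
proof -
  assume *: "p \<in> F0" "f \<in> C"
  have "act (- p + p) f \<doteq> act (- p) f + act p f" using * by (intro act_plus free_algebra_closed)
  then have "- (0 - (act (- p) f + act p f)) \<in> N" by (intro N_minus) (simp add: act_zero_left cong_def)
  then show ?thesis by (simp add: cong_def add.commute)
qed

lemma act_minus_plus: "p \<in> F0 \<Longrightarrow> q \<in> F0 \<Longrightarrow> f \<in> C \<Longrightarrow> act (p - q) f \<doteq> act p f - act q f"
  using cong_trans[OF act_plus[of p "- q" f] cong_add[OF cong_refl act_minus[of q f]]]
  by (simp add: free_algebra_closed)

lemma act_gen_gen:
  assumes "x \<in> part L 0" "y \<in> part L 0" "f \<in> C"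
  shows "act (gen x * gen y) f \<doteq> ac x (ac y f)"
proof -
  have "act (gen x * gen y) f \<doteq> ac x (act (gen y) f)"
    using assms by (intro act_gen_mult free_algebra_closed)
  also have "\<dots> \<doteq> ac x (ac y f)" using assms by (intro ac_cong act_gen)
  finally show ?thesis .
qed

lemma ac_zero_left: "f \<in> C \<Longrightarrow> ac 0 f \<doteq> 0"
  using cong_trans[of "ac 0 f" "sc 0 (ac 0 f)" 0] ac_scale[OF part_zero, of f 0]
    sc_zero_left[of "ac 0 f"] ac_C[OF part_zero, of f] by (simp add: cong_def)

text \<open>
  The odd part of the even subalgebra is zero, so a relation with an odd letter only involves the
  letter \<open>0\<close>, which acts by zero modulo \<open>N\<close>. The other relations are those of the Lie algebra.
\<close>

lemma act_rels:
  assumes p: "p \<in> env_rels (even_subalgebra L)" and f: "f \<in> C"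
  shows "act p f \<doteq> 0"
proof -
  note cl = free_algebra_closed subspace_add[OF subspace_part] subspace_scale[OF subspace_part]
  consider (add) x y where "x \<in> part L 0" "y \<in> part L 0" "p = gen (x + y) - gen x - gen y"
    | (scale) c x where "x \<in> part L 0" "p = gen (lscale L c x) - const c * gen x"
    | (bracket) x y i j where "x \<in> part (even_subalgebra L) i" "y \<in> part (even_subalgebra L) j"
      "p = gen x * gen y - const (koszul i j) * gen y * gen x - gen (bracket L x y)"
    | (square) x where "x \<in> part (even_subalgebra L) 1" "p = gen x * gen x - gen (square L x)"
    using p unfolding env_rels_def even_subalgebra_simps superspace_even by blast
  then show ?thesis
  proof cases
    case add
    have "act p f \<doteq> act (gen (x + y) - gen x) f - act (gen y) f"
      unfolding add(3) using add f by (intro act_minus_plus cl)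
    also have "\<dots> \<doteq> act (gen (x + y)) f - act (gen x) f - act (gen y) f"
      using add f by (intro cong_diff act_minus_plus cong_refl cl)
    also have "\<dots> \<doteq> ac (x + y) f - ac x f - ac y f"
      using add f by (intro cong_diff act_gen cl)
    also have "\<dots> \<doteq> 0" using ac_plus[OF add(1,2) f] by (simp add: cong_zero_iff algebra_simps)
    finally show ?thesis .
  next
    case scale
    have "act p f \<doteq> act (gen (lscale L c x)) f - act (const c * gen x) f"
      unfolding scale(2) using scale f by (intro act_minus_plus cl)
    also have "\<dots> \<doteq> ac (lscale L c x) f - sc c (act (gen x) f)"
      using scale f by (intro cong_diff act_gen act_const_mult cl)
    also have "\<dots> \<doteq> ac (lscale L c x) f - sc c (ac x f)"
      using scale f by (intro cong_diff act_gen sc_cong cong_refl)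
    also have "\<dots> \<doteq> 0" using ac_scale[OF scale(1) f] by (simp add: cong_zero_iff)
    finally show ?thesis .
  next
    case bracket
    have xy: "x \<in> part L 0" "y \<in> part L 0"
      using bracket(1,2) part_zero by (auto simp: part_even_subalgebra split: if_splits)
    have b: "bracket L x y \<in> part L 0" using bracket_part[OF xy] by simp
    have k: "koszul i j = (1 :: 'k) \<or> x = 0 \<and> y = 0"
      using bracket(1,2) by (auto simp: koszul_def part_even_subalgebra)
    let ?k = "koszul i j :: 'k"
    have "act p f \<doteq> act (gen x * gen y - const ?k * (gen y * gen x)) f - act (gen (bracket L x y)) f"
      unfolding bracket(3) mult.assoc using xy b f by (intro act_minus_plus cl)
    also have "\<dots> \<doteq> act (gen x * gen y) f - act (const ?k * (gen y * gen x)) f - act (gen (bracket L x y)) f"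
      using xy b f by (intro cong_diff act_minus_plus cong_refl cl)
    also have "\<dots> \<doteq> ac x (ac y f) - sc ?k (act (gen y * gen x) f) - ac (bracket L x y) f"
      using xy b f by (intro cong_diff act_gen_gen act_gen act_const_mult cl)
    also have "\<dots> \<doteq> ac x (ac y f) - sc ?k (ac y (ac x f)) - ac (bracket L x y) f"
      using xy b f by (intro cong_diff act_gen_gen sc_cong cong_refl)
    also have "\<dots> \<doteq> 0"
      using k
    proof
      assume k: "?k = 1"
      have "ac x (ac y f) - sc ?k (ac y (ac x f)) - ac (bracket L x y) f \<doteq>
          ac x (ac y f) - ac y (ac x f) - ac (bracket L x y) f"
        unfolding k using sc_one[of "ac y (ac x f)"] ac_C xy f
        by (intro cong_diff cong_refl) (simp add: cong_def)
      also have "\<dots> \<doteq> 0" using ac_bracket[OF xy f] by (simp add: cong_zero_iff algebra_simps)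
      finally show ?thesis .
    next
      assume "x = 0 \<and> y = 0"
      then have z: "x = 0" "y = 0" "bracket L x y = 0" using bracket_zero_left zero_superspace by auto
      have "ac 0 (ac 0 f) \<doteq> 0" using ac_zero_left ac_C part_zero f by blast
      then have "ac 0 (ac 0 f) - sc ?k (ac 0 (ac 0 f)) - ac 0 f \<doteq> 0 - sc ?k 0 - 0"
        using ac_C[OF part_zero f] f by (intro cong_diff sc_cong ac_zero_left)
      then show ?thesis using z by (simp add: sc_zero)
    qed
    finally show ?thesis .
  next
    case square
    have x: "x = 0" using square(1) by (simp add: part_even_subalgebra)
    have "act p f \<doteq> act (gen 0 * gen 0) f - act (gen 0) f"
      unfolding square(2) x square_zero using f part_zero by (intro act_minus_plus cl)
    also have "\<dots> \<doteq> ac 0 (ac 0 f) - ac 0 f"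
      using f part_zero by (intro cong_diff act_gen_gen act_gen)
    also have "\<dots> \<doteq> 0 - 0"
      using f part_zero by (intro cong_diff ac_zero_left ac_C)
    finally show ?thesis by simp
  qed
qed

lemma act_env_ideal:
  assumes "p \<in> env_ideal (even_subalgebra L)" "f \<in> C"
  shows "act p f \<doteq> 0"
proof -
  interpret L0: lie_superalgebra "even_subalgebra L" by (rule lie_superalgebra_even)
  let ?J = "{p \<in> F0. \<forall>f\<in>C. act p f \<doteq> 0}"
  have "env_ideal (even_subalgebra L) \<subseteq> ?J"
  proof (rule L0.env_ideal_subsetI)
    show "p + q \<in> ?J" if "p \<in> ?J" "q \<in> ?J" for p q
      using that cong_trans[OF act_plus[of p q] cong_add[of _ 0 _ 0]] by (auto intro: free_algebra_closed)
    show "p * q \<in> ?J" if p: "p \<in> carrier (free_algebra (superspace (even_subalgebra L)))" and q: "q \<in> ?J" for p q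
    proof -
      have pq: "p \<in> F0" "q \<in> F0" using p q by simp_all
      have "act (p * q) f \<doteq> 0" if f: "f \<in> C" for f
      proof -
        have "act (p * q) f \<doteq> act p (act q f)" using pq f by (rule act_mult)
        also have "\<dots> \<doteq> act p 0" using q f pq(1) by (intro act_cong) auto
        also have "act p 0 = 0" using act_add[of p 0 0] by simp
        finally show ?thesis .
      qed
      then show ?thesis using free_algebra_closed(6)[OF pq] by simp
    qed
    show "p * q \<in> ?J" if "p \<in> ?J" "q \<in> carrier (free_algebra (superspace (even_subalgebra L)))" for p q
    proof -
      have "act (p * q) f \<doteq> 0" if f: "f \<in> C" for f
        using cong_trans[OF act_mult[of p q f]] \<open>p \<in> ?J\<close> \<open>q \<in> _\<close> act_C[of q f] f by simp
      then show ?thesis using that by (auto intro: free_algebra_closed)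
    qed
    show "env_rels (even_subalgebra L) \<subseteq> ?J"
      using L0.env_rels_closed act_rels by auto
  qed (auto simp: free_algebra_closed act_zero_left cong_refl)
  then show ?thesis using assms by blast
qed

lemma act_eqI:
  assumes "p \<in> F0" "q \<in> F0" "p - q \<in> env_ideal (even_subalgebra L)" "f \<in> C"
  shows "act p f \<doteq> act q f"
proof -
  have "act (p - q) f \<doteq> 0" using act_env_ideal assms by blast
  then have "act p f - act q f \<doteq> 0"
    using cong_trans[OF cong_sym[OF act_minus_plus]] assms by blast
  then show ?thesis by (simp add: cong_def)
qed

text \<open>
  An element \<open>u\<close> of the enveloping algebra acts through its representative \<open>rep u\<close>, another choice
  of which changes the result by an element of \<open>N\<close>.
\<close>

lemma act_rep:
  assumes "f \<in> C"
  shows act_rep_class: "p \<in> F0 \<Longrightarrow> act (rep (env_class (even_subalgebra L) p)) f \<doteq> act p f"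
    and act_rep_add: "u \<in> carrier (env_even L) \<Longrightarrow> v \<in> carrier (env_even L) \<Longrightarrow>
      act (rep (u \<oplus>\<^bsub>env_even L\<^esub> v)) f \<doteq> act (rep u) f + act (rep v) f"
    and act_rep_mult: "u \<in> carrier (env_even L) \<Longrightarrow> v \<in> carrier (env_even L) \<Longrightarrow>
      act (rep (u \<otimes>\<^bsub>env_even L\<^esub> v)) f \<doteq> act (rep u) (act (rep v) f)"
    and act_rep_one: "act (rep \<one>\<^bsub>env_even L\<^esub>) f \<doteq> f"
proof -
  interpret L0: lie_superalgebra "even_subalgebra L" by (rule lie_superalgebra_even)
  show c: "act (rep (env_class (even_subalgebra L) p)) f \<doteq> act p f" if "p \<in> F0" for p
    using L0.rep_env_class[of p] that assms by (intro act_eqI) auto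
  have one: "1 \<in> F0" by (rule free_algebra_closed)
  show "act (rep \<one>\<^bsub>env_even L\<^esub>) f \<doteq> f"
    using cong_trans[OF c[OF one] act_one[OF assms]] by (simp add: L0.env_class_one)
  fix u v assume u: "u \<in> carrier (env_even L)" and v: "v \<in> carrier (env_even L)"
  have r: "rep u \<in> F0" "rep v \<in> F0" using L0.rep_env_closed u v by auto
  have "env_class (even_subalgebra L) (rep u + rep v) = u \<oplus>\<^bsub>env_even L\<^esub> v"
    "env_class (even_subalgebra L) (rep u * rep v) = u \<otimes>\<^bsub>env_even L\<^esub> v"
    using r u v by (simp_all add: L0.env_class_add L0.env_class_mult L0.env_class_rep)
  then show "act (rep (u \<oplus>\<^bsub>env_even L\<^esub> v)) f \<doteq> act (rep u) f + act (rep v) f"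
    "act (rep (u \<otimes>\<^bsub>env_even L\<^esub> v)) f \<doteq> act (rep u) (act (rep v) f)"
    using cong_trans[OF c act_plus, of "rep u" "rep v"] cong_trans[OF c act_mult, of "rep u" "rep v"]
      r assms free_algebra_closed(5,6)[OF r] by simp_all
qed

end

section \<open>Tensor products over the even part\<close>

locale even_module = lie_superalgebra L + M: left_module "env_even L" M
  for L :: "('k::field, 's::ab_group_add) superalgebra" and M :: "(('k, 's) env, 'm, 'z) module_scheme"
begin

sublocale even: lie_superalgebra "even_subalgebra L"
  by (rule lie_superalgebra_even)

abbreviation "kscale \<equiv> env_scale (even_subalgebra L) M"

definition lie_act :: "'s \<Rightarrow> 'm \<Rightarrow> 'm"
  where "lie_act x m = env_class (even_subalgebra L) (gen x) \<odot>\<^bsub>M\<^esub> m"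

definition poly_act :: "('k, 's) free_algebra \<Rightarrow> 'm \<Rightarrow> 'm"
  where "poly_act p m = env_class (even_subalgebra L) p \<odot>\<^bsub>M\<^esub> m"

lemma class_in: "p \<in> F0 \<Longrightarrow> env_class (even_subalgebra L) p \<in> carrier (env_even L)"
  using even.env_class_in by simp

lemma poly_act_closed: "p \<in> F0 \<Longrightarrow> m \<in> carrier M \<Longrightarrow> poly_act p m \<in> carrier M"
  by (simp add: poly_act_def M.smult_closed class_in)

lemma poly_act_add: "p \<in> F0 \<Longrightarrow> q \<in> F0 \<Longrightarrow> m \<in> carrier M \<Longrightarrow> poly_act (p + q) m = poly_act p m \<oplus>\<^bsub>M\<^esub> poly_act q m"
  by (simp add: poly_act_def even.env_class_add M.smult_l_distr class_in)

lemma poly_act_mult: "p \<in> F0 \<Longrightarrow> q \<in> F0 \<Longrightarrow> m \<in> carrier M \<Longrightarrow> poly_act (p * q) m = poly_act p (poly_act q m)"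
  by (simp add: poly_act_def even.env_class_mult M.smult_assoc class_in)

lemma poly_act_eqI:
  assumes "p \<in> F0" "q \<in> F0" "p - q \<in> env_ideal (even_subalgebra L)"
  shows "poly_act p m = poly_act q m"
  using assms even.env_class_eqI[of p q] by (simp add: poly_act_def)

lemma kscale_eq: "kscale c m = poly_act (const c) m" by (simp add: env_scale_def poly_act_def)

lemma lie_act_eq: "lie_act x m = poly_act (gen x) m" by (simp add: lie_act_def poly_act_def)

lemma kscale_closed: "m \<in> carrier M \<Longrightarrow> kscale c m \<in> carrier M"
  by (simp add: kscale_eq poly_act_closed free_algebra_closed)

lemma lie_act_closed: "x \<in> part L 0 \<Longrightarrow> m \<in> carrier M \<Longrightarrow> lie_act x m \<in> carrier M"
  by (simp add: lie_act_eq poly_act_closed free_algebra_closed)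

lemma kscale_add: "m \<in> carrier M \<Longrightarrow> n \<in> carrier M \<Longrightarrow> kscale c (m \<oplus>\<^bsub>M\<^esub> n) = kscale c m \<oplus>\<^bsub>M\<^esub> kscale c n"
  by (simp add: env_scale_def M.smult_r_distr class_in free_algebra_closed)

lemma lie_act_add: "x \<in> part L 0 \<Longrightarrow> m \<in> carrier M \<Longrightarrow> n \<in> carrier M \<Longrightarrow>
    lie_act x (m \<oplus>\<^bsub>M\<^esub> n) = lie_act x m \<oplus>\<^bsub>M\<^esub> lie_act x n"
  by (simp add: lie_act_def M.smult_r_distr class_in free_algebra_closed)

lemma kscale_plus: "m \<in> carrier M \<Longrightarrow> kscale (c + d) m = kscale c m \<oplus>\<^bsub>M\<^esub> kscale d m"
  by (simp add: kscale_eq const_simps poly_act_add free_algebra_closed)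

lemma kscale_mult: "m \<in> carrier M \<Longrightarrow> kscale (c * d) m = kscale c (kscale d m)"
  by (simp add: kscale_eq const_simps poly_act_mult free_algebra_closed)

lemma kscale_one: "m \<in> carrier M \<Longrightarrow> kscale 1 m = m"
  by (simp add: kscale_eq const_simps poly_act_def even.env_class_one M.smult_one)

lemma kscale_lie_act: "x \<in> part L 0 \<Longrightarrow> m \<in> carrier M \<Longrightarrow> kscale c (lie_act x m) = lie_act x (kscale c m)"
  by (simp add: kscale_eq lie_act_eq poly_act_mult[symmetric] free_algebra_closed const_commute)

lemma even_rels: "p \<in> env_rels (even_subalgebra L) \<Longrightarrow> p \<in> env_ideal (even_subalgebra L)"
  by (rule even.rels_I)

lemma lie_act_plus:
  assumes "x \<in> part L 0" "y \<in> part L 0" "m \<in> carrier M"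
  shows "lie_act (x + y) m = lie_act x m \<oplus>\<^bsub>M\<^esub> lie_act y m"
proof -
  have "gen (x + y) - gen x - gen y \<in> env_ideal (even_subalgebra L)"
    using assms by (intro even_rels) (auto simp: env_rels_def)
  then have "poly_act (gen (x + y)) m = poly_act (gen x + gen y) m"
    using assms subspace_add[OF subspace_part, of x 0 y]
    by (intro poly_act_eqI) (simp_all add: free_algebra_closed algebra_simps)
  then show ?thesis using assms by (simp add: lie_act_eq poly_act_add free_algebra_closed)
qed

lemma lie_act_scale:
  assumes "x \<in> part L 0" "m \<in> carrier M"
  shows "lie_act (lscale L c x) m = kscale c (lie_act x m)"
proof -
  have "gen (lscale L c x) - const c * gen x \<in> env_ideal (even_subalgebra L)"
    using assms by (intro even_rels) (auto simp: env_rels_def)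
  then have "poly_act (gen (lscale L c x)) m = poly_act (const c * gen x) m"
    using assms subspace_scale[OF subspace_part, of x 0 c]
    by (intro poly_act_eqI) (simp_all add: free_algebra_closed)
  then show ?thesis using assms by (simp add: lie_act_eq kscale_eq poly_act_mult free_algebra_closed)
qed

lemma lie_act_bracket:
  assumes "x \<in> part L 0" "y \<in> part L 0" "m \<in> carrier M"
  shows "lie_act x (lie_act y m) = lie_act y (lie_act x m) \<oplus>\<^bsub>M\<^esub> lie_act (bracket L x y) m"
proof -
  have "gen x * gen y - const (koszul 0 0) * gen y * gen x - gen (bracket (even_subalgebra L) x y) \<in>
      {gen x * gen y - const (koszul i j) * gen y * gen x - gen (bracket (even_subalgebra L) x y) | x y i j.
        x \<in> part (even_subalgebra L) i \<and> y \<in> part (even_subalgebra L) j}"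
    using assms
    by (intro CollectI exI[of _ x] exI[of _ y] exI[of _ "0 :: bit"] conjI refl) simp_all
  then have "gen x * gen y - const (koszul 0 0) * gen y * gen x - gen (bracket (even_subalgebra L) x y)
      \<in> env_rels (even_subalgebra L)"
    unfolding env_rels_def by (rule UnI1[OF UnI2])
  then have "gen x * gen y - gen y * gen x - gen (bracket L x y) \<in> env_ideal (even_subalgebra L)"
    using even_rels[of "gen x * gen y - const (koszul 0 0) * gen y * gen x - gen (bracket L x y)"]
    by (simp add: koszul_def const_simps)
  then have "poly_act (gen x * gen y) m = poly_act (gen y * gen x + gen (bracket L x y)) m"
    using assms bracket_part[of x 0 y 0]
    by (intro poly_act_eqI) (simp_all add: free_algebra_closed algebra_simps)
  then show ?thesis using assms bracket_part[of x 0 y 0]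
    by (simp add: lie_act_eq poly_act_add poly_act_mult free_algebra_closed)
qed

text \<open>The enveloping algebra is generated by the scalars and the Lie algebra.\<close>

lemma additive_commutes_with_env:
  assumes T: "left_module (env_even L) T"
    and closed: "\<And>m. m \<in> carrier M \<Longrightarrow> J m \<in> carrier T"
    and add: "\<And>m n. m \<in> carrier M \<Longrightarrow> n \<in> carrier M \<Longrightarrow> J (m \<oplus>\<^bsub>M\<^esub> n) = J m \<oplus>\<^bsub>T\<^esub> J n"
    and const: "\<And>c m. m \<in> carrier M \<Longrightarrow> J (kscale c m) = env_scale (even_subalgebra L) T c (J m)"
    and gen: "\<And>x m. x \<in> part L 0 \<Longrightarrow> m \<in> carrier M \<Longrightarrow>
      J (lie_act x m) = env_class (even_subalgebra L) (gen x) \<odot>\<^bsub>T\<^esub> J m"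
  shows "J \<in> left_module_hom (env_even L) M T"
proof -
  interpret T: even_module L T by (intro even_module.intro T lie_superalgebra_axioms)
  have "J (poly_act p m) = T.poly_act p (J m)" if "p \<in> F0" "m \<in> carrier M" for p m
    using that(1)
  proof (induction p rule: free_algebra_induct)
    case (const c)
    then show ?case using assms(4)[OF that(2)] by (simp add: kscale_eq T.kscale_eq)
  next
    case (add p q)
    then show ?case
      using that(2) by (simp add: poly_act_add T.poly_act_add closed assms(3) poly_act_closed)
  next
    case (gen x p)
    then show ?case
      using that(2) assms(5)[of x "poly_act p m"]
      by (simp add: poly_act_mult T.poly_act_mult closed free_algebra_closed poly_act_closed
          lie_act_eq T.lie_act_eq T.lie_act_def[symmetric])
  qed
  then have "J (u \<odot>\<^bsub>M\<^esub> m) = u \<odot>\<^bsub>T\<^esub> J m" if "u \<in> carrier (env_even L)" "m \<in> carrier M" for u m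
    using that by (elim even.env_carrierE) (simp add: poly_act_def T.poly_act_def)
  then show ?thesis using closed add by (auto simp: left_module_hom_def hom_def)
qed

end

locale even_tensor = lie_superalgebra L + S: even_module L S + E: even_module L E
  for L :: "('k::field, 's::ab_group_add) superalgebra"
    and S :: "(('k, 's) env, 'a, 'y) module_scheme" and E :: "(('k, 's) env, 'b, 'z) module_scheme"
begin

sublocale balanced_tensor S E "UNIV :: 'k set" "\<lambda>s c. S.kscale c s" E.kscale
  by (intro balanced_tensor.intro balanced_tensor_axioms.intro S.M.abelian_group_axioms
      E.M.abelian_group_axioms S.kscale_closed E.kscale_closed)

notation cong (infix \<open>\<doteq>\<close> 50)

lemmas tensor_scale = tensor_balanced[OF _ UNIV_I]

text \<open>
  Scalars act on the first factor, elements of the Lie algebra by the Leibniz rule.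
\<close>

abbreviation "tsc \<equiv> \<lambda>c. frag_extend (\<lambda>(s, e). frag_of (S.kscale c s, e))"

abbreviation "tac \<equiv> tensor_leibniz (even_subalgebra L) S E"

lemma tac_frag_of: "tac x (frag_of (s, e)) = frag_of (S.lie_act x s, e) + frag_of (s, E.lie_act x e)"
  by (simp add: tensor_leibniz_def S.lie_act_def E.lie_act_def)

lemma tac_diff: "tac x (f - g) = tac x f - tac x g"
  by (simp add: tensor_leibniz_def frag_extend_diff)

lemma tac_add: "tac x (f + g) = tac x f + tac x g"
  by (simp add: tensor_leibniz_def frag_extend_add)

lemma tsc_C: "f \<in> C \<Longrightarrow> tsc c f \<in> C"
  using keys_frag_extend[of "\<lambda>(s, e). frag_of (S.kscale c s, e)" f]
  by (fastforce simp: S.kscale_closed)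

lemma tac_C: "x \<in> part L 0 \<Longrightarrow> f \<in> C \<Longrightarrow> tac x f \<in> C"
proof -
  assume x: "x \<in> part L 0" and "f \<in> C"
  then have "Poly_Mapping.keys f \<subseteq> X" by simp
  then show "tac x f \<in> C"
  proof (induction f rule: frag_induction)
    case zero show ?case by (simp add: tensor_leibniz_def)
  next
    case (one y)
    then show ?case using x
      by (cases y) (auto simp del: carrier_free_Abelian_group_iff
          simp: tac_frag_of C_closed(1) S.lie_act_closed E.lie_act_closed intro!: C_closed(3))
  next
    case (diff a b) then show ?case unfolding tac_diff by (rule C_closed(4))
  qed
qed

lemma tsc_null:
  assumes f: "f \<in> null" shows "tsc c f \<in> null"
proof (rule null_preserved[of "tsc c"])
  show "tsc c (frag_of (S.kscale d m, n)) \<doteq> tsc c (frag_of (m, E.kscale d n))"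
    if "m \<in> carrier S" "n \<in> carrier E" for m n d
    using tensor_scale[of "S.kscale c m" n d] that
    by (simp add: S.kscale_closed S.kscale_mult[symmetric] mult.commute)
  show "tsc c (frag_of (m \<oplus>\<^bsub>S\<^esub> m', n)) \<doteq> tsc c (frag_of (m, n)) + tsc c (frag_of (m', n))"
    if "m \<in> carrier S" "m' \<in> carrier S" "n \<in> carrier E" for m m' n
    using tensor_add_left[of "S.kscale c m" "S.kscale c m'" n] that by (simp add: S.kscale_closed S.kscale_add)
  show "tsc c (frag_of (m, n \<oplus>\<^bsub>E\<^esub> n')) \<doteq> tsc c (frag_of (m, n)) + tsc c (frag_of (m, n'))"
    if "m \<in> carrier S" "n \<in> carrier E" "n' \<in> carrier E" for m n n'
    using tensor_add_right[of "S.kscale c m" n n'] that by (simp add: S.kscale_closed)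
  show "tsc c (f - g) = tsc c f - tsc c g" for f g by (rule frag_extend_diff)
qed (rule f)

lemma tac_null:
  assumes x: "x \<in> part L 0" and f: "f \<in> null" shows "tac x f \<in> null"
proof (rule null_preserved[of "tac x"])
  note cl = S.lie_act_closed[OF x] E.lie_act_closed[OF x] S.kscale_closed E.kscale_closed
  show "tac x (f - g) = tac x f - tac x g" for f g by (rule tac_diff)
  show "tac x (frag_of (m \<oplus>\<^bsub>S\<^esub> m', n)) \<doteq> tac x (frag_of (m, n)) + tac x (frag_of (m', n))"
    if "m \<in> carrier S" "m' \<in> carrier S" "n \<in> carrier E" for m m' n
    using cong_add[OF tensor_add_left[of "S.lie_act x m" "S.lie_act x m'" n] tensor_add_left[of m m' "E.lie_act x n"]]
      that x by (simp add: tac_frag_of S.lie_act_add cl add_ac)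
  show "tac x (frag_of (m, n \<oplus>\<^bsub>E\<^esub> n')) \<doteq> tac x (frag_of (m, n)) + tac x (frag_of (m, n'))"
    if "m \<in> carrier S" "n \<in> carrier E" "n' \<in> carrier E" for m n n'
    using cong_add[OF tensor_add_right[of "S.lie_act x m" n n'] tensor_add_right[of m "E.lie_act x n" "E.lie_act x n'"]]
      that x by (simp add: tac_frag_of E.lie_act_add cl add_ac)
  show "tac x (frag_of (S.kscale c m, n)) \<doteq> tac x (frag_of (m, E.kscale c n))"
    if "m \<in> carrier S" "n \<in> carrier E" for m n c
    using cong_add[OF tensor_scale[of "S.lie_act x m" n c] tensor_scale[of m "E.lie_act x n" c]] that x
    by (simp add: tac_frag_of cl S.kscale_lie_act E.kscale_lie_act)
qed (rule f)

sublocale ops: even_operators L null C tsc tac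
proof
  fix c d f x y
  show "tsc c (f + g) = tsc c f + tsc c g" "tac x (f + g) = tac x f + tac x g" for g
    by (rule frag_extend_add, rule tac_add)
  assume f: "f \<in> C"
  note ext = frag_cong_ext[OF f, unfolded cong_def]
  show "tsc (c + d) f - (tsc c f + tsc d f) \<in> null"
    by (rule ext) (use tensor_add_left in \<open>simp_all add: frag_extend_diff S.kscale_plus S.kscale_closed cong_def\<close>)
  show "tsc (c * d) f - tsc c (tsc d f) \<in> null"
    by (rule ext) (simp_all add: frag_extend_diff S.kscale_mult S.kscale_closed N_zero)
  show "tsc 1 f - f \<in> null"
    by (rule ext) (simp_all add: frag_extend_diff S.kscale_one N_zero)
  assume x: "x \<in> part L 0"
  note cl = S.lie_act_closed[OF x] E.lie_act_closed[OF x] S.kscale_closed E.kscale_closed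
  show "tsc c (tac x f) - tac x (tsc c f) \<in> null"
    by (rule ext) (simp_all add: frag_extend_diff tac_diff tac_frag_of frag_extend_add S.kscale_lie_act x N_zero)
  show "tac (lscale L c x) f - tsc c (tac x f) \<in> null"
  proof (rule ext)
    fix s e assume se: "s \<in> carrier S" "e \<in> carrier E"
    have "frag_of (S.kscale c (S.lie_act x s), e) + frag_of (s, E.kscale c (E.lie_act x e)) \<doteq>
        frag_of (S.kscale c (S.lie_act x s), e) + frag_of (S.kscale c s, E.lie_act x e)"
      using se cl by (intro cong_add cong_refl cong_sym[OF tensor_scale])
    then show "tac (lscale L c x) (frag_of (s, e)) - tsc c (tac x (frag_of (s, e))) \<in> null"
      using se by (simp add: tac_frag_of frag_extend_add S.lie_act_scale E.lie_act_scale x cong_def)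
  qed (simp_all add: frag_extend_diff tac_diff)
  assume y: "y \<in> part L 0"
  note cly = S.lie_act_closed[OF y] E.lie_act_closed[OF y]
  have b: "bracket L x y \<in> part L 0" using bracket_part[OF x y] by simp
  show "tac (x + y) f - (tac x f + tac y f) \<in> null"
  proof (rule ext)
    fix s e assume se: "s \<in> carrier S" "e \<in> carrier E"
    show "tac (x + y) (frag_of (s, e)) - (tac x (frag_of (s, e)) + tac y (frag_of (s, e))) \<in> null"
      using cong_add[OF tensor_add_left[of "S.lie_act x s" "S.lie_act y s" e] tensor_add_right[of s "E.lie_act x e" "E.lie_act y e"]]
        se cl cly by (simp add: tac_frag_of S.lie_act_plus E.lie_act_plus x y cong_def algebra_simps)
  qed (simp_all add: tac_diff)
  \<comment> \<open>The mixed terms \<open>x s \<otimes> y e + y s \<otimes> x e\<close> are symmetric in \<open>x\<close> and \<open>y\<close> and cancel in the commutator.\<close>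
  show "tac x (tac y f) - (tac y (tac x f) + tac (bracket L x y) f) \<in> null"
  proof (rule ext)
    fix s e assume se: "s \<in> carrier S" "e \<in> carrier E"
    show "tac x (tac y (frag_of (s, e))) - (tac y (tac x (frag_of (s, e))) + tac (bracket L x y) (frag_of (s, e))) \<in> null"
      using cong_add[OF tensor_add_left[of "S.lie_act y (S.lie_act x s)" "S.lie_act (bracket L x y) s" e]
          tensor_add_right[of s "E.lie_act y (E.lie_act x e)" "E.lie_act (bracket L x y) e"]]
        se cl cly b S.lie_act_closed E.lie_act_closed
      by (simp add: tac_frag_of tac_add S.lie_act_bracket[OF x y] E.lie_act_bracket[OF x y] x y cong_def algebra_simps)
  qed (simp_all add: tac_diff)
qed (use tsc_C tsc_null tac_C tac_null C_closed in auto)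

lemma tensor_action_eq: "tensor_action (even_subalgebra L) S E = ops.act"
  by (intro ext) (simp add: tensor_action_def ops.act_def)

lemma tensor_module_eq:
  "tensor_module (even_subalgebra L) S E = coset_module (free_Abelian_group X) null (\<lambda>u. ops.act (rep u))"
  by (simp add: tensor_module_def presented_module_eq_coset_module null_def tensor_action_eq)

lemma rep_F0: "u \<in> carrier (env_even L) \<Longrightarrow> rep u \<in> F0"
  using S.even.rep_env_closed by simp

lemma tensor_module_left_module: "left_module (env_even L) (tensor_module (even_subalgebra L) S E)"
  unfolding tensor_module_eq
proof (rule quot.left_module_coset_module[OF S.even.ring_env])
  fix a b f assume a: "a \<in> carrier (env_even L)" and b: "b \<in> carrier (env_even L)" and f: "f \<in> C"
  note cl = ops.act_C[OF rep_F0]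
  show "null #>\<^bsub>free_Abelian_group X\<^esub> ops.act (rep (a \<oplus>\<^bsub>env_even L\<^esub> b)) f =
      null #>\<^bsub>free_Abelian_group X\<^esub> (ops.act (rep a) f \<otimes>\<^bsub>free_Abelian_group X\<^esub> ops.act (rep b) f)"
    using ops.act_rep_add[OF f a b] a b f cl S.even.ring_env
    by (intro coset_eqI) (auto simp del: carrier_free_Abelian_group_iff intro!: C_closed(3) ring.ring_simprules)
  show "null #>\<^bsub>free_Abelian_group X\<^esub> ops.act (rep (a \<otimes>\<^bsub>env_even L\<^esub> b)) f =
      null #>\<^bsub>free_Abelian_group X\<^esub> ops.act (rep a) (ops.act (rep b) f)"
    using ops.act_rep_mult[OF f a b] a b f cl S.even.ring_env
    by (intro coset_eqI) (auto simp del: carrier_free_Abelian_group_iff intro!: ring.ring_simprules)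
next
  fix f assume f: "f \<in> C"
  then show "null #>\<^bsub>free_Abelian_group X\<^esub> ops.act (rep \<one>\<^bsub>env_even L\<^esub>) f = null #>\<^bsub>free_Abelian_group X\<^esub> f"
    using ops.act_rep_one[OF f] ops.act_C[OF rep_F0] S.even.ring_env
    by (intro coset_eqI) (auto simp del: carrier_free_Abelian_group_iff intro!: ring.ring_simprules)
qed (auto simp del: carrier_free_Abelian_group_iff simp: ops.act_add ops.act_C rep_F0 intro: ops.act_N rep_F0)

lemma tensor_smult:
  assumes "p \<in> F0" "f \<in> C"
  shows "env_class (even_subalgebra L) p \<odot>\<^bsub>tensor_module (even_subalgebra L) S E\<^esub>
      (null #>\<^bsub>free_Abelian_group X\<^esub> f) = null #>\<^bsub>free_Abelian_group X\<^esub> ops.act p f"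
proof -
  let ?u = "env_class (even_subalgebra L) p"
  have u: "rep ?u \<in> F0" using S.class_in[OF assms(1)] rep_F0 by blast
  have "?u \<odot>\<^bsub>tensor_module (even_subalgebra L) S E\<^esub> (null #>\<^bsub>free_Abelian_group X\<^esub> f) =
      null #>\<^bsub>free_Abelian_group X\<^esub> ops.act (rep ?u) f"
    unfolding tensor_module_eq using u assms(2)
    by (intro quot.smult_coset) (auto simp del: carrier_free_Abelian_group_iff simp: ops.act_add ops.act_C intro: ops.act_N)
  also have "\<dots> = null #>\<^bsub>free_Abelian_group X\<^esub> ops.act p f"
    using ops.act_rep_class[OF assms(2,1)] u assms by (intro coset_eqI ops.act_C)
  finally show ?thesis .
qed

end

section \<open>Generation of the enveloping algebra over the even part\<close>

context lie_superalgebra begin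

definition word_span :: "'b monomial set \<Rightarrow> ('a, 'b) free_algebra set"
  where "word_span W = {p \<in> F. \<exists>q. Poly_Mapping.keys q \<subseteq> W \<and> p - q \<in> I}"

abbreviation "all_words \<equiv> {w. set (letters w) \<subseteq> superspace L}"

lemma keys_all_words: "Poly_Mapping.keys p \<subseteq> all_words \<longleftrightarrow> p \<in> F"
  by (auto simp: mem_free_algebra_iff)

lemma word_span_F: "p \<in> word_span W \<Longrightarrow> p \<in> F"
  by (simp add: word_span_def)

lemma word_span_mono: "W \<subseteq> W' \<Longrightarrow> word_span W \<subseteq> word_span W'"
  unfolding word_span_def by blast

lemma word_span_keys: "Poly_Mapping.keys p \<subseteq> W \<Longrightarrow> W \<subseteq> all_words \<Longrightarrow> p \<in> word_span W"
  unfolding word_span_def using keys_all_words[of p] I_zero by (auto intro!: exI[of _ p])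

lemma word_span_cong:
  assumes "p \<in> F" "q \<in> word_span W" "p - q \<in> I" shows "p \<in> word_span W"
proof -
  obtain r where r: "Poly_Mapping.keys r \<subseteq> W" "q - r \<in> I" using assms(2) by (auto simp: word_span_def)
  have "p - r \<in> I" using I_add[OF assms(3) r(2)] by simp
  then show ?thesis using r assms(1) by (auto simp: word_span_def)
qed

lemma word_span_I: "p \<in> I \<Longrightarrow> p \<in> word_span W"
  unfolding word_span_def using I_F by (auto intro!: exI[of _ 0])

lemma word_span_zero: "0 \<in> word_span W"
  by (rule word_span_I[OF I_zero])

lemma word_span_add:
  assumes "p \<in> word_span W" "q \<in> word_span W" shows "p + q \<in> word_span W"
proof -
  obtain p' q' where *: "Poly_Mapping.keys p' \<subseteq> W" "p - p' \<in> I" "Poly_Mapping.keys q' \<subseteq> W" "q - q' \<in> I"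
    using assms by (auto simp: word_span_def)
  have "(p + q) - (p' + q') \<in> I" using I_add[OF *(2,4)] by (simp add: algebra_simps)
  moreover have "Poly_Mapping.keys (p' + q') \<subseteq> W" using * Poly_Mapping.keys_add[of p' q'] by auto
  ultimately show ?thesis
    using assms by (auto simp: word_span_def free_algebra_closed)
qed

lemma word_span_const:
  assumes "p \<in> word_span W" shows "const c * p \<in> word_span W"
proof -
  obtain p' where *: "Poly_Mapping.keys p' \<subseteq> W" "p - p' \<in> I" using assms by (auto simp: word_span_def)
  have "const c * p - const c * p' \<in> I"
    using I_lmult[OF _ *(2), of "const c"] by (simp add: free_algebra_closed algebra_simps)
  moreover have "Poly_Mapping.keys (const c * p') \<subseteq> W"
    using *(1) keys_mult[of "const c" p'] by (force simp: const_def split: if_splits)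
  ultimately show ?thesis using word_span_F[OF assms] by (auto simp: word_span_def free_algebra_closed)
qed

lemma word_span_diff:
  "p \<in> word_span W \<Longrightarrow> q \<in> word_span W \<Longrightarrow> p - q \<in> word_span W"
  using word_span_add[of p W "const (- 1) * q"] word_span_const[of q W "- 1"] by (simp add: const_simps)

lemma word_span_induct [consumes 2, case_names cong zero add word]:
  assumes p: "p \<in> word_span W" and W: "W \<subseteq> all_words"
    and cong: "\<And>p q. p \<in> F \<Longrightarrow> q \<in> F \<Longrightarrow> p - q \<in> I \<Longrightarrow> P q \<Longrightarrow> P p"
    and zero: "P 0"
    and add: "\<And>p q. p \<in> F \<Longrightarrow> q \<in> F \<Longrightarrow> P p \<Longrightarrow> P q \<Longrightarrow> P (p + q)"
    and word: "\<And>w c. w \<in> W \<Longrightarrow> P (Poly_Mapping.single w c)"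
  shows "P p"
proof -
  obtain q where q: "Poly_Mapping.keys q \<subseteq> W" "p - q \<in> I" using p by (auto simp: word_span_def)
  have F: "r \<in> F" if "Poly_Mapping.keys r \<subseteq> W" for r using that W keys_all_words by blast
  have "P q" using q(1) by (induction q rule: poly_sum_induct) (use F zero add word in auto)
  then show ?thesis using cong[OF word_span_F[OF p] F[OF q(1)] q(2)] by blast
qed

lemma gen_add_I: "x \<in> superspace L \<Longrightarrow> y \<in> superspace L \<Longrightarrow> gen (x + y) - (gen x + gen y) \<in> I"
proof -
  assume "x \<in> superspace L" "y \<in> superspace L"
  then have "gen (x + y) - gen x - gen y \<in> env_rels L" unfolding env_rels_def by blast
  then show ?thesis using rels_I by (simp add: diff_diff_eq)
qed

lemma gen_scale_I: "x \<in> superspace L \<Longrightarrow> gen (lscale L c x) - const c * gen x \<in> I"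
  by (rule rels_I) (unfold env_rels_def, blast)

lemma gen_bracket_I:
  assumes "x \<in> part L i" "y \<in> part L j"
  shows "gen x * gen y - (const (koszul i j) * gen y * gen x + gen (bracket L x y)) \<in> I"
proof -
  have "gen x * gen y - const (koszul i j) * gen y * gen x - gen (bracket L x y) \<in> env_rels L"
    unfolding env_rels_def using assms by blast
  then show ?thesis using rels_I by (simp add: diff_diff_eq)
qed

lemma gen_square_I: "x \<in> part L 1 \<Longrightarrow> gen x * gen x - gen (square L x) \<in> I"
  by (rule rels_I) (unfold env_rels_def, blast)

lemma gen_F: "x \<in> part L i \<Longrightarrow> gen x \<in> F"
  using part_superspace by (intro free_algebra_closed)

lemma gen_0_I: "gen 0 \<in> I"
  using I_minus[OF gen_add_I[OF zero_superspace zero_superspace]] by simp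

lemma gen_mult_cong:
  assumes "x \<in> part L i" "p \<in> F" "q \<in> F" "p - q \<in> I" "gen x * q \<in> word_span W"
  shows "gen x * p \<in> word_span W"
proof -
  have "gen x * p - gen x * q = gen x * (p - q)" by (simp add: algebra_simps)
  then have "gen x * p - gen x * q \<in> I" using I_lmult[OF gen_F[OF assms(1)] assms(4)] by simp
  then show ?thesis
    by (rule word_span_cong[OF free_algebra_closed(6)[OF gen_F[OF assms(1)] assms(2)] assms(5)])
qed

end

locale odd_spanned = lie_superalgebra L for L :: "('k::field, 's::ab_group_add) superalgebra" +
  fixes b :: "'s set"
  assumes finite_b: "finite b" and b_odd: "b \<subseteq> part L 1" and b_span: "part L 1 \<subseteq> span b"
begin

definition b_words :: "nat \<Rightarrow> 's monomial set"
  where "b_words n = {w. set (letters w) \<subseteq> b \<and> length (letters w) \<le> n}"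

text \<open>
  Even letters in front of at most \<open>n\<close> odd letters from the spanning set \<open>b\<close>: up to their order these
  are the monomials of the Poincare-Birkhoff-Witt theorem.
\<close>

definition normal_words :: "nat \<Rightarrow> 's monomial set"
  where "normal_words n = {Monomial (u @ v) | u v. set u \<subseteq> part L 0 \<and> set v \<subseteq> b \<and> length v \<le> n}"

lemma normal_words_words: "normal_words n \<subseteq> all_words"
proof
  fix w assume "w \<in> normal_words n"
  then obtain u v where "w = Monomial (u @ v)" "set u \<subseteq> part L 0" "set v \<subseteq> b" by (auto simp: normal_words_def)
  then show "w \<in> all_words" using part_superspace[of _ 0] part_superspace[of _ 1] b_odd by auto
qed

lemma b_words_normal: "b_words n \<subseteq> normal_words n"
proof
  fix w assume "w \<in> b_words n"
  then show "w \<in> normal_words n"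
    unfolding b_words_def normal_words_def by (intro CollectI exI[of _ "[]"] exI[of _ "letters w"]) simp
qed

lemma b_words_words: "b_words n \<subseteq> all_words"
  using b_words_normal normal_words_words by blast

lemma b_words_mono: "m \<le> n \<Longrightarrow> b_words m \<subseteq> b_words n"
  by (auto simp: b_words_def)

lemma normal_words_mono: "m \<le> n \<Longrightarrow> normal_words m \<subseteq> normal_words n"
proof
  fix w assume "m \<le> n" "w \<in> normal_words m"
  then obtain u v where "w = Monomial (u @ v)" "set u \<subseteq> part L 0" "set v \<subseteq> b" "length v \<le> n"
    by (auto simp: normal_words_def)
  then show "w \<in> normal_words n"
    unfolding normal_words_def by (intro CollectI exI[of _ u] exI[of _ v]) simp
qed

lemma finite_b_words: "finite (b_words n)"
proof (rule finite_subset)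
  show "b_words n \<subseteq> Monomial ` {xs. set xs \<subseteq> b \<and> length xs \<le> n}"
  proof
    fix w assume "w \<in> b_words n"
    then show "w \<in> Monomial ` {xs. set xs \<subseteq> b \<and> length xs \<le> n}"
      by (intro image_eqI[of _ _ "letters w"]) (auto simp: b_words_def)
  qed
  show "finite (Monomial ` {xs. set xs \<subseteq> b \<and> length xs \<le> n})"
    using finite_lists_length_le[OF finite_b] by simp
qed

abbreviation "V n \<equiv> word_span (b_words n)"

abbreviation "Y n \<equiv> word_span (normal_words n)"

lemma V_subset_Y: "V n \<subseteq> Y n"
  using b_words_normal by (rule word_span_mono)

text \<open>
  For an element of \<open>b\<close> this only lengthens a word. The elements \<open>x\<close> with the claimed property form
  a subspace, and \<open>b\<close> spans the odd part.
\<close>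

lemma V_odd_mult:
  assumes x: "x \<in> part L 1" and p: "p \<in> V n"
  shows "gen x * p \<in> V (Suc n)"
  using p b_words_words
proof (induction p rule: word_span_induct)
  case (cong p q)
  show ?case by (rule gen_mult_cong[OF x cong])
next
  case zero show ?case by (simp add: word_span_zero)
next
  case (add p q) then show ?case using word_span_add by (simp add: distrib_left)
next
  case (word w c)
  let ?p = "Poly_Mapping.single w c"
  have pF: "?p \<in> F" using word b_words_words[of n] by (auto simp: mem_free_algebra_iff)
  let ?Z = "{x \<in> part L 1. gen x * ?p \<in> V (Suc n)}"
  have "subspace ?Z"
  proof (rule subspaceI)
    show "0 \<in> ?Z" using part_zero I_rmult[OF gen_0_I pF] word_span_I by auto
  next
    fix x y assume xy: "x \<in> ?Z" "y \<in> ?Z"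
    then have xyL: "x \<in> superspace L" "y \<in> superspace L" using part_superspace by auto
    have "gen (x + y) * ?p - (gen x * ?p + gen y * ?p) = (gen (x + y) - (gen x + gen y)) * ?p"
      by (simp add: algebra_simps)
    then have i: "gen (x + y) * ?p - (gen x * ?p + gen y * ?p) \<in> I"
      using I_rmult[OF gen_add_I[OF xyL] pF] by simp
    have xy1: "x + y \<in> part L 1" using xy subspace_add[OF subspace_part] by auto
    have "gen (x + y) * ?p \<in> V (Suc n)"
      using xy by (intro word_span_cong[OF _ word_span_add i] free_algebra_closed(6) gen_F[OF xy1] pF) auto
    then show "x + y \<in> ?Z" using xy1 by simp
  next
    fix d x assume x: "x \<in> ?Z"
    have dx: "lscale L d x \<in> part L 1" using x subspace_scale[OF subspace_part] by auto
    have "gen (lscale L d x) * ?p - const d * (gen x * ?p) = (gen (lscale L d x) - const d * gen x) * ?p"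
      by (simp add: algebra_simps)
    then have i: "gen (lscale L d x) * ?p - const d * (gen x * ?p) \<in> I"
      using I_rmult[OF gen_scale_I pF, of x d] x part_superspace by auto
    have "gen (lscale L d x) * ?p \<in> V (Suc n)"
      using x by (intro word_span_cong[OF _ word_span_const i] free_algebra_closed(6) gen_F[OF dx] pF) auto
    then show "lscale L d x \<in> ?Z" using dx by simp
  qed
  moreover have "b \<subseteq> ?Z"
  proof
    fix x assume x: "x \<in> b"
    obtain xs where xs: "w = Monomial xs" by (cases w)
    have "Monomial (x # xs) \<in> b_words (Suc n)" using x word by (simp add: xs b_words_def)
    then have "gen x * ?p \<in> V (Suc n)"
      unfolding xs single_Cons[symmetric] by (intro word_span_keys b_words_words) simp
    then show "x \<in> ?Z" using x b_odd by auto
  qed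
  ultimately have "span b \<subseteq> ?Z" by (intro span_minimal)
  then show ?case using x b_span by blast
qed

lemma Y_even_mult:
  assumes y: "y \<in> part L 0" and p: "p \<in> Y n"
  shows "gen y * p \<in> Y n"
  using p normal_words_words
proof (induction p rule: word_span_induct)
  case (cong p q)
  show ?case by (rule gen_mult_cong[OF y cong])
next
  case zero show ?case by (simp add: word_span_zero)
next
  case (add p q) then show ?case using word_span_add by (simp add: distrib_left)
next
  case (word w c)
  then obtain u v where uv: "w = Monomial (u @ v)" "set u \<subseteq> part L 0" "set v \<subseteq> b" "length v \<le> n"
    by (auto simp: normal_words_def)
  have "Monomial ((y # u) @ v) \<in> normal_words n"
    unfolding normal_words_def using uv y by (intro CollectI exI[of _ "y # u"] exI[of _ v]) simp
  then show ?case
    unfolding uv(1) single_Cons[symmetric] by (intro word_span_keys normal_words_words) simp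
qed

text \<open>
  The relation \<open>x y = y x + [x, y]\<close> moves the odd letter \<open>x\<close> to the right past an even letter \<open>y\<close>, and
  \<open>[x, y]\<close> is again odd with fewer even letters left to pass.
\<close>

lemma Y_odd_mult:
  assumes x: "x \<in> part L 1" and p: "p \<in> Y n"
  shows "gen x * p \<in> Y (Suc n)"
  using p normal_words_words
proof (induction p rule: word_span_induct)
  case (cong p q)
  show ?case by (rule gen_mult_cong[OF x cong])
next
  case zero show ?case by (simp add: word_span_zero)
next
  case (add p q) then show ?case using word_span_add by (simp add: distrib_left)
next
  case (word w c)
  then obtain u v where uv: "w = Monomial (u @ v)" "set u \<subseteq> part L 0" "set v \<subseteq> b" "length v \<le> n"
    by (auto simp: normal_words_def)
  have "gen x * Poly_Mapping.single (Monomial (u @ v)) c \<in> Y (Suc n)"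
    using uv(2) x
  proof (induction u arbitrary: x)
    case Nil
    have "Poly_Mapping.single (Monomial v) c \<in> V n"
      using uv by (intro word_span_keys b_words_words) (simp add: b_words_def)
    then show ?case using V_odd_mult[OF Nil(2)] V_subset_Y by auto
  next
    case (Cons y u)
    let ?p = "Poly_Mapping.single (Monomial (u @ v)) c"
    have y: "y \<in> part L 0" and u: "set u \<subseteq> part L 0" using Cons by auto
    have pF: "?p \<in> F"
      using u uv b_odd part_superspace by (auto simp: mem_free_algebra_iff)
    have br: "bracket L x y \<in> part L 1" using bracket_part[OF Cons(3) y] by simp
    have "gen y * (gen x * ?p) + gen (bracket L x y) * ?p \<in> Y (Suc n)"
      using Cons.IH[OF u Cons(3)] Cons.IH[OF u br] Y_even_mult[OF y] by (intro word_span_add) auto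
    moreover have "gen x * (gen y * ?p) - (gen y * (gen x * ?p) + gen (bracket L x y) * ?p) =
        (gen x * gen y - (const (koszul 1 0) * gen y * gen x + gen (bracket L x y))) * ?p"
      by (simp add: koszul_def const_simps algebra_simps)
    moreover have "\<dots> \<in> I" by (intro I_rmult gen_bracket_I Cons(3) y pF)
    ultimately have "gen x * (gen y * ?p) \<in> Y (Suc n)"
      by (intro word_span_cong[OF _ \<open>gen y * (gen x * ?p) + _ \<in> _\<close>] free_algebra_closed(6) gen_F[OF y] gen_F[OF Cons(3)] pF) simp
    then show ?case by (simp add: single_Cons)
  qed
  then show ?case by (simp add: uv(1))
qed

lemma Y_mult:
  assumes p: "p \<in> Y m" and q: "q \<in> Y n"
  shows "p * q \<in> Y (m + n)"
  using p normal_words_words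
proof (induction p rule: word_span_induct)
  case (cong p p')
  have "p * q - p' * q = (p - p') * q" by (simp add: algebra_simps)
  then have "p * q - p' * q \<in> I" using I_rmult[OF cong(3) word_span_F[OF q]] by simp
  then show ?case by (intro word_span_cong[OF _ cong(4)] free_algebra_closed(6) cong(1) word_span_F[OF q])
next
  case zero show ?case by (simp add: word_span_zero)
next
  case (add p q) then show ?case using word_span_add by (simp add: distrib_right)
next
  case (word w c)
  then obtain u v where uv: "w = Monomial (u @ v)" "set u \<subseteq> part L 0" "set v \<subseteq> b" "length v \<le> m"
    by (auto simp: normal_words_def)
  have v: "Poly_Mapping.single (Monomial v) c * q \<in> Y (length v + n)"
    using uv(3)
  proof (induction v)
    case Nil
    then show ?case using word_span_const[OF q] by (simp add: single_Nil)
  next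
    case (Cons x v)
    then show ?case using Y_odd_mult[of x "Poly_Mapping.single (Monomial v) c * q" "length v + n"] b_odd
      by (simp add: single_Cons mult.assoc subset_iff)
  qed
  have "Poly_Mapping.single (Monomial (u @ v)) c * q \<in> Y (length v + n)"
    using uv(2)
  proof (induction u)
    case (Cons y u)
    then show ?case using Y_even_mult[of y "Poly_Mapping.single (Monomial (u @ v)) c * q" "length v + n"]
      by (simp add: single_Cons mult.assoc)
  qed (simp add: v)
  then show ?case using word_span_mono[OF normal_words_mono[of "length v + n" "m + n"]] uv by auto
qed

lemma Y_word_b: "set v \<subseteq> b \<Longrightarrow> Poly_Mapping.single (Monomial v) c \<in> Y (length v)"
  using subsetD[OF V_subset_Y]
  by (intro subsetD[OF V_subset_Y] word_span_keys b_words_words) (simp add: b_words_def)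

lemma Y_one: "1 \<in> Y 0"
  using Y_word_b[of "[]" 1] by (simp add: single_Nil const_simps)

lemma Y_even: "y \<in> part L 0 \<Longrightarrow> gen y \<in> Y 0"
  using Y_even_mult[OF _ Y_one] by simp

lemma Y_odd: "x \<in> part L 1 \<Longrightarrow> gen x \<in> Y 1"
  using Y_odd_mult[OF _ Y_one] by simp

text \<open>
  Two equal odd letters can be moved next to each other up to terms of lower degree, and then
  replaced by the even element \<open>square L a\<close>.
\<close>

lemma Y_repeated:
  assumes a: "a \<in> part L 1" and v: "set v \<subseteq> b"
  shows "gen a * Poly_Mapping.single (Monomial v) 1 * gen a \<in> Y (Suc (length v))"
  using v
proof (induction v)
  case Nil
  have "gen a * gen a \<in> Y 0"
    using a square_part by (intro word_span_cong[OF _ Y_even gen_square_I] free_algebra_closed(6) gen_F[OF a])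
  then show ?case
    using word_span_mono[OF normal_words_mono[of 0 "Suc 0"]] by (auto simp: single_Nil const_simps)
next
  case (Cons c v)
  let ?p = "Poly_Mapping.single (Monomial v) 1 :: ('k, 's) free_algebra"
  have c: "c \<in> part L 1" and v: "set v \<subseteq> b" using Cons b_odd by auto
  have p: "?p \<in> Y (length v)" using Y_word_b[OF v] .
  have pF: "?p * gen a \<in> F" using word_span_F[OF p] a by (intro free_algebra_closed gen_F)
  have br: "bracket L a c \<in> part L 0" using bracket_part[OF a c] by simp
  have "const (koszul 1 1) * (gen c * (gen a * ?p * gen a)) \<in> Y (Suc (Suc (length v)))"
    using Y_odd_mult[OF c Cons.IH[OF v]] by (rule word_span_const)
  moreover have "gen (bracket L a c) * (?p * gen a) \<in> Y (Suc (Suc (length v)))"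
    using Y_even_mult[OF br Y_mult[OF p Y_odd[OF a]]]
      word_span_mono[OF normal_words_mono[of "length v + 1" "Suc (Suc (length v))"]] by auto
  ultimately have s: "const (koszul 1 1) * (gen c * (gen a * ?p * gen a)) + gen (bracket L a c) * (?p * gen a)
      \<in> Y (Suc (Suc (length v)))"
    by (rule word_span_add)
  have "gen a * gen c * (?p * gen a) -
      (const (koszul 1 1) * (gen c * (gen a * ?p * gen a)) + gen (bracket L a c) * (?p * gen a)) =
      (gen a * gen c - (const (koszul 1 1) * gen c * gen a + gen (bracket L a c))) * (?p * gen a)"
    by (simp add: algebra_simps)
  moreover have "\<dots> \<in> I" by (intro I_rmult gen_bracket_I a c pF)
  ultimately have "gen a * gen c * (?p * gen a) \<in> Y (Suc (Suc (length v)))"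
    by (intro word_span_cong[OF _ s] free_algebra_closed(6) gen_F[OF a] gen_F[OF c] pF) simp
  then show ?case by (simp add: single_Cons mult.assoc)
qed

text \<open>
  A word with more letters than \<open>b\<close> has elements repeats a letter.
\<close>

lemma Y_long_word:
  assumes v: "set v \<subseteq> b" "length v = Suc (card b)"
  shows "Poly_Mapping.single (Monomial v) 1 \<in> Y (card b)"
proof -
  have "\<not> distinct v"
    using distinct_card[of v] card_mono[OF finite_b v(1)] v(2) by auto
  then obtain p a q r where d: "v = p @ [a] @ q @ [a] @ r" using not_distinct_decomp by blast
  let ?w = "\<lambda>v. Poly_Mapping.single (Monomial v) 1 :: ('k, 's) free_algebra"
  have a: "a \<in> part L 1" using v(1) d b_odd by auto
  have "?w v = ?w p * (gen a * ?w q * gen a) * ?w r"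
    by (simp add: d single_append single_Cons mult.assoc)
  moreover have "?w p * (gen a * ?w q * gen a) * ?w r \<in> Y (length p + Suc (length q) + length r)"
    using v(1) by (intro Y_mult Y_repeated a Y_word_b) (auto simp: d)
  moreover have "length p + Suc (length q) + length r = card b" using v(2) d by simp
  ultimately show ?thesis by simp
qed

lemma Y_top: "Y (Suc (card b)) \<subseteq> Y (card b)"
proof
  fix p assume "p \<in> Y (Suc (card b))"
  then show "p \<in> Y (card b)"
    using normal_words_words
  proof (induction p rule: word_span_induct)
    case (cong p q) show ?case by (rule word_span_cong[OF cong(1,4,3)])
  next
    case (word w c)
    then obtain u v where uv: "w = Monomial (u @ v)" "set u \<subseteq> part L 0" "set v \<subseteq> b" "length v \<le> Suc (card b)"
      by (auto simp: normal_words_def)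
    show ?case
    proof (cases "length v = Suc (card b)")
      case True
      have "Monomial (u @ []) \<in> normal_words 0"
        unfolding normal_words_def using uv by (intro CollectI exI[of _ u] exI[of _ "[]"]) simp
      then have "Poly_Mapping.single (Monomial u) c \<in> Y 0"
        by (intro word_span_keys normal_words_words) simp
      then have "Poly_Mapping.single (Monomial u) c * Poly_Mapping.single (Monomial v) 1 \<in> Y (0 + card b)"
        using Y_long_word[OF uv(3) True] by (rule Y_mult)
      then show ?thesis by (simp add: uv(1) mult_single plus_monomial_def)
    next
      case False
      then have "w \<in> normal_words (card b)"
        unfolding normal_words_def uv(1) using uv by (intro CollectI exI[of _ u] exI[of _ v]) simp
      then show ?thesis by (intro word_span_keys normal_words_words) simp
    qed
  qed (auto simp: word_span_zero word_span_add)
qed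

text \<open>
  The enveloping algebra is spanned by the normal words with at most \<open>card b\<close> odd letters. In particular
  it is finitely generated as a left module over the enveloping algebra of the even part.
\<close>

lemma Y_eq_F: "Y (card b) = F"
proof
  show "Y (card b) \<subseteq> F" using word_span_F by blast
  show "F \<subseteq> Y (card b)"
  proof
    fix p :: "('k, 's) free_algebra" assume "p \<in> F"
    then show "p \<in> Y (card b)"
    proof (induction p rule: free_algebra_induct)
      case (const c)
      have "const c \<in> Y 0" using word_span_const[OF Y_one] by simp
      then show ?case using word_span_mono[OF normal_words_mono[of 0 "card b"]] by auto
    next
      case (add p q) show ?case by (rule word_span_add[OF add(3,4)])
    next
      case (gen x p)
      obtain y z where yz: "x = y + z" "y \<in> part L 0" "z \<in> part L 1"
        using gen(1) by (auto simp: superspace_def)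
      have s: "gen y * p + gen z * p \<in> Y (card b)"
        using Y_even_mult[OF yz(2) gen(3)] Y_odd_mult[OF yz(3) gen(3)] Y_top by (intro word_span_add) auto
      have "gen x * p - (gen y * p + gen z * p) = (gen (y + z) - (gen y + gen z)) * p"
        by (simp add: yz(1) algebra_simps)
      moreover have "\<dots> \<in> I" using yz gen by (intro I_rmult gen_add_I) (auto intro: part_superspace)
      ultimately show ?case using gen(1,2)
        by (intro word_span_cong[OF _ s] free_algebra_closed(4,6)) simp_all
    qed
  qed
qed

text \<open>
  Commuting with \<open>y\<close> is a derivation that sends a letter \<open>x\<close> to \<open>[x, y]\<close>, which is odd again and
  therefore a combination of letters in \<open>b\<close>.
\<close>

lemma V_ad:
  assumes y: "y \<in> part L 0" and p: "p \<in> V n"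
  shows "p * gen y - gen y * p \<in> V n"
  using p b_words_words
proof (induction p rule: word_span_induct)
  case (cong p q)
  have "(p * gen y - gen y * p) - (q * gen y - gen y * q) = (p - q) * gen y - gen y * (p - q)"
    by (simp add: algebra_simps)
  moreover have "\<dots> \<in> I" by (intro I_diff I_lmult I_rmult cong(3) gen_F[OF y])
  ultimately show ?case
    by (intro word_span_cong[OF _ cong(4)] free_algebra_closed(6,8) gen_F[OF y] cong(1)) simp
next
  case zero show ?case by (simp add: word_span_zero)
next
  case (add p q)
  have "(p + q) * gen y - gen y * (p + q) = (p * gen y - gen y * p) + (q * gen y - gen y * q)"
    by (simp add: algebra_simps)
  then show ?case using add word_span_add by simp
next
  case (word w c)
  have "Poly_Mapping.single (Monomial v) c * gen y - gen y * Poly_Mapping.single (Monomial v) c \<in> V (length v)"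
    if "set v \<subseteq> b" for v
    using that
  proof (induction v)
    case Nil
    show ?case by (simp add: single_Nil const_commute word_span_zero)
  next
    case (Cons x v)
    let ?p = "Poly_Mapping.single (Monomial v) c"
    have x: "x \<in> part L 1" and v: "set v \<subseteq> b" using Cons b_odd by auto
    have p: "?p \<in> V (length v)" using v by (intro word_span_keys b_words_words) (simp add: b_words_def)
    have br: "bracket L x y \<in> part L 1" using bracket_part[OF x y] by simp
    have s: "gen x * (?p * gen y - gen y * ?p) + gen (bracket L x y) * ?p \<in> V (Suc (length v))"
      using V_odd_mult[OF x Cons.IH[OF v]] V_odd_mult[OF br p] by (intro word_span_add)
    have "(gen x * ?p * gen y - gen y * (gen x * ?p)) - (gen x * (?p * gen y - gen y * ?p) + gen (bracket L x y) * ?p) =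
        (gen x * gen y - (const (koszul 1 0) * gen y * gen x + gen (bracket L x y))) * ?p"
      by (simp add: koszul_def const_simps algebra_simps)
    moreover have "\<dots> \<in> I" by (intro I_rmult gen_bracket_I x y word_span_F[OF p])
    ultimately have "gen x * ?p * gen y - gen y * (gen x * ?p) \<in> V (Suc (length v))"
      by (intro word_span_cong[OF _ s] free_algebra_closed(6,8) gen_F[OF x] gen_F[OF y] word_span_F[OF p]) simp
    then show ?case by (simp add: single_Cons)
  qed
  from this[of "letters w"] word word_span_mono[OF b_words_mono[of "length (letters w)" n]]
  show ?case by (auto simp: b_words_def)
qed

end

section \<open>The dual of a finite dimensional space of generators\<close>

text \<open>
  The classes of the words in \<open>W\<close> form a basis of the space \<open>V\<close> spanned by all words of length at most
  \<open>card b\<close> in \<open>b\<close>. That space is finite dimensional, generates the enveloping algebra over the even part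
  and is stable under commuting with even elements.
\<close>

locale word_basis = odd_spanned L b
  for L :: "('k::field, 's::ab_group_add) superalgebra" and b :: "'s set" +
  fixes W :: "'s monomial set"
  assumes W_words: "W \<subseteq> b_words (card b)"
    and W_spans: "V (card b) \<subseteq> word_span W"
    and W_independent: "\<And>p :: ('k, 's) free_algebra. Poly_Mapping.keys p \<subseteq> W \<Longrightarrow> p \<in> I \<Longrightarrow> p = 0"

text \<open>
  A spanning set of words with the least number of elements is independent.
\<close>

lemma (in odd_spanned) exists_word_basis: "\<exists>W. word_basis L b W"
proof -
  let ?P = "\<lambda>W. W \<subseteq> b_words (card b) \<and> V (card b) \<subseteq> word_span W"
  obtain W where W: "?P W" and min: "\<And>W'. ?P W' \<Longrightarrow> card W \<le> card W'"
    using ex_has_least_nat[of ?P "b_words (card b)" card] by blast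
  have Ww: "W \<subseteq> all_words" using W b_words_words by blast
  have fin: "finite W" using W finite_b_words finite_subset by blast
  have "p = 0" if p: "Poly_Mapping.keys p \<subseteq> W" "p \<in> I" for p :: "('k, 's) free_algebra"
  proof (rule ccontr)
    assume "p \<noteq> 0"
    then obtain w where w: "w \<in> Poly_Mapping.keys p" by (metis ex_in_conv keys_eq_empty)
    let ?c = "Poly_Mapping.lookup p w" and ?w = "Poly_Mapping.single w (1 :: 'k)"
    have c: "?c \<noteq> 0" using w by (simp add: in_keys_iff)
    \<comment> \<open>The relation \<open>p\<close> expresses its word \<open>w\<close> through the other words.\<close>
    define r where "r = ?w - const (1 / ?c) * p"
    have lr: "Poly_Mapping.lookup r v = (if v = w then 0 else - (1 / ?c) * Poly_Mapping.lookup p v)" for v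
    proof -
      have "Poly_Mapping.lookup (const (1 / ?c) * p) v = 1 / ?c * Poly_Mapping.lookup p v"
        unfolding const_def mult_map_scale_conv_mult[symmetric] by (simp add: map.rep_eq when_def)
      then show ?thesis using c by (simp add: r_def lookup_minus lookup_single when_def)
    qed
    have keys: "Poly_Mapping.keys r \<subseteq> W - {w}"
      using p(1) by (auto simp: in_keys_iff lr split: if_splits)
    have wF: "w \<in> all_words" using w p(1) Ww by auto
    have "?w - r \<in> I" using I_lmult[OF free_algebra_closed(3) p(2)] by (simp add: r_def)
    moreover have "?w \<in> F" using wF by (simp add: mem_free_algebra_iff)
    ultimately have wr: "?w \<in> word_span (W - {w})" using keys by (auto simp: word_span_def)
    have "word_span W \<subseteq> word_span (W - {w})"
    proof
      fix q assume "q \<in> word_span W"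
      then show "q \<in> word_span (W - {w})"
        using Ww
      proof (induction q rule: word_span_induct)
        case (cong p q) show ?case by (rule word_span_cong[OF cong(1,4,3)])
      next
        case (word v d)
        show ?case
        proof (cases "v = w")
          case True
          have "Poly_Mapping.single w d = const d * ?w" by (simp add: const_mult_single)
          then show ?thesis using word_span_const[OF wr] True by simp
        next
          case False
          then show ?thesis using word Ww by (intro word_span_keys) auto
        qed
      qed (auto simp: word_span_zero word_span_add)
    qed
    then have "card W \<le> card (W - {w})" using W by (intro min) auto
    moreover have "w \<in> W" using w p(1) by auto
    ultimately show False using fin by (metis card_Diff1_less not_le)
  qed
  then have "word_basis L b W" using W by unfold_locales auto
  then show ?thesis by blast
qed

context word_basis begin

abbreviation "wd w \<equiv> Poly_Mapping.single w (1 :: 'k)"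

lemma finite_W: "finite W"
  using W_words finite_b_words finite_subset by blast

lemma W_all_words: "W \<subseteq> all_words"
  using W_words b_words_words by blast

lemma keys_W_F: "Poly_Mapping.keys q \<subseteq> W \<Longrightarrow> q \<in> F"
  using W_all_words keys_all_words[of q] by blast

lemma wd_F: "w \<in> W \<Longrightarrow> wd w \<in> F"
  by (rule keys_W_F) simp

definition VV :: "('k, 's) free_algebra set"
  where "VV = word_span W"

lemma VV_eq: "VV = V (card b)"
  unfolding VV_def using W_spans word_span_mono[OF W_words] by blast

lemma VV_closed:
  "0 \<in> VV" "p \<in> VV \<Longrightarrow> q \<in> VV \<Longrightarrow> p + q \<in> VV" "p \<in> VV \<Longrightarrow> q \<in> VV \<Longrightarrow> p - q \<in> VV"
  "p \<in> VV \<Longrightarrow> const c * p \<in> VV" "Poly_Mapping.keys p \<subseteq> W \<Longrightarrow> p \<in> VV"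
  unfolding VV_def
  by (auto simp: word_span_zero word_span_add word_span_diff word_span_const word_span_keys W_all_words)

lemma VV_F: "p \<in> VV \<Longrightarrow> p \<in> F"
  unfolding VV_def by (rule word_span_F)

text \<open>Coordinates in the basis formed by the classes of the words in \<open>W\<close>.\<close>

definition coords :: "('k, 's) free_algebra \<Rightarrow> ('k, 's) free_algebra"
  where "coords p = (THE q. Poly_Mapping.keys q \<subseteq> W \<and> p - q \<in> I)"

lemma coords_eqI:
  assumes "Poly_Mapping.keys q \<subseteq> W" "p - q \<in> I" shows "coords p = q"
  unfolding coords_def
proof (rule the_equality)
  fix q' assume q': "Poly_Mapping.keys q' \<subseteq> W \<and> p - q' \<in> I"
  have "Poly_Mapping.keys (q' - q) \<subseteq> W" using assms(1) q' keys_diff[of q' q] by auto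
  moreover have "q' - q \<in> I" using I_diff[OF assms(2), of "p - q'"] q' by simp
  ultimately show "q' = q" using W_independent by fastforce
qed (use assms in simp)

lemma coords:
  assumes "p \<in> VV"
  shows coords_keys: "Poly_Mapping.keys (coords p) \<subseteq> W" and coords_I: "p - coords p \<in> I"
proof -
  obtain q where "Poly_Mapping.keys q \<subseteq> W" "p - q \<in> I" using assms by (auto simp: VV_def word_span_def)
  then show "Poly_Mapping.keys (coords p) \<subseteq> W" "p - coords p \<in> I" using coords_eqI by auto
qed

lemma keys_const_mult: "Poly_Mapping.keys q \<subseteq> W \<Longrightarrow> Poly_Mapping.keys (const c * q) \<subseteq> W"
  using keys_mult[of "const c" q] by (force simp: const_def split: if_splits)

lemma keys_plus: "Poly_Mapping.keys p \<subseteq> W \<Longrightarrow> Poly_Mapping.keys q \<subseteq> W \<Longrightarrow> Poly_Mapping.keys (p + q) \<subseteq> W"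
  using Poly_Mapping.keys_add[of p q] by auto

lemma coords_add:
  assumes "p \<in> VV" "q \<in> VV" shows "coords (p + q) = coords p + coords q"
proof (rule coords_eqI)
  show "p + q - (coords p + coords q) \<in> I"
    using I_add[OF coords_I[OF assms(1)] coords_I[OF assms(2)]] by (simp add: algebra_simps)
qed (intro keys_plus coords_keys assms)

lemma coords_const:
  assumes "p \<in> VV" shows "coords (const c * p) = const c * coords p"
proof (rule coords_eqI)
  show "const c * p - const c * coords p \<in> I"
    using I_lmult[OF free_algebra_closed(3) coords_I[OF assms]] by (simp add: algebra_simps)
qed (intro keys_const_mult coords_keys assms)

lemma coords_cong:
  assumes "p \<in> VV" "q - p \<in> I" shows "coords q = coords p"
  using I_add[OF assms(2) coords_I[OF assms(1)]] by (intro coords_eqI coords_keys assms(1)) simp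

definition ad :: "'s \<Rightarrow> ('k, 's) free_algebra \<Rightarrow> ('k, 's) free_algebra"
  where "ad y p = p * gen y - gen y * p"

lemma ad_VV: "y \<in> part L 0 \<Longrightarrow> p \<in> VV \<Longrightarrow> ad y p \<in> VV"
  unfolding VV_eq ad_def by (rule V_ad)

lemma ad_add: "ad y (p + q) = ad y p + ad y q" by (simp add: ad_def algebra_simps)

lemma ad_const: "ad y (const c * p) = const c * ad y p"
proof -
  have "gen y * (const c * p) = const c * (gen y * p)"
    by (simp only: mult.assoc[symmetric] const_commute[of c "gen y"])
  then show ?thesis by (simp add: ad_def right_diff_distrib mult.assoc)
qed

lemma ad_I: "y \<in> part L 0 \<Longrightarrow> p \<in> I \<Longrightarrow> ad y p \<in> I"
  unfolding ad_def by (intro I_diff I_rmult I_lmult gen_F)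

text \<open>
  Commuting with \<open>y\<close> respects congruence, so it may be computed on coordinates.
\<close>

lemma coords_ad_coords:
  assumes "y \<in> part L 0" "p \<in> VV" shows "coords (ad y (coords p)) = coords (ad y p)"
proof -
  have "ad y (p - coords p) \<in> I" using ad_I assms coords_I by blast
  moreover have "ad y (p - coords p) = ad y p - ad y (coords p)" by (simp add: ad_def algebra_simps)
  ultimately have "ad y p - ad y (coords p) \<in> I" by simp
  from coords_cong[OF _ this] show ?thesis
    using ad_VV[OF assms(1) VV_closed(5)[OF coords_keys[OF assms(2)]]] by simp
qed

lemma lookup_const_mult: "Poly_Mapping.lookup (const c * p) w = c * Poly_Mapping.lookup p w"
  unfolding const_def mult_map_scale_conv_mult[symmetric] by (simp add: map.rep_eq when_def)

definition pair :: "('k, 's) free_algebra \<Rightarrow> ('k, 's) free_algebra \<Rightarrow> 'k"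
  where "pair e q = (\<Sum>w\<in>W. Poly_Mapping.lookup q w * Poly_Mapping.lookup e w)"

lemma pair_add_right: "pair e (p + q) = pair e p + pair e q"
  by (simp add: pair_def lookup_add distrib_right sum.distrib)

lemma pair_add_left: "pair (d + e) q = pair d q + pair e q"
  by (simp add: pair_def lookup_add distrib_left sum.distrib)

lemma pair_const_right: "pair e (const c * q) = c * pair e q"
  by (simp add: pair_def lookup_const_mult sum_distrib_left mult.assoc)

lemma pair_const_left: "pair (const c * e) q = c * pair e q"
  by (simp add: pair_def lookup_const_mult sum_distrib_left mult_ac)

lemma pair_zero_right: "pair e 0 = 0" by (simp add: pair_def)

lemma pair_wd_left: "w \<in> W \<Longrightarrow> pair (wd w) q = Poly_Mapping.lookup q w"
  using finite_W by (simp add: pair_def lookup_single when_def if_distrib[of "(*) _"] sum.delta' cong: if_cong)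

lemma pair_wd_right: "w \<in> W \<Longrightarrow> pair e (wd w) = Poly_Mapping.lookup e w"
  using finite_W by (simp add: pair_def lookup_single when_def if_distrib[of "\<lambda>x. x * _"] sum.delta' cong: if_cong)

text \<open>
  The action contragredient to \<open>ad\<close>. Polynomials supported on \<open>W\<close> serve as linear forms here,
  the coefficient at \<open>w\<close> being the value at the basis vector \<open>w\<close>.
\<close>

definition coad :: "'s \<Rightarrow> ('k, 's) free_algebra \<Rightarrow> ('k, 's) free_algebra"
  where "coad y e = (\<Sum>w\<in>W. Poly_Mapping.single w (pair e (coords (ad y (wd w)))))"

lemma lookup_coad: "Poly_Mapping.lookup (coad y e) w = (if w \<in> W then pair e (coords (ad y (wd w))) else 0)"
  using finite_W by (simp add: coad_def lookup_sum lookup_single when_def sum.delta)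

lemma coad_keys: "Poly_Mapping.keys (coad y e) \<subseteq> W"
  by (auto simp: in_keys_iff lookup_coad split: if_splits)

lemma wd_VV: "w \<in> W \<Longrightarrow> wd w \<in> VV"
  by (intro VV_closed) simp

lemma pair_coad:
  assumes y: "y \<in> part L 0" and q: "Poly_Mapping.keys q \<subseteq> W"
  shows "pair (coad y e) q = pair e (coords (ad y q))"
  using q
proof (induction q rule: poly_sum_induct)
  case zero
  have "coords 0 = 0" by (intro coords_eqI) (simp_all add: I_zero)
  then show ?case by (simp add: pair_zero_right ad_def)
next
  case (add p q)
  then show ?case
    by (simp add: pair_add_right ad_add coords_add ad_VV y VV_closed(5))
next
  case (single w c)
  have "Poly_Mapping.single w c = const c * wd w" by (simp add: const_mult_single)
  then show ?case using single
    by (simp add: pair_const_right ad_const coords_const ad_VV y wd_VV pair_wd_right lookup_coad)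
qed

sublocale dual: even_operators L "{0}" "{e. Poly_Mapping.keys e \<subseteq> W}" "\<lambda>c e. const c * e" coad
proof
  fix c d x y and f g :: "('k, 's) free_algebra"
  show "f \<in> {0} \<Longrightarrow> g \<in> {0} \<Longrightarrow> f - g \<in> {0}" by simp
  show "f \<in> {e. Poly_Mapping.keys e \<subseteq> W} \<Longrightarrow> g \<in> {e. Poly_Mapping.keys e \<subseteq> W} \<Longrightarrow> f + g \<in> {e. Poly_Mapping.keys e \<subseteq> W}"
    using keys_plus by simp
  show "f \<in> {e. Poly_Mapping.keys e \<subseteq> W} \<Longrightarrow> const c * f \<in> {e. Poly_Mapping.keys e \<subseteq> W}"
    using keys_const_mult by simp
  show "const c * (f + g) = const c * f + const c * g" by (simp add: distrib_left)
  show "coad x (f + g) = coad x f + coad x g"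
    by (rule poly_mapping_eqI) (simp add: lookup_coad lookup_add pair_add_left)
  show "coad x f \<in> {e. Poly_Mapping.keys e \<subseteq> W}" using coad_keys by simp
  show "f \<in> {0} \<Longrightarrow> coad x f \<in> {0}" by (simp add: coad_def pair_def)
  show "const c * coad x f - coad x (const c * f) \<in> {0}"
    by (simp, rule poly_mapping_eqI) (simp add: lookup_coad lookup_const_mult pair_const_left)
  show "const (c + d) * f - (const c * f + const d * f) \<in> {0}" by (simp add: const_simps algebra_simps)
  show "const (c * d) * f - const c * (const d * f) \<in> {0}" by (simp add: const_simps algebra_simps)
  show "const 1 * f - f \<in> {0}" by (simp add: const_simps)
  assume x: "x \<in> part L 0"
  have xL: "x \<in> superspace L" using x by (rule part_superspace)
  have "coords (ad (lscale L c x) p) = const c * coords (ad x p)" if p: "p \<in> VV" for p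
  proof -
    have "p * (const c * gen x) = const c * (p * gen x)"
      by (simp only: mult.assoc[symmetric] const_commute[of c p])
    then have "ad (lscale L c x) p - const c * ad x p =
        p * (gen (lscale L c x) - const c * gen x) - (gen (lscale L c x) - const c * gen x) * p"
      by (simp add: ad_def algebra_simps)
    also have "\<dots> \<in> I" by (intro I_diff I_lmult I_rmult gen_scale_I xL VV_F p)
    finally have "coords (ad (lscale L c x) p) = coords (const c * ad x p)"
      by (intro coords_cong VV_closed ad_VV x p)
    then show ?thesis using coords_const[OF ad_VV[OF x p]] by simp
  qed
  then show "coad (lscale L c x) f - const c * coad x f \<in> {0}"
    by (simp, intro poly_mapping_eqI) (simp add: lookup_coad lookup_const_mult pair_const_right wd_VV)
  assume y: "y \<in> part L 0"
  have yL: "y \<in> superspace L" using y by (rule part_superspace)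
  have "coords (ad (x + y) p) = coords (ad x p) + coords (ad y p)" if p: "p \<in> VV" for p
  proof -
    have "ad (x + y) p - (ad x p + ad y p) =
        p * (gen (x + y) - (gen x + gen y)) - (gen (x + y) - (gen x + gen y)) * p"
      by (simp add: ad_def algebra_simps)
    also have "\<dots> \<in> I" by (intro I_diff I_lmult I_rmult gen_add_I xL yL VV_F p)
    finally have "coords (ad (x + y) p) = coords (ad x p + ad y p)"
      by (intro coords_cong VV_closed ad_VV x y p)
    then show ?thesis using coords_add[OF ad_VV[OF x p] ad_VV[OF y p]] by simp
  qed
  then show "coad (x + y) f - (coad x f + coad y f) \<in> {0}"
    by (simp, intro poly_mapping_eqI) (simp add: lookup_coad lookup_add pair_add_right wd_VV)
  have br: "bracket L x y \<in> part L 0" using bracket_part[OF x y] by simp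
  have "coords (ad y (ad x p)) = coords (ad x (ad y p)) + coords (ad (bracket L x y) p)" if p: "p \<in> VV" for p
  proof -
    let ?r = "gen x * gen y - (const (koszul 0 0) * gen y * gen x + gen (bracket L x y)) :: ('k, 's) free_algebra"
    have "ad y (ad x p) - (ad x (ad y p) + ad (bracket L x y) p) = p * ?r - ?r * p"
      by (simp add: ad_def koszul_def const_simps algebra_simps)
    also have "\<dots> \<in> I" by (intro I_diff I_lmult I_rmult gen_bracket_I x y VV_F p)
    finally have "coords (ad y (ad x p)) = coords (ad x (ad y p) + ad (bracket L x y) p)"
      by (intro coords_cong VV_closed ad_VV x y p br)
    then show ?thesis using coords_add[OF ad_VV[OF x ad_VV[OF y p]] ad_VV[OF br p]] by simp
  qed
  then show "coad x (coad y f) - (coad y (coad x f) + coad (bracket L x y) f) \<in> {0}"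
    by (simp, intro poly_mapping_eqI)
      (simp add: lookup_coad lookup_add pair_add_right wd_VV pair_coad x y coords_keys ad_VV coords_ad_coords)
qed simp_all

definition dual_module :: "(('k, 's) env, ('k, 's) free_algebra) module"
  where "dual_module = \<lparr>carrier = {e. Poly_Mapping.keys e \<subseteq> W}, mult = undefined, one = undefined,
    ring.zero = 0, add = (+), smult = (\<lambda>u. dual.act (rep u))\<rparr>"

lemma dual_cong: "dual.cong f g \<longleftrightarrow> f = g"
  by (simp add: dual.cong_def)

lemma dual_module_simps [simp]:
  "carrier dual_module = {e. Poly_Mapping.keys e \<subseteq> W}" "\<zero>\<^bsub>dual_module\<^esub> = 0"
  "d \<oplus>\<^bsub>dual_module\<^esub> e = d + e" "u \<odot>\<^bsub>dual_module\<^esub> e = dual.act (rep u) e"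
  by (simp_all add: dual_module_def)

lemma left_module_dual: "left_module (env_even L) dual_module"
proof -
  interpret L0: lie_superalgebra "even_subalgebra L" by (rule lie_superalgebra_even)
  have "abelian_group dual_module"
  proof (rule abelian_groupI)
    fix x assume "x \<in> carrier dual_module"
    then show "\<exists>y\<in>carrier dual_module. y \<oplus>\<^bsub>dual_module\<^esub> x = \<zero>\<^bsub>dual_module\<^esub>"
      by (intro bexI[of _ "- x"]) simp_all
  qed (auto simp: algebra_simps dest: subsetD[OF keys_plus])
  moreover have "rep u \<in> F0" if "u \<in> carrier (env_even L)" for u using L0.rep_env_closed[OF that] by simp
  ultimately show ?thesis
    using dual.act_rep_add dual.act_rep_mult dual.act_rep_one dual.act_C
    by (intro left_module.intro left_module_axioms.intro L0.ring_env)
      (auto simp: dual_cong dual.act_add)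
qed

end

sublocale word_basis \<subseteq> E: even_module L dual_module
  by (intro even_module.intro lie_superalgebra_axioms left_module_dual)

context word_basis begin

lemma dual_kscale: "Poly_Mapping.keys e \<subseteq> W \<Longrightarrow> E.kscale c e = const c * e"
  using dual.act_rep_class[of e "const c"] dual.act_const[of e c]
  by (simp add: env_scale_def dual_cong free_algebra_closed)

lemma dual_lie_act: "x \<in> part L 0 \<Longrightarrow> Poly_Mapping.keys e \<subseteq> W \<Longrightarrow> E.lie_act x e = coad x e"
  using dual.act_rep_class[of e "gen x"] dual.act_gen[of x e]
  by (simp add: E.lie_act_def dual_cong free_algebra_closed)

lemma dual_finite_dimensional: "env_finite_dimensional (even_subalgebra L) dual_module"
  unfolding env_finite_dimensional_def
proof (intro exI[of _ "wd ` W"] conjI ballI)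
  show "finite (wd ` W)" using finite_W by simp
  show "wd ` W \<subseteq> carrier dual_module" by auto
  fix x assume "x \<in> carrier dual_module"
  then have x: "Poly_Mapping.keys x \<subseteq> W" by simp
  let ?c = "\<lambda>e. Poly_Mapping.lookup x (the_elem (Poly_Mapping.keys e)) :: 'k"
  have "finsum dual_module (\<lambda>e. E.kscale (?c e) e) (wd ` A) = (\<Sum>w\<in>A. Poly_Mapping.single w (Poly_Mapping.lookup x w))"
    if "finite A" "A \<subseteq> W" for A
    using that
  proof (induction A rule: finite_induct)
    case empty
    then show ?case by (simp add: E.M.M.finsum_empty)
  next
    case (insert w A)
    have kscale: "E.kscale (?c (wd v)) (wd v) = Poly_Mapping.single v (Poly_Mapping.lookup x v)" if "v \<in> insert w A" for v
      using that insert.prems by (subst dual_kscale) (auto simp: const_mult_single)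
    have "v = w" if "wd w = wd v" for v using arg_cong[OF that, of Poly_Mapping.keys] by simp
    then have "wd w \<notin> wd ` A" using insert.hyps by auto
    moreover have kc: "E.kscale (?c e) e \<in> carrier dual_module" if "e \<in> insert (wd w) (wd ` A)" for e
    proof -
      have "\<exists>v\<in>W. e = wd v" using that insert.prems by auto
      then have "e \<in> carrier dual_module" by auto
      then show ?thesis by (rule E.kscale_closed)
    qed
    ultimately have "finsum dual_module (\<lambda>e. E.kscale (?c e) e) (insert (wd w) (wd ` A)) =
        E.kscale (?c (wd w)) (wd w) \<oplus>\<^bsub>dual_module\<^esub> finsum dual_module (\<lambda>e. E.kscale (?c e) e) (wd ` A)"
      using insert.hyps(1) by (intro E.M.M.finsum_insert funcsetI finite_imageI kc) auto
    then show ?case using insert kscale[of w] by simp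
  qed
  from this[OF finite_W] have f: "finsum dual_module (\<lambda>e. E.kscale (?c e) e) (wd ` W) =
      (\<Sum>w\<in>W. Poly_Mapping.single w (Poly_Mapping.lookup x w))" by simp
  also have "\<dots> = x"
    using x by (intro poly_mapping_eqI) (auto simp: lookup_sum lookup_single when_def finite_W in_keys_iff)
  finally show "\<exists>c. x = finsum dual_module (\<lambda>e. E.kscale (c e) e) (wd ` W)"
    by (intro exI[of _ ?c]) simp
qed

end

section \<open>Modules over the enveloping algebra and their restrictions\<close>

locale env_module = lie_superalgebra L + M: left_module "env L" M
  for L :: "('k::field, 's::ab_group_add) superalgebra" and M :: "(('k, 's) env, 'm) module"
begin

definition poly_act :: "('k, 's) free_algebra \<Rightarrow> 'm \<Rightarrow> 'm"
  where "poly_act p m = env_class L p \<odot>\<^bsub>M\<^esub> m"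

lemma poly_act_closed: "p \<in> F \<Longrightarrow> m \<in> carrier M \<Longrightarrow> poly_act p m \<in> carrier M"
  by (simp add: poly_act_def M.smult_closed env_class_in)

lemma poly_act_add: "p \<in> F \<Longrightarrow> q \<in> F \<Longrightarrow> m \<in> carrier M \<Longrightarrow> poly_act (p + q) m = poly_act p m \<oplus>\<^bsub>M\<^esub> poly_act q m"
  by (simp add: poly_act_def env_class_add M.smult_l_distr env_class_in)

lemma poly_act_add_right: "p \<in> F \<Longrightarrow> m \<in> carrier M \<Longrightarrow> n \<in> carrier M \<Longrightarrow> poly_act p (m \<oplus>\<^bsub>M\<^esub> n) = poly_act p m \<oplus>\<^bsub>M\<^esub> poly_act p n"
  by (simp add: poly_act_def M.smult_r_distr env_class_in)

lemma poly_act_mult: "p \<in> F \<Longrightarrow> q \<in> F \<Longrightarrow> m \<in> carrier M \<Longrightarrow> poly_act (p * q) m = poly_act p (poly_act q m)"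
  by (simp add: poly_act_def env_class_mult M.smult_assoc env_class_in)

lemma poly_act_cong: "p \<in> F \<Longrightarrow> q \<in> F \<Longrightarrow> p - q \<in> I \<Longrightarrow> poly_act p m = poly_act q m"
  using env_class_eqI[of p q] by (simp add: poly_act_def)

lemma poly_act_zero: "m \<in> carrier M \<Longrightarrow> poly_act 0 m = \<zero>\<^bsub>M\<^esub>"
  by (simp add: poly_act_def env_class_zero M.smult_zero_left)

lemma poly_act_one: "m \<in> carrier M \<Longrightarrow> poly_act 1 m = m"
  by (simp add: poly_act_def env_class_one M.smult_one)

definition res :: "(('k, 's) env, 'm) module"
  where "res = M\<lparr>smult := \<lambda>u m. env_map L u \<odot>\<^bsub>M\<^esub> m\<rparr>"

lemma res_simps [simp]:
  "carrier res = carrier M" "\<zero>\<^bsub>res\<^esub> = \<zero>\<^bsub>M\<^esub>" "m \<oplus>\<^bsub>res\<^esub> n = m \<oplus>\<^bsub>M\<^esub> n"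
  "u \<odot>\<^bsub>res\<^esub> m = env_map L u \<odot>\<^bsub>M\<^esub> m"
  by (simp_all add: res_def)

lemma left_module_res: "left_module (env_even L) res"
  unfolding res_def
  by (rule M.left_module_restrict_scalars[OF lie_superalgebra.ring_env[OF lie_superalgebra_even] env_map_hom])

sublocale R: even_module L res
  by (intro even_module.intro lie_superalgebra_axioms left_module_res)

lemma res_poly_act: "p \<in> F0 \<Longrightarrow> R.poly_act p m = poly_act p m"
  by (simp add: R.poly_act_def poly_act_def env_map_class)

lemma res_kscale: "R.kscale c m = poly_act (const c) m"
  by (simp add: R.kscale_eq res_poly_act free_algebra_closed)

lemma res_lie_act: "x \<in> part L 0 \<Longrightarrow> R.lie_act x m = poly_act (gen x) m"
  by (simp add: R.lie_act_eq res_poly_act free_algebra_closed)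

lemma submodule_res_poly_act:
  assumes "submodule D (env_even L) res" "p \<in> F0" "m \<in> D"
  shows "poly_act p m \<in> D"
proof -
  have "env_class (even_subalgebra L) p \<odot>\<^bsub>res\<^esub> m \<in> D"
    using assms R.class_in unfolding R.M.submodule_iff by blast
  then show ?thesis using assms(2) by (simp add: poly_act_def env_map_class)
qed

lemma submodule_iff_poly_act:
  "submodule D (env L) M \<longleftrightarrow> D \<subseteq> carrier M \<and> \<zero>\<^bsub>M\<^esub> \<in> D \<and>
    (\<forall>x\<in>D. \<forall>y\<in>D. x \<oplus>\<^bsub>M\<^esub> y \<in> D) \<and> (\<forall>p\<in>F. \<forall>x\<in>D. poly_act p x \<in> D)"
proof -
  have "(\<forall>a\<in>carrier (env L). \<forall>x\<in>D. a \<odot>\<^bsub>M\<^esub> x \<in> D) \<longleftrightarrow> (\<forall>p\<in>F. \<forall>x\<in>D. poly_act p x \<in> D)"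
    unfolding poly_act_def by (auto intro: env_class_in elim!: env_carrierE)
  then show ?thesis unfolding M.submodule_iff by simp
qed

end

locale module_with_word_basis = word_basis L b W + env_module L M
  for L :: "('k::field, 's::ab_group_add) superalgebra" and b W and M :: "(('k, 's) env, 'm) module"
begin

text \<open>This is the equation \<open>U(\<ss>) = U(\<ss>\<^sub>0) V\<close>, with \<open>V\<close> the span of the words in \<open>W\<close>.\<close>

lemma even_submodule_contains_orbit:
  assumes D: "submodule D (env_even L) res" and m: "m \<in> carrier M"
    and W: "\<And>w. w \<in> W \<Longrightarrow> poly_act (wd w) m \<in> D" and p: "p \<in> F"
  shows "poly_act p m \<in> D"
proof -
  have D': "D \<subseteq> carrier M" "\<zero>\<^bsub>M\<^esub> \<in> D" "\<And>x y. x \<in> D \<Longrightarrow> y \<in> D \<Longrightarrow> x \<oplus>\<^bsub>M\<^esub> y \<in> D"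
    using D unfolding R.M.submodule_iff by auto
  have const: "poly_act (const c * q) m \<in> D" if "q \<in> F" "poly_act q m \<in> D" for c q
    using submodule_res_poly_act[OF D free_algebra_closed(3) that(2)] that(1) m by (simp add: poly_act_mult free_algebra_closed)
  have VD: "poly_act q m \<in> D" if "q \<in> VV" for q
    using that W_all_words unfolding VV_def
  proof (induction q rule: word_span_induct)
    case (cong p q) then show ?case using poly_act_cong by simp
  next
    case (word w c)
    have "Poly_Mapping.single w c = const c * wd w" by (simp add: const_mult_single)
    then show ?case using const[OF wd_F[OF word] W[OF word]] by simp
  qed (use D' m in \<open>simp_all add: poly_act_zero poly_act_add\<close>)
  have "p \<in> Y (card b)" using p Y_eq_F by simp
  then show ?thesis
    using normal_words_words
  proof (induction p rule: word_span_induct)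
    case (cong p q) then show ?case using poly_act_cong by simp
  next
    case (word w c)
    then obtain u v where uv: "w = Monomial (u @ v)" "set u \<subseteq> part L 0" "set v \<subseteq> b" "length v \<le> card b"
      by (auto simp: normal_words_def)
    have v: "Poly_Mapping.single (Monomial v) c \<in> VV"
      unfolding VV_eq using uv by (intro word_span_keys b_words_words) (simp add: b_words_def)
    have u: "wd (Monomial u) \<in> F0" using uv by (simp add: mem_free_algebra_iff)
    have "poly_act (wd (Monomial u)) (poly_act (Poly_Mapping.single (Monomial v) c) m) \<in> D"
      by (rule submodule_res_poly_act[OF D u VD[OF v]])
    then show ?case
      using m VV_F[OF v] subsetD[OF F0_subset u] by (simp add: uv(1) single_append poly_act_mult)
  qed (use D' m in \<open>simp_all add: poly_act_zero poly_act_add\<close>)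
qed

end

text \<open>
  A homomorphism \<open>f\<close> from the restriction of \<open>M\<close> to \<open>S\<close>. The map \<open>embed\<close> is the adjoint
  homomorphism \<open>m \<mapsto> (v \<mapsto> f (v m))\<close> from \<open>M\<close> to the linear maps from \<open>V\<close> to \<open>S\<close>.
\<close>

locale coinduced = module_with_word_basis L b W M + S: even_module L S
  for L :: "('k::field, 's::ab_group_add) superalgebra" and b W
    and M :: "(('k, 's) env, 'm) module" and S :: "(('k, 's) env, 'a) module" +
  fixes f :: "'m \<Rightarrow> 'a"
  assumes f: "f \<in> left_module_hom (env_even L) res S"
begin

sublocale T: even_tensor L S dual_module
  by (intro even_tensor.intro lie_superalgebra_axioms S.even_module_axioms E.even_module_axioms)

notation T.cong (infix \<open>\<doteq>\<close> 50)

lemma f_closed: "m \<in> carrier M \<Longrightarrow> f m \<in> carrier S"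
  using left_module_homD(1)[OF f] by simp

lemma f_add: "m \<in> carrier M \<Longrightarrow> n \<in> carrier M \<Longrightarrow> f (m \<oplus>\<^bsub>M\<^esub> n) = f m \<oplus>\<^bsub>S\<^esub> f n"
  using left_module_homD(2)[OF f] by simp

lemma f_zero: "f \<zero>\<^bsub>M\<^esub> = \<zero>\<^bsub>S\<^esub>"
  using left_module_hom_zero[OF left_module_res S.M.left_module_axioms f] by simp

lemma f_poly_act: "p \<in> F0 \<Longrightarrow> m \<in> carrier M \<Longrightarrow> f (poly_act p m) = S.poly_act p (f m)"
  using left_module_homD(3)[OF f, of "env_class (even_subalgebra L) p" m]
  by (simp add: R.class_in poly_act_def S.poly_act_def env_map_class)

definition frag_embed :: "'m \<Rightarrow> ('a \<times> ('k, 's) free_algebra) \<Rightarrow>\<^sub>0 int"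
  where "frag_embed m = (\<Sum>w\<in>W. frag_of (f (poly_act (wd w) m), wd w))"

definition embed :: "'m \<Rightarrow> (('a \<times> ('k, 's) free_algebra) \<Rightarrow>\<^sub>0 int) set"
  where "embed m = T.null #>\<^bsub>free_Abelian_group T.X\<^esub> frag_embed m"

lemma sum_C: "(\<And>i. i \<in> A \<Longrightarrow> g i \<in> T.C) \<Longrightarrow> sum g A \<in> T.C"
  by (rule sum_closed[OF T.C_closed(2,3)])

lemma fw_closed: "w \<in> W \<Longrightarrow> m \<in> carrier M \<Longrightarrow> f (poly_act (wd w) m) \<in> carrier S"
  by (intro f_closed poly_act_closed wd_F)

lemma frag_embed_C: "m \<in> carrier M \<Longrightarrow> frag_embed m \<in> T.C"
  unfolding frag_embed_def by (intro sum_C) (simp only: T.C_closed(1), simp add: fw_closed)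

lemma tensor_zero_left: "Poly_Mapping.keys e \<subseteq> W \<Longrightarrow> frag_of (\<zero>\<^bsub>S\<^esub>, e) \<doteq> 0"
  using T.N_minus T.tensor_add_left[of "\<zero>\<^bsub>S\<^esub>" "\<zero>\<^bsub>S\<^esub>" e] by (fastforce simp: T.cong_def)

lemma tensor_zero_right: "s \<in> carrier S \<Longrightarrow> frag_of (s, 0) \<doteq> 0"
  using T.N_minus T.tensor_add_right[of s 0 0] by (fastforce simp: T.cong_def)

text \<open>
  Expansion of a linear form \<open>e\<close> in the dual basis \<open>wd w\<close>.
\<close>

lemma tensor_expand:
  assumes s: "s \<in> carrier S" and e: "Poly_Mapping.keys e \<subseteq> W"
  shows "frag_of (s, e) \<doteq> (\<Sum>w\<in>W. frag_of (S.kscale (Poly_Mapping.lookup e w) s, wd w))"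
proof -
  let ?s = "\<lambda>w. Poly_Mapping.single w (Poly_Mapping.lookup e w)"
  have "Poly_Mapping.keys (sum ?s A) \<subseteq> W \<and>
      frag_of (s, sum ?s A) \<doteq> (\<Sum>w\<in>A. frag_of (S.kscale (Poly_Mapping.lookup e w) s, wd w))"
    if "finite A" "A \<subseteq> W" for A
    using that
  proof (induction A rule: finite_induct)
    case empty
    show ?case using tensor_zero_right[OF s] by simp
  next
    case (insert w A)
    then have w: "w \<in> W" and IH: "Poly_Mapping.keys (sum ?s A) \<subseteq> W"
      "frag_of (s, sum ?s A) \<doteq> (\<Sum>w\<in>A. frag_of (S.kscale (Poly_Mapping.lookup e w) s, wd w))" by auto
    have k: "?s w = E.kscale (Poly_Mapping.lookup e w) (wd w)"
      using w by (subst dual_kscale) (simp_all add: const_mult_single)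
    have "frag_of (s, ?s w + sum ?s A) \<doteq> frag_of (s, ?s w) + frag_of (s, sum ?s A)"
      using T.tensor_add_right[of s "?s w" "sum ?s A"] s w IH(1) by simp
    also have "\<dots> \<doteq> frag_of (S.kscale (Poly_Mapping.lookup e w) s, wd w) +
        (\<Sum>w\<in>A. frag_of (S.kscale (Poly_Mapping.lookup e w) s, wd w))"
      unfolding k using w s by (intro T.cong_add IH(2) T.cong_sym[OF T.tensor_scale]) simp_all
    finally have "frag_of (s, sum ?s (insert w A)) \<doteq>
        (\<Sum>w\<in>insert w A. frag_of (S.kscale (Poly_Mapping.lookup e w) s, wd w))"
      using insert.hyps by simp
    moreover have "Poly_Mapping.keys (sum ?s (insert w A)) \<subseteq> W"
      using insert.hyps keys_plus[of "?s w", OF _ IH(1)] w by simp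
    ultimately show ?case by blast
  qed
  moreover have "sum ?s W = e"
    using e finite_W by (intro poly_mapping_eqI) (auto simp: lookup_sum lookup_single when_def in_keys_iff)
  ultimately show ?thesis using finite_W by force
qed

lemma tensor_collect:
  assumes m: "m \<in> carrier M" and q: "Poly_Mapping.keys q \<subseteq> W" and e: "Poly_Mapping.keys e \<subseteq> W"
  shows "(\<Sum>w\<in>W. frag_of (S.kscale (Poly_Mapping.lookup q w) (f (poly_act (wd w) m)), e)) \<doteq> frag_of (f (poly_act q m), e)"
proof -
  let ?s = "\<lambda>w. Poly_Mapping.single w (Poly_Mapping.lookup q w)"
  have "Poly_Mapping.keys (sum ?s A) \<subseteq> W \<and>
      (\<Sum>w\<in>A. frag_of (S.kscale (Poly_Mapping.lookup q w) (f (poly_act (wd w) m)), e)) \<doteq> frag_of (f (poly_act (sum ?s A) m), e)"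
    if "finite A" "A \<subseteq> W" for A
    using that
  proof (induction A rule: finite_induct)
    case empty
    show ?case using T.cong_sym[OF tensor_zero_left[OF e]] by (simp add: poly_act_zero m f_zero)
  next
    case (insert w A)
    let ?g = "\<lambda>w. frag_of (S.kscale (Poly_Mapping.lookup q w) (f (poly_act (wd w) m)), e)"
    from insert have w: "w \<in> W" and IH: "Poly_Mapping.keys (sum ?s A) \<subseteq> W"
      "sum ?g A \<doteq> frag_of (f (poly_act (sum ?s A) m), e)" by auto
    have sw: "?s w = const (Poly_Mapping.lookup q w) * wd w" by (simp add: const_mult_single)
    have k: "S.kscale (Poly_Mapping.lookup q w) (f (poly_act (wd w) m)) = f (poly_act (?s w) m)"
      unfolding sw using w m by (simp add: poly_act_mult free_algebra_closed wd_F f_poly_act poly_act_closed S.kscale_eq)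
    have swW: "Poly_Mapping.keys (?s w) \<subseteq> W" using w by simp
    note F = keys_W_F[OF swW] keys_W_F[OF IH(1)]
    have "?g w + sum ?g A \<doteq> frag_of (f (poly_act (?s w) m), e) + frag_of (f (poly_act (sum ?s A) m), e)"
      unfolding k by (intro T.cong_add T.cong_refl IH(2))
    also have "\<dots> \<doteq> frag_of (f (poly_act (?s w) m) \<oplus>\<^bsub>S\<^esub> f (poly_act (sum ?s A) m), e)"
      using F e m by (intro T.cong_sym[OF T.tensor_add_left] f_closed poly_act_closed) simp_all
    also have "f (poly_act (?s w) m) \<oplus>\<^bsub>S\<^esub> f (poly_act (sum ?s A) m) = f (poly_act (?s w + sum ?s A) m)"
      using F m by (simp add: f_add poly_act_closed poly_act_add)
    finally have "sum ?g (insert w A) \<doteq> frag_of (f (poly_act (sum ?s (insert w A)) m), e)"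
      using insert.hyps by simp
    moreover have "Poly_Mapping.keys (sum ?s (insert w A)) \<subseteq> W"
      using insert.hyps keys_plus[OF swW IH(1)] by simp
    ultimately show ?case by blast
  qed
  moreover have "sum ?s W = q"
    using q finite_W by (intro poly_mapping_eqI) (auto simp: lookup_sum lookup_single when_def in_keys_iff)
  ultimately show ?thesis using finite_W by force
qed

lemma frag_embed_add:
  assumes "m \<in> carrier M" "n \<in> carrier M"
  shows "frag_embed (m \<oplus>\<^bsub>M\<^esub> n) \<doteq> frag_embed m + frag_embed n"
  unfolding frag_embed_def sum.distrib[symmetric]
proof (rule T.cong_sum)
  fix w assume w: "w \<in> W"
  have "f (poly_act (wd w) (m \<oplus>\<^bsub>M\<^esub> n)) = f (poly_act (wd w) m) \<oplus>\<^bsub>S\<^esub> f (poly_act (wd w) n)"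
    using assms wd_F[OF w] by (simp add: poly_act_add_right poly_act_closed f_add)
  then show "frag_of (f (poly_act (wd w) (m \<oplus>\<^bsub>M\<^esub> n)), wd w) \<doteq>
      frag_of (f (poly_act (wd w) m), wd w) + frag_of (f (poly_act (wd w) n), wd w)"
    using T.tensor_add_left[of "f (poly_act (wd w) m)" "f (poly_act (wd w) n)" "wd w"] fw_closed[OF w] assms w by simp
qed

lemma tsc_sum: "T.tsc c (sum g A) = (\<Sum>i\<in>A. T.tsc c (g i))"
  by (induction A rule: infinite_finite_induct) (simp_all add: frag_extend_add)

lemma tac_sum: "T.tac c (sum g A) = (\<Sum>i\<in>A. T.tac c (g i))"
  by (induction A rule: infinite_finite_induct) (simp_all add: frag_extend_add tensor_leibniz_def)

lemma frag_embed_scale: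
  assumes "m \<in> carrier M"
  shows "frag_embed (poly_act (const c) m) = T.tsc c (frag_embed m)"
  unfolding frag_embed_def tsc_sum
proof (intro sum.cong refl)
  fix w assume w: "w \<in> W"
  have "poly_act (wd w) (poly_act (const c) m) = poly_act (const c) (poly_act (wd w) m)"
    using assms wd_F[OF w] by (simp add: poly_act_mult[symmetric] free_algebra_closed const_commute)
  then have "f (poly_act (wd w) (poly_act (const c) m)) = S.kscale c (f (poly_act (wd w) m))"
    using assms wd_F[OF w] by (simp add: f_poly_act free_algebra_closed poly_act_closed S.kscale_eq)
  then show "frag_of (f (poly_act (wd w) (poly_act (const c) m)), wd w) = T.tsc c (frag_of (f (poly_act (wd w) m), wd w))"
    by simp
qed

text \<open>
  The operator \<open>ad x\<close> by which \<open>x\<close> fails to commute with \<open>V\<close> is compensated by the action of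
  \<open>x\<close> on the dual of \<open>V\<close>.
\<close>

lemma frag_embed_lie:
  assumes x: "x \<in> part L 0" and m: "m \<in> carrier M"
  shows "frag_embed (poly_act (gen x) m) \<doteq> T.tac x (frag_embed m)"
proof -
  let ?q = "\<lambda>u. coords (ad x (wd u))"
  have q: "Poly_Mapping.keys (?q u) \<subseteq> W" if "u \<in> W" for u
    by (intro coords_keys ad_VV x wd_VV that)
  have adF: "ad x (wd u) \<in> F" if "u \<in> W" for u by (intro VV_F ad_VV x wd_VV that)
  have "T.tac x (frag_embed m) =
      (\<Sum>w\<in>W. frag_of (S.lie_act x (f (poly_act (wd w) m)), wd w)) + (\<Sum>w\<in>W. frag_of (f (poly_act (wd w) m), coad x (wd w)))"
    unfolding frag_embed_def tac_sum sum.distrib[symmetric]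
    by (intro sum.cong refl) (simp add: T.tac_frag_of dual_lie_act x)
  also have "\<dots> \<doteq> (\<Sum>u\<in>W. frag_of (S.lie_act x (f (poly_act (wd u) m)), wd u)) +
      (\<Sum>w\<in>W. \<Sum>u\<in>W. frag_of (S.kscale (Poly_Mapping.lookup (coad x (wd w)) u) (f (poly_act (wd w) m)), wd u))"
    by (intro T.cong_add T.cong_refl T.cong_sum tensor_expand fw_closed m coad_keys)
  also have "(\<Sum>w\<in>W. \<Sum>u\<in>W. frag_of (S.kscale (Poly_Mapping.lookup (coad x (wd w)) u) (f (poly_act (wd w) m)), wd u)) =
      (\<Sum>u\<in>W. \<Sum>w\<in>W. frag_of (S.kscale (Poly_Mapping.lookup (?q u) w) (f (poly_act (wd w) m)), wd u))"
    by (subst sum.swap) (intro sum.cong refl, simp add: lookup_coad pair_wd_left)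
  also have "(\<Sum>u\<in>W. frag_of (S.lie_act x (f (poly_act (wd u) m)), wd u)) + \<dots> \<doteq>
      (\<Sum>u\<in>W. frag_of (S.lie_act x (f (poly_act (wd u) m)), wd u)) + (\<Sum>u\<in>W. frag_of (f (poly_act (?q u) m), wd u))"
    by (intro T.cong_add T.cong_refl T.cong_sum tensor_collect m q) simp_all
  also have "\<dots> \<doteq> frag_embed (poly_act (gen x) m)"
    unfolding frag_embed_def sum.distrib[symmetric]
  proof (rule T.cong_sum)
    fix u assume u: "u \<in> W"
    have "poly_act (?q u) m = poly_act (ad x (wd u)) m"
      using poly_act_cong[OF adF[OF u] keys_W_F[OF q[OF u]] coords_I[OF ad_VV[OF x wd_VV[OF u]]]] by simp
    moreover have "S.lie_act x (f (poly_act (wd u) m)) = f (poly_act (gen x) (poly_act (wd u) m))"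
      using x m u by (simp add: f_poly_act free_algebra_closed poly_act_closed wd_F S.lie_act_eq)
    moreover have "poly_act (wd u) (poly_act (gen x) m) = poly_act (gen x) (poly_act (wd u) m) \<oplus>\<^bsub>M\<^esub> poly_act (ad x (wd u)) m"
    proof -
      have "wd u * gen x = gen x * wd u + ad x (wd u)" by (simp add: ad_def)
      then have "poly_act (wd u * gen x) m = poly_act (gen x * wd u) m \<oplus>\<^bsub>M\<^esub> poly_act (ad x (wd u)) m"
        using poly_act_add[OF free_algebra_closed(6)[OF gen_F[OF x] wd_F[OF u]] adF[OF u] m] by simp
      then show ?thesis using gen_F[OF x] wd_F[OF u] m by (simp add: poly_act_mult)
    qed
    ultimately show "frag_of (S.lie_act x (f (poly_act (wd u) m)), wd u) + frag_of (f (poly_act (?q u) m), wd u) \<doteq>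
        frag_of (f (poly_act (wd u) (poly_act (gen x) m)), wd u)"
      using T.cong_sym[OF T.tensor_add_left[of "f (poly_act (gen x) (poly_act (wd u) m))" "f (poly_act (ad x (wd u)) m)" "wd u"]]
        u m adF[OF u] gen_F[OF x] wd_F[OF u]
      by (simp add: f_closed poly_act_closed f_add)
  qed
  finally show ?thesis by (rule T.cong_sym)
qed

abbreviation "TM \<equiv> tensor_module (even_subalgebra L) S dual_module"

lemma embed_closed: "m \<in> carrier M \<Longrightarrow> embed m \<in> carrier TM"
  unfolding embed_def T.tensor_module_eq by (intro T.quot.coset_closed frag_embed_C)

text \<open>
  Homomorphy only has to be tested for scalars and for elements of the Lie algebra.
\<close>

lemma embed_hom: "embed \<in> left_module_hom (env_even L) res TM"
proof (rule R.additive_commutes_with_env[OF T.tensor_module_left_module])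
  fix m assume "m \<in> carrier res"
  then have m: "m \<in> carrier M" by simp
  note mC = frag_embed_C[OF m]
  show "embed m \<in> carrier TM" by (rule embed_closed[OF m])
  show "embed (R.kscale c m) = env_scale (even_subalgebra L) TM c (embed m)" for c
  proof -
    have "env_scale (even_subalgebra L) TM c (embed m) =
        T.null #>\<^bsub>free_Abelian_group T.X\<^esub> T.ops.act (const c) (frag_embed m)"
      unfolding env_scale_def[of "even_subalgebra L" TM] embed_def by (rule T.tensor_smult[OF free_algebra_closed(3) mC])
    also have "\<dots> = T.null #>\<^bsub>free_Abelian_group T.X\<^esub> T.tsc c (frag_embed m)"
      by (intro T.coset_eqI T.ops.act_C T.tsc_C mC free_algebra_closed T.ops.act_const)
    finally show ?thesis by (simp add: embed_def res_kscale frag_embed_scale m)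
  qed
  show "embed (R.lie_act x m) = env_class (even_subalgebra L) (gen x) \<odot>\<^bsub>TM\<^esub> embed m"
    if x: "x \<in> part L 0" for x
  proof -
    have "env_class (even_subalgebra L) (gen x) \<odot>\<^bsub>TM\<^esub> embed m =
        T.null #>\<^bsub>free_Abelian_group T.X\<^esub> T.ops.act (gen x) (frag_embed m)"
      unfolding embed_def by (rule T.tensor_smult[OF free_algebra_closed(4)[OF x] mC])
    also have "\<dots> = T.null #>\<^bsub>free_Abelian_group T.X\<^esub> frag_embed (poly_act (gen x) m)"
      using x m by (intro T.coset_eqI T.ops.act_C mC free_algebra_closed frag_embed_C poly_act_closed gen_F
          T.cong_trans[OF T.ops.act_gen T.cong_sym[OF frag_embed_lie]])
    finally show ?thesis by (simp add: embed_def res_lie_act x)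
  qed
  fix n assume "n \<in> carrier res"
  then have n: "n \<in> carrier M" by simp
  have "embed m \<oplus>\<^bsub>TM\<^esub> embed n = T.null #>\<^bsub>free_Abelian_group T.X\<^esub> (frag_embed m + frag_embed n)"
    unfolding embed_def T.tensor_module_eq
    using T.quot.add_coset[OF mC frag_embed_C[OF n]] by simp
  also have "\<dots> = embed (m \<oplus>\<^bsub>M\<^esub> n)"
    unfolding embed_def using m n
    by (intro T.coset_eqI T.C_closed(3) frag_embed_C T.cong_sym[OF frag_embed_add]) simp_all
  finally show "embed (m \<oplus>\<^bsub>res\<^esub> n) = embed m \<oplus>\<^bsub>TM\<^esub> embed n" by simp
qed

text \<open>Evaluation at the basis vector \<open>w\<close> recovers \<open>f (w m)\<close> from the image of \<open>m\<close>.\<close>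

lemma embed_zeroD:
  assumes m: "m \<in> carrier M" and z: "embed m = \<zero>\<^bsub>TM\<^esub>" and w: "w \<in> W"
  shows "f (poly_act (wd w) m) = \<zero>\<^bsub>S\<^esub>"
proof -
  have jm: "frag_embed m \<in> T.null"
    using z T.quot.coset_eq_N_iff[OF frag_embed_C[OF m]]
    unfolding embed_def T.tensor_module_eq T.quot.zero_coset_module by blast
  let ?ev = "\<lambda>s e. S.kscale (Poly_Mapping.lookup e w) s"
  have ev: "?ev s e \<in> carrier S" if "s \<in> carrier S" "e \<in> carrier dual_module" for s e
    using that by (simp add: S.kscale_closed)
  have ev_l: "?ev (s \<oplus>\<^bsub>S\<^esub> s') e = ?ev s e \<oplus>\<^bsub>S\<^esub> ?ev s' e"
    if "s \<in> carrier S" "s' \<in> carrier S" "e \<in> carrier dual_module" for s s' e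
    using that by (simp add: S.kscale_add)
  have ev_r: "?ev s (e \<oplus>\<^bsub>dual_module\<^esub> e') = ?ev s e \<oplus>\<^bsub>S\<^esub> ?ev s e'"
    if "s \<in> carrier S" "e \<in> carrier dual_module" "e' \<in> carrier dual_module" for s e e'
    using that by (simp add: S.kscale_plus lookup_add)
  have ev_b: "?ev (S.kscale c s) e = ?ev s (E.kscale c e)"
    if "s \<in> carrier S" "c \<in> UNIV" "e \<in> carrier dual_module" for s c e
    using that by (simp add: dual_kscale lookup_const_mult S.kscale_mult[symmetric] mult.commute)
  obtain h where h: "\<And>s e. s \<in> carrier S \<Longrightarrow> e \<in> carrier dual_module \<Longrightarrow> h (frag_of (s, e)) = ?ev s e"
    and h_add: "\<And>u v. u \<in> T.C \<Longrightarrow> v \<in> T.C \<Longrightarrow> h (u + v) = h u \<oplus>\<^bsub>S\<^esub> h v"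
    and h_zero: "h 0 = \<zero>\<^bsub>S\<^esub>" and h_null: "\<And>u. u \<in> T.null \<Longrightarrow> h u = \<zero>\<^bsub>S\<^esub>"
    by (rule T.balanced_lift[OF S.M.M.abelian_group_axioms, of ?ev],
        erule (1) ev, erule (2) ev_l, erule (2) ev_r, erule (2) ev_b) (rule that)
  have hgg: "h (frag_of (s, e)) = S.kscale (Poly_Mapping.lookup e w) s"
    if "s \<in> carrier S" "Poly_Mapping.keys e \<subseteq> W" for s e using h[of s e] that by simp
  have "h (frag_embed m) = \<zero>\<^bsub>S\<^esub>" using h_null[OF jm] .
  moreover have "h (\<Sum>v\<in>A. frag_of (f (poly_act (wd v) m), wd v)) = (if w \<in> A then f (poly_act (wd w) m) else \<zero>\<^bsub>S\<^esub>)"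
    if "finite A" "A \<subseteq> W" for A
    using that
  proof (induction A rule: finite_induct)
    case empty show ?case by (simp add: h_zero)
  next
    case (insert v A)
    let ?j = "\<lambda>v. frag_of (f (poly_act (wd v) m), wd v)"
    have C: "?j u \<in> T.C" if "u \<in> W" for u using that fw_closed[OF that m] by simp
    have "h (?j v + sum ?j A) = h (?j v) \<oplus>\<^bsub>S\<^esub> h (sum ?j A)"
      using insert.prems C by (intro h_add sum_C) auto
    moreover have "h (?j v) = (if v = w then f (poly_act (wd w) m) else \<zero>\<^bsub>S\<^esub>)"
    proof -
      have "h (?j v) = S.kscale (Poly_Mapping.lookup (wd v) w) (f (poly_act (wd v) m))"
        using insert.prems fw_closed[of v m] m by (intro hgg) auto
      moreover have "S.kscale 0 s = \<zero>\<^bsub>S\<^esub>" if "s \<in> carrier S" for s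
        using that S.kscale_plus[OF that, of 0 0] S.kscale_closed[OF that, of 0]
        by (metis S.M.M.add.r_cancel_one add.right_neutral)
      ultimately show ?thesis
        using insert.prems fw_closed[of v m] m by (auto simp: lookup_single when_def S.kscale_one)
    qed
    ultimately show ?case
      using insert fw_closed[OF w m] by (auto simp: S.M.M.zero_closed)
  qed
  ultimately show ?thesis using finite_W w unfolding frag_embed_def by force
qed

end

section \<open>Simple submodules of the restriction\<close>

lemma (in lie_superalgebra) exists_odd_spanned:
  assumes "finite_dimensional L" shows "\<exists>b. odd_spanned L b"
proof -
  obtain B where B: "finite B" "superspace L = span B"
    using assms by (auto simp: finite_dimensional_def)
  obtain b where b: "b \<subseteq> part L 1" "independent b" "part L 1 \<subseteq> span b"
    by (rule maximal_independent_subset)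
  have "b \<subseteq> span B" using b(1) part_superspace B(2) by blast
  then have "finite b" using independent_span_bound[OF B(1) b(2)] by simp
  then have "odd_spanned L b" using b by unfold_locales
  then show ?thesis by blast
qed

context lie_superalgebra begin

abbreviation "finite_type_tensor_socles \<equiv>
  \<forall>(S :: (('a, 'b) env, ('a, 'b) free_algebra) module) (E :: (('a, 'b) env, ('a, 'b) free_algebra) module).
    simple_module (env_even L) S \<and> left_module (env_even L) E \<and>
    env_finite_dimensional (even_subalgebra L) E \<longrightarrow>
    finite_type_socle (env_even L) (tensor_module (even_subalgebra L) S E)"

end

context env_module begin

text \<open>
  The restriction of \<open>M\<close> is finitely generated and so has a simple quotient \<open>S\<close> by a maximal
  submodule \<open>K\<close>. The map \<open>embed\<close> to \<open>S \<otimes> V\<^sup>*\<close> is injective as soon as \<open>K\<close> contains no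
  orbit of a non-zero vector.
\<close>

lemma restriction_has_simple_submodule:
  assumes fd: "finite_dimensional L"
    and socle: finite_type_tensor_socles
    and K0: "submodule K0 (env_even L) res" "K0 \<noteq> carrier M"
    and m0: "m0 \<in> carrier M" "\<And>x. x \<in> carrier M \<Longrightarrow> \<exists>p\<in>F. x = poly_act p m0"
    and no_orbit: "\<And>K m. submodule K (env_even L) res \<Longrightarrow> K0 \<subseteq> K \<Longrightarrow> K \<noteq> carrier M \<Longrightarrow>
      m \<in> carrier M \<Longrightarrow> (\<And>p. p \<in> F \<Longrightarrow> poly_act p m \<in> K) \<Longrightarrow> m = \<zero>\<^bsub>M\<^esub>"
    and N: "submodule N (env_even L) res" "N \<noteq> {\<zero>\<^bsub>M\<^esub>}"
  shows "\<exists>P. submodule P (env_even L) res \<and> P \<subseteq> N \<and> simple_module (env_even L) (res\<lparr>carrier := P\<rparr>)"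
proof -
  obtain b where "odd_spanned L b" using exists_odd_spanned[OF fd] by blast
  then interpret B: odd_spanned L b .
  obtain W where "word_basis L b W" using B.exists_word_basis by blast
  then interpret W: word_basis L b W .
  interpret MW: module_with_word_basis L b W M
    by (intro module_with_word_basis.intro W.word_basis_axioms env_module_axioms)
  have "\<exists>K. submodule K (env_even L) res \<and> K0 \<subseteq> K \<and> K \<noteq> carrier res \<and>
      (\<forall>N. submodule N (env_even L) res \<and> K \<subseteq> N \<longrightarrow> N = K \<or> N = carrier res)"
  proof (rule R.M.exists_maximal_submodule)
    show "finite ((\<lambda>w. poly_act (W.wd w) m0) ` W)" using W.finite_W by simp
    show "(\<lambda>w. poly_act (W.wd w) m0) ` W \<subseteq> carrier res" using m0(1) W.wd_F by (auto intro!: poly_act_closed)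
    fix N assume N: "submodule N (env_even L) res" and WN: "(\<lambda>w. poly_act (W.wd w) m0) ` W \<subseteq> N"
    have wN: "poly_act (W.wd w) m0 \<in> N" if "w \<in> W" for w using WN that by (simp add: image_subset_iff)
    have pN: "poly_act p m0 \<in> N" if "p \<in> F" for p
      by (rule MW.even_submodule_contains_orbit[OF N m0(1) wN that])
    have "x \<in> N" if x: "x \<in> carrier M" for x
    proof -
      obtain p where "p \<in> F" "x = poly_act p m0" using m0(2)[OF x] by (elim bexE)
      then show ?thesis using pN by simp
    qed
    moreover have "N \<subseteq> carrier res" using N by (simp add: R.M.submodule_iff)
    ultimately show "N = carrier res" by (simp add: subset_antisym subset_iff)
  qed (use K0 in simp_all)
  then obtain K where K: "submodule K (env_even L) res" "K0 \<subseteq> K" "K \<noteq> carrier res"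
    and max: "\<And>N. submodule N (env_even L) res \<Longrightarrow> K \<subseteq> N \<Longrightarrow> N = K \<or> N = carrier res" by auto
  have quotient: "\<exists>(S :: (('k, 's) env, 'm set) module) f. simple_module (env_even L) S \<and>
      f \<in> left_module_hom (env_even L) res S \<and> f ` carrier res = carrier S \<and>
      (\<forall>x\<in>carrier res. f x = \<zero>\<^bsub>S\<^esub> \<longleftrightarrow> x \<in> K)"
    by (rule R.M.simple_quotient[OF K(1,3)]) (rule max)
  obtain S0 :: "(('k, 's) env, 'm set) module" and f0 where S0: "simple_module (env_even L) S0"
    and f0: "f0 \<in> left_module_hom (env_even L) res S0"
    and "f0 ` carrier res = carrier S0"
    and ker0: "\<forall>x\<in>carrier res. f0 x = \<zero>\<^bsub>S0\<^esub> \<longleftrightarrow> x \<in> K"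
    using quotient by (elim exE conjE) (rule that)
  obtain S :: "(('k, 's) env, ('k, 's) free_algebra) module" and g where S: "simple_module (env_even L) S"
    and g: "g \<in> left_module_hom (env_even L) S0 S" and bij: "bij_betw g (carrier S0) (carrier S)"
    using simple_module_on_free_algebra[OF S0] by (elim exE conjE) (rule that)
  have lS0: "left_module (env_even L) S0" and lS: "left_module (env_even L) S"
    using S0 S by (simp_all add: simple_module_def)
  let ?f = "\<lambda>x. g (f0 x)"
  have f: "?f \<in> left_module_hom (env_even L) res S"
    using left_module_homD[OF f0] left_module_homD[OF g] unfolding left_module_hom_def hom_def by auto
  interpret S0: left_module "env_even L" S0 by (rule lS0)
  have ker: "?f x = \<zero>\<^bsub>S\<^esub> \<longleftrightarrow> x \<in> K" if x: "x \<in> carrier M" for x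
  proof -
    have "?f x = \<zero>\<^bsub>S\<^esub> \<longleftrightarrow> g (f0 x) = g \<zero>\<^bsub>S0\<^esub>" using left_module_hom_zero[OF lS0 lS g] by simp
    also have "\<dots> \<longleftrightarrow> f0 x = \<zero>\<^bsub>S0\<^esub>"
      using bij left_module_homD(1)[OF f0, of x] x by (auto simp: bij_betw_def dest: inj_onD)
    finally show ?thesis using ker0 x by simp
  qed
  interpret C: coinduced L b W M S ?f
    by (intro coinduced.intro MW.module_with_word_basis_axioms even_module.intro
        lie_superalgebra_axioms lS coinduced_axioms.intro f)
  show ?thesis
  proof (rule injective_hom_reflects_simple_submodule[OF left_module_res _ C.embed_hom,
        simplified res_simps])
    show "left_module (env_even L) C.TM" by (rule C.T.tensor_module_left_module)
    show "finite_type_socle (env_even L) C.TM"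
      by (intro socle[rule_format] conjI S W.left_module_dual W.dual_finite_dimensional)
    fix m assume m: "m \<in> carrier M" "C.embed m = \<zero>\<^bsub>C.TM\<^esub>"
    have "poly_act (W.wd w) m \<in> K" if "w \<in> W" for w
      using C.embed_zeroD[OF m that] ker[OF poly_act_closed[OF W.wd_F[OF that] m(1)]] by simp
    then have "poly_act p m \<in> K" if "p \<in> F" for p
      by (rule MW.even_submodule_contains_orbit[OF K(1) m(1) _ that])
    then show "m = \<zero>\<^bsub>M\<^esub>" using no_orbit[OF K(1,2)] K(3) m(1) by simp
  qed (use N in simp_all)
qed

end

section \<open>Induced modules\<close>

context env_module begin

abbreviation "sub P \<equiv> res\<lparr>carrier := P\<rparr>"

text \<open>
  The adjoint of the inclusion of an even submodule \<open>P\<close>. An induced module is additively generated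
  by pure tensors, whence the last but one property of its image.
\<close>

lemma induced_hom:
  assumes P: "submodule P (env_even L) res"
  obtains f where "f \<in> left_module_hom (env L) (env_induced L (sub P)) M"
    and "submodule (f ` carrier (env_induced L (sub P))) (env L) M"
    and "\<And>a m. a \<in> carrier (env L) \<Longrightarrow> m \<in> P \<Longrightarrow>
      induced_tensor (env L) (env_even L) (env_map L) (sub P) a m \<in> carrier (env_induced L (sub P)) \<and>
      f (induced_tensor (env L) (env_even L) (env_map L) (sub P) a m) = a \<odot>\<^bsub>M\<^esub> m"
    and "\<forall>D. \<zero>\<^bsub>M\<^esub> \<in> D \<longrightarrow> (\<forall>a\<in>carrier (env L). \<forall>m\<in>P. a \<odot>\<^bsub>M\<^esub> m \<in> D) \<longrightarrow>
      (\<forall>x\<in>D. \<forall>y\<in>D. x \<oplus>\<^bsub>M\<^esub> \<ominus>\<^bsub>M\<^esub> y \<in> D) \<longrightarrow> f ` carrier (env_induced L (sub P)) \<subseteq> D"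
    and "abelian_group (env_induced L (sub P))"
proof -
  note env_map_closed = ring_hom_closed[OF env_map_hom]
  let ?act = "\<lambda>a. frag_extend (\<lambda>(b, m). frag_of (a \<otimes>\<^bsub>env L\<^esub> b, m))"
  have PM: "P \<subseteq> carrier M" using P by (simp add: R.M.submodule_iff)
  interpret P: left_module "env_even L" "sub P" by (rule R.M.left_module_submodule[OF P])
  interpret B: balanced_tensor "env L" "sub P" "carrier (env_even L)"
      "\<lambda>a u. a \<otimes>\<^bsub>env L\<^esub> env_map L u" "\<lambda>u m. u \<odot>\<^bsub>sub P\<^esub> m"
    using P.smult_closed
    by (intro balanced_tensor.intro balanced_tensor_axioms.intro M.R.abelian_group_axioms
        P.M.abelian_group_axioms) (simp_all add: env_map_closed)
  let ?G = "free_Abelian_group B.X"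
  have fC: "frag_of (a, m) \<in> B.C" if "a \<in> carrier (env L)" "m \<in> P" for a m using that by simp
  have bal: "a \<odot>\<^bsub>M\<^esub> m \<in> carrier M" if "a \<in> carrier (env L)" "m \<in> carrier (sub P)" for a m
    using that PM by (auto intro: M.smult_closed)
  have bal_l: "(a \<oplus>\<^bsub>env L\<^esub> a') \<odot>\<^bsub>M\<^esub> m = a \<odot>\<^bsub>M\<^esub> m \<oplus>\<^bsub>M\<^esub> a' \<odot>\<^bsub>M\<^esub> m"
    if "a \<in> carrier (env L)" "a' \<in> carrier (env L)" "m \<in> carrier (sub P)" for a a' m
    using that PM by (auto intro: M.smult_l_distr)
  have bal_r: "a \<odot>\<^bsub>M\<^esub> (m \<oplus>\<^bsub>sub P\<^esub> m') = a \<odot>\<^bsub>M\<^esub> m \<oplus>\<^bsub>M\<^esub> a \<odot>\<^bsub>M\<^esub> m'"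
    if "a \<in> carrier (env L)" "m \<in> carrier (sub P)" "m' \<in> carrier (sub P)" for a m m'
    using that PM by (auto intro!: M.smult_r_distr)
  have bal_b: "(a \<otimes>\<^bsub>env L\<^esub> env_map L u) \<odot>\<^bsub>M\<^esub> m = a \<odot>\<^bsub>M\<^esub> (u \<odot>\<^bsub>sub P\<^esub> m)"
    if "a \<in> carrier (env L)" "u \<in> carrier (env_even L)" "m \<in> carrier (sub P)" for a u m
    using that PM env_map_closed by (auto intro!: M.smult_assoc)
  obtain h where h: "h \<in> hom ?G (add_monoid M)"
    and hgen': "\<And>a m. a \<in> carrier (env L) \<Longrightarrow> m \<in> carrier (sub P) \<Longrightarrow> h (frag_of (a, m)) = a \<odot>\<^bsub>M\<^esub> m"
    and h_add: "\<And>u v. u \<in> B.C \<Longrightarrow> v \<in> B.C \<Longrightarrow> h (u + v) = h u \<oplus>\<^bsub>M\<^esub> h v"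
    and h_minus: "\<And>u v. u \<in> B.C \<Longrightarrow> v \<in> B.C \<Longrightarrow> h (u - v) = h u \<oplus>\<^bsub>M\<^esub> \<ominus>\<^bsub>M\<^esub> h v"
    and h_closed: "\<And>u. u \<in> B.C \<Longrightarrow> h u \<in> carrier M"
    and h_zero: "h 0 = \<zero>\<^bsub>M\<^esub>" and hnull: "\<And>u. u \<in> B.null \<Longrightarrow> h u = \<zero>\<^bsub>M\<^esub>"
    by (rule B.balanced_lift[OF M.M.abelian_group_axioms, of "\<lambda>a m. a \<odot>\<^bsub>M\<^esub> m"],
        erule (1) bal, erule (2) bal_l, erule (2) bal_r, erule (2) bal_b) (rule that)
  have hgen: "h (frag_of (a, m)) = a \<odot>\<^bsub>M\<^esub> m" if "a \<in> carrier (env L)" "m \<in> P" for a m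
    using that by (intro hgen') simp_all
  let ?Ind = "env_induced L (sub P)"
  have Ind: "?Ind = coset_module ?G B.null ?act"
    unfolding induced_module_def presented_module_eq_coset_module B.null_def induced_null_def by simp
  have tensor: "induced_tensor (env L) (env_even L) (env_map L) (sub P) a m = B.null #>\<^bsub>?G\<^esub> frag_of (a, m)" for a m
    unfolding induced_tensor_def B.null_def induced_null_def by simp
  have actC: "?act a g \<in> carrier ?G \<and> h (?act a g) = a \<odot>\<^bsub>M\<^esub> h g" if a: "a \<in> carrier (env L)" and g: "g \<in> carrier ?G" for a g
  proof -
    have "Poly_Mapping.keys g \<subseteq> B.X" using g by simp
    then have "g \<in> carrier ?G \<and> ?act a g \<in> carrier ?G \<and> h (?act a g) = a \<odot>\<^bsub>M\<^esub> h g"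
    proof (induction g rule: frag_induction)
      case zero then show ?case using a by (simp add: h_zero M.smult_zero_right)
    next
      case (one x)
      then obtain b m where x: "x = (b, m)" "b \<in> carrier (env L)" "m \<in> P" by auto
      then show ?case using a PM fC by (simp add: hgen M.smult_assoc subset_iff)
    next
      case (diff u v)
      have "\<ominus>\<^bsub>M\<^esub> (a \<odot>\<^bsub>M\<^esub> h v) = a \<odot>\<^bsub>M\<^esub> (\<ominus>\<^bsub>M\<^esub> h v)"
      proof (rule M.M.minus_equality)
        show "a \<odot>\<^bsub>M\<^esub> (\<ominus>\<^bsub>M\<^esub> h v) \<oplus>\<^bsub>M\<^esub> a \<odot>\<^bsub>M\<^esub> h v = \<zero>\<^bsub>M\<^esub>"
          using a h_closed[of v] diff by (simp add: M.smult_r_distr[symmetric] M.M.l_neg M.smult_zero_right)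
      qed (use a h_closed[of v] diff in \<open>simp_all add: M.smult_closed\<close>)
      then show ?case using diff a B.C_closed h_closed
        by (simp del: carrier_free_Abelian_group_iff add: frag_extend_diff h_minus M.smult_r_distr)
    qed
    then show ?thesis by blast
  qed
  define f where "f A = h (rep A)" for A
  have f_proj: "f (B.null #>\<^bsub>?G\<^esub> g) = h g" if "g \<in> carrier ?G" for g
    unfolding f_def by (rule B.quot.coset_lift(1)[OF M.M.abelian_group_axioms h hnull that])
  have f_hom: "f \<in> hom (add_monoid ?Ind) (add_monoid M)"
    using B.quot.coset_lift(2)[OF M.M.abelian_group_axioms h hnull] unfolding Ind f_def[abs_def] by blast
  have f_smult: "a \<odot>\<^bsub>?Ind\<^esub> A \<in> carrier ?Ind \<and> f (a \<odot>\<^bsub>?Ind\<^esub> A) = a \<odot>\<^bsub>M\<^esub> f A"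
    if a: "a \<in> carrier (env L)" and A: "A \<in> carrier ?Ind" for a A
  proof -
    obtain g where g: "g \<in> carrier ?G" "A = B.null #>\<^bsub>?G\<^esub> g" using A unfolding Ind by (rule B.quot.cosetE)
    have r: "rep A \<in> carrier ?G" unfolding g(2) by (rule B.quot.rep_coset(1)[OF g(1)])
    have s: "a \<odot>\<^bsub>?Ind\<^esub> A = B.null #>\<^bsub>?G\<^esub> ?act a (rep A)" unfolding Ind by (simp only: coset_module_def module.select_convs)
    have aC: "?act a (rep A) \<in> B.C" and hA: "h (?act a (rep A)) = a \<odot>\<^bsub>M\<^esub> h (rep A)"
      using actC[OF a r] by blast+
    have "B.null #>\<^bsub>?G\<^esub> ?act a (rep A) \<in> carrier ?Ind" unfolding Ind by (rule B.quot.coset_closed[OF aC])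
    moreover have "f (B.null #>\<^bsub>?G\<^esub> ?act a (rep A)) = a \<odot>\<^bsub>M\<^esub> f A"
      unfolding f_proj[OF aC] hA by (simp only: f_def)
    ultimately show ?thesis unfolding s by blast
  qed
  have f_mod: "f \<in> left_module_hom (env L) ?Ind M"
    using f_hom f_smult by (auto simp: left_module_hom_def)
  have im: "f ` carrier ?Ind = h ` carrier ?G"
  proof
    show "f ` carrier ?Ind \<subseteq> h ` carrier ?G"
    proof
      fix x assume "x \<in> f ` carrier ?Ind"
      then obtain A where A: "A \<in> carrier ?Ind" "x = f A" by auto
      then obtain g where "g \<in> carrier ?G" "A = B.null #>\<^bsub>?G\<^esub> g" unfolding Ind by (elim B.quot.cosetE)
      then show "x \<in> h ` carrier ?G" using f_proj A(2) by blast
    qed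
    show "h ` carrier ?G \<subseteq> f ` carrier ?Ind"
    proof
      fix x assume "x \<in> h ` carrier ?G"
      then obtain g where g: "g \<in> carrier ?G" "x = h g" by auto
      then have "B.null #>\<^bsub>?G\<^esub> g \<in> carrier ?Ind" unfolding Ind by (intro B.quot.coset_closed)
      then show "x \<in> f ` carrier ?Ind" using f_proj[OF g(1)] g(2) by force
    qed
  qed
  have im_sub: "submodule (f ` carrier ?Ind) (env L) M"
    unfolding im M.submodule_iff
  proof (intro conjI ballI)
    show "h ` carrier ?G \<subseteq> carrier M" using h_closed by blast
    show "\<zero>\<^bsub>M\<^esub> \<in> h ` carrier ?G" using h_zero by (intro image_eqI[of _ _ 0]) simp_all
  next
    fix x y assume "x \<in> h ` carrier ?G" "y \<in> h ` carrier ?G"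
    then obtain u v where uv: "u \<in> carrier ?G" "x = h u" "v \<in> carrier ?G" "y = h v" by blast
    then show "x \<oplus>\<^bsub>M\<^esub> y \<in> h ` carrier ?G"
      unfolding uv(2,4) h_add[OF uv(1,3), symmetric] by (intro imageI B.C_closed(3))
  next
    fix a x assume a: "a \<in> carrier (env L)" and "x \<in> h ` carrier ?G"
    then obtain u where u: "u \<in> carrier ?G" "x = h u" by blast
    then show "a \<odot>\<^bsub>M\<^esub> x \<in> h ` carrier ?G"
      unfolding u(2) actC[OF a u(1), THEN conjunct2, symmetric]
      by (intro imageI actC[OF a u(1), THEN conjunct1])
  qed
  show thesis
  proof (rule that[OF f_mod im_sub])
    fix a m assume am: "a \<in> carrier (env L)" "m \<in> P"
    show "induced_tensor (env L) (env_even L) (env_map L) (sub P) a m \<in> carrier ?Ind \<and>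
        f (induced_tensor (env L) (env_even L) (env_map L) (sub P) a m) = a \<odot>\<^bsub>M\<^esub> m"
      unfolding tensor f_proj[OF fC[OF am]] hgen[OF am] unfolding Ind using B.quot.coset_closed[OF fC[OF am]] by blast
  next
    show "\<forall>D. \<zero>\<^bsub>M\<^esub> \<in> D \<longrightarrow> (\<forall>a\<in>carrier (env L). \<forall>m\<in>P. a \<odot>\<^bsub>M\<^esub> m \<in> D) \<longrightarrow>
      (\<forall>x\<in>D. \<forall>y\<in>D. x \<oplus>\<^bsub>M\<^esub> \<ominus>\<^bsub>M\<^esub> y \<in> D) \<longrightarrow> f ` carrier ?Ind \<subseteq> D"
    proof (intro allI impI subsetI)
      fix D x assume D0: "\<zero>\<^bsub>M\<^esub> \<in> D" and gen: "\<forall>a\<in>carrier (env L). \<forall>m\<in>P. a \<odot>\<^bsub>M\<^esub> m \<in> D"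
        and D_diff: "\<forall>x\<in>D. \<forall>y\<in>D. x \<oplus>\<^bsub>M\<^esub> \<ominus>\<^bsub>M\<^esub> y \<in> D" and x: "x \<in> f ` carrier ?Ind"
      obtain g where g: "g \<in> carrier ?G" "x = h g" using x unfolding im by blast
      have "Poly_Mapping.keys g \<subseteq> B.X" using g(1) by simp
      then have "g \<in> carrier ?G \<and> h g \<in> D"
      proof (induction g rule: frag_induction)
        case zero show ?case using D0 h_zero by simp
      next
        case (one y)
        then obtain a m where y: "y = (a, m)" "a \<in> carrier (env L)" "m \<in> P" by auto
        show ?case unfolding y(1) using fC[OF y(2,3)] gen y(2,3) hgen[OF y(2,3)] by (simp del: carrier_free_Abelian_group_iff)
      next
        case (diff u v)
        then have uv: "u \<in> carrier ?G" "v \<in> carrier ?G" "h u \<in> D" "h v \<in> D" by blast+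
        then show ?case using h_minus[OF uv(1,2)] B.C_closed(4)[OF uv(1,2)] D_diff by (simp del: carrier_free_Abelian_group_iff)
      qed
      then show "x \<in> D" using g(2) by simp
    qed
  next
    show "abelian_group ?Ind" unfolding Ind by (rule B.quot.abelian_group_coset_module)
  qed
qed

end

section \<open>Gradings\<close>

context lie_superalgebra begin

definition homogeneous :: "bit \<Rightarrow> ('a, 'b) free_algebra set"
  where "homogeneous i = {p. \<forall>w\<in>Poly_Mapping.keys p. \<exists>ds.
    list_all2 (\<lambda>x d. x \<in> part L d) (letters w) ds \<and> sum_list ds = i}"

lemma env_part_eq: "env_part L i = env_class L ` homogeneous i"
  by (simp add: env_part_def homogeneous_def)

lemma homogeneous_F: "homogeneous i \<subseteq> F"
proof
  fix p assume p: "p \<in> homogeneous i"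
  have "set xs \<subseteq> superspace L" if "list_all2 (\<lambda>x d. x \<in> part L d) xs ds" for xs ds
    using that by (induction rule: list_all2_induct) (auto intro: part_superspace)
  then show "p \<in> F" using p unfolding homogeneous_def mem_free_algebra_iff by blast
qed

lemma homogeneous_zero: "0 \<in> homogeneous i"
  by (simp add: homogeneous_def)

lemma homogeneous_add: "p \<in> homogeneous i \<Longrightarrow> q \<in> homogeneous i \<Longrightarrow> p + q \<in> homogeneous i"
  using Poly_Mapping.keys_add[of p q] unfolding homogeneous_def by blast

lemma homogeneous_const: "const c \<in> homogeneous 0"
  by (auto simp: homogeneous_def const_def zero_monomial_def split: if_splits)

lemma homogeneous_gen_mult:
  assumes x: "x \<in> part L d" and p: "p \<in> homogeneous i"
  shows "gen x * p \<in> homogeneous (d + i)"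
  unfolding homogeneous_def
proof (intro CollectI ballI)
  fix w assume "w \<in> Poly_Mapping.keys (gen x * p)"
  then obtain v where v: "v \<in> Poly_Mapping.keys p" "w = Monomial (x # letters v)"
    using keys_mult[of "gen x" p] by (auto simp: gen_def plus_monomial_def)
  then obtain ds where "list_all2 (\<lambda>x d. x \<in> part L d) (letters v) ds" "sum_list ds = i"
    using p by (auto simp: homogeneous_def)
  then show "\<exists>ds. list_all2 (\<lambda>x d. x \<in> part L d) (letters w) ds \<and> sum_list ds = d + i"
    using x v(2) by (intro exI[of _ "d # ds"]) simp
qed

text \<open>
  Letters need not be homogeneous: \<open>x = y + z\<close> with \<open>y\<close> even and \<open>z\<close> odd, and \<open>gen x\<close> is congruent to
  \<open>gen y + gen z\<close>.
\<close>

lemma homogeneous_decomposition: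
  assumes "p \<in> F"
  shows "\<exists>q\<in>homogeneous 0. \<exists>r\<in>homogeneous 1. p - (q + r) \<in> I"
  using assms
proof (induction p rule: free_algebra_induct)
  case (const c)
  show ?case
    using homogeneous_const homogeneous_zero I_zero
    by (intro bexI[of _ "const c"] bexI[of _ 0]) simp_all
next
  case (add p p')
  then obtain q r q' r' where *: "q \<in> homogeneous 0" "r \<in> homogeneous 1" "p - (q + r) \<in> I"
    "q' \<in> homogeneous 0" "r' \<in> homogeneous 1" "p' - (q' + r') \<in> I" by blast
  have "(p + p') - ((q + q') + (r + r')) = (p - (q + r)) + (p' - (q' + r'))" by simp
  also have "\<dots> \<in> I" using * by (intro I_add)
  finally show ?case using * by (intro bexI[of _ "q + q'"] bexI[of _ "r + r'"] homogeneous_add)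
next
  case (gen x p)
  then obtain q r where qr: "q \<in> homogeneous 0" "r \<in> homogeneous 1" "p - (q + r) \<in> I" by blast
  obtain y z where yz: "x = y + z" "y \<in> part L 0" "z \<in> part L 1"
    using gen(1) by (auto simp: superspace_def)
  have "gen x * p - ((gen y * q + gen z * r) + (gen y * r + gen z * q)) =
      (gen (y + z) - (gen y + gen z)) * p + (gen y + gen z) * (p - (q + r))"
    by (simp add: yz(1) algebra_simps)
  also have "\<dots> \<in> I"
    using qr gen(2) by (intro I_add I_rmult I_lmult gen_add_I free_algebra_closed(5)
        gen_F[OF yz(2)] gen_F[OF yz(3)] part_superspace[OF yz(2)] part_superspace[OF yz(3)])
  finally show ?case
    using homogeneous_gen_mult[OF yz(2) qr(1)] homogeneous_gen_mult[OF yz(3) qr(2)]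
      homogeneous_gen_mult[OF yz(2) qr(2)] homogeneous_gen_mult[OF yz(3) qr(1)]
    by (intro bexI[of _ "gen y * q + gen z * r"] bexI[of _ "gen y * r + gen z * q"] homogeneous_add) simp_all
qed

lemma env_part_closed: "env_part L i \<subseteq> carrier (env L)"
  unfolding env_part_eq using homogeneous_F env_class_in by blast

lemma env_part_decomposition:
  assumes "a \<in> carrier (env L)"
  shows "\<exists>u\<in>env_part L 0. \<exists>v\<in>env_part L 1. a = u \<oplus>\<^bsub>env L\<^esub> v"
proof -
  obtain p where p: "p \<in> F" "a = env_class L p" using assms by (rule env_carrierE)
  obtain q r where qr: "q \<in> homogeneous 0" "r \<in> homogeneous 1" "p - (q + r) \<in> I"
    using homogeneous_decomposition[OF p(1)] by blast
  have F: "q \<in> F" "r \<in> F" using qr homogeneous_F by auto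
  have "a = env_class L q \<oplus>\<^bsub>env L\<^esub> env_class L r"
    unfolding p(2) env_class_add[OF F, symmetric]
    by (intro env_class_eqI free_algebra_closed(5) F p qr)
  then show ?thesis using qr unfolding env_part_eq by blast
qed

lemma F0_homogeneous: "F0 \<subseteq> homogeneous 0"
proof
  fix p assume "p \<in> F0"
  then show "p \<in> homogeneous 0"
  proof (induction p rule: free_algebra_induct)
    case (gen x p)
    then show ?case using homogeneous_gen_mult[of x 0 p 0] by simp
  qed (simp_all add: homogeneous_const homogeneous_add)
qed

lemma env_map_env_part:
  assumes "u \<in> env_part (even_subalgebra L) i" shows "env_map L u \<in> env_part L i"
proof -
  interpret L0: lie_superalgebra "even_subalgebra L" by (rule lie_superalgebra_even)
  obtain p where p: "p \<in> L0.homogeneous i" "u = env_class (even_subalgebra L) p"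
    using assms unfolding L0.env_part_eq by blast
  have pF: "p \<in> F0" using p(1) L0.homogeneous_F by auto
  have "p \<in> homogeneous i"
    unfolding homogeneous_def
  proof (intro CollectI ballI)
    fix w assume "w \<in> Poly_Mapping.keys p"
    then obtain ds where "list_all2 (\<lambda>x d. x \<in> part (even_subalgebra L) d) (letters w) ds" "sum_list ds = i"
      using p(1) by (auto simp: L0.homogeneous_def)
    moreover from this(1) have "list_all2 (\<lambda>x d. x \<in> part L d) (letters w) ds"
      by (rule list_all2_mono) (rule part_even_subset)
    ultimately show "\<exists>ds. list_all2 (\<lambda>x d. x \<in> part L d) (letters w) ds \<and> sum_list ds = i" by blast
  qed
  then show ?thesis unfolding p(2) env_map_class[OF pF] env_part_eq by blast
qed

end

(* The degrees i and i + 1 are the two parities, whichever of them i is; sums of degrees stay sums. *)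
declare add_bit_eq_xor [simp del]

locale graded_env_module = env_module L M
  for L :: "('k::field, 's::ab_group_add) superalgebra" and M :: "(('k, 's) env, 'm) module" +
  fixes G :: "bit \<Rightarrow> 'm set"
  assumes graded: "graded_module (env L) (env_part L) M G"
begin

lemma G_subgroup: "subgroup (G i) (add_monoid M)"
  using graded by (simp add: graded_module_def group_grading_def)

lemma G_closed:
  shows G_carrier: "x \<in> G i \<Longrightarrow> x \<in> carrier M"
    and G_zero: "\<zero>\<^bsub>M\<^esub> \<in> G i"
    and G_add: "x \<in> G i \<Longrightarrow> y \<in> G i \<Longrightarrow> x \<oplus>\<^bsub>M\<^esub> y \<in> G i"
    and G_minus: "x \<in> G i \<Longrightarrow> \<ominus>\<^bsub>M\<^esub> x \<in> G i"
  using subgroup.mem_carrier[OF G_subgroup, of x i] subgroup.one_closed[OF G_subgroup, of i]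
    subgroup.m_closed[OF G_subgroup, of x i y] subgroup.m_inv_closed[OF G_subgroup, of x i]
  by (simp_all add: a_inv_def)

lemma G_smult: "a \<in> env_part L i \<Longrightarrow> x \<in> G j \<Longrightarrow> a \<odot>\<^bsub>M\<^esub> x \<in> G (i + j)"
  using graded by (simp add: graded_module_def)

lemma G_Int: "x \<in> G i \<Longrightarrow> x \<in> G (i + 1) \<Longrightarrow> x = \<zero>\<^bsub>M\<^esub>"
proof -
  have "G 0 \<inter> G 1 = {\<zero>\<^bsub>M\<^esub>}" using graded by (simp add: graded_module_def group_grading_def)
  then show "x \<in> G i \<Longrightarrow> x \<in> G (i + 1) \<Longrightarrow> x = \<zero>\<^bsub>M\<^esub>" by (cases i rule: bit.exhaust) auto
qed

lemma G_decomposition: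
  assumes "x \<in> carrier M" obtains y z where "y \<in> G i" "z \<in> G (i + 1)" "x = y \<oplus>\<^bsub>M\<^esub> z"
proof -
  obtain y z where yz: "y \<in> G 0" "z \<in> G 1" "x = y \<oplus>\<^bsub>M\<^esub> z"
    using assms graded unfolding graded_module_def group_grading_def by blast
  show thesis
  proof (cases i rule: bit.exhaust)
    case zero then show ?thesis using that[of y z] yz by simp
  next
    case one
    then show ?thesis using that[of z y] yz G_carrier[of y 0] G_carrier[of z 1] by (simp add: M.M.a_comm)
  qed
qed

lemma G_submodule: "submodule (G i) (env_even L) res"
  unfolding R.M.submodule_iff
proof (intro conjI ballI)
  fix u x assume u: "u \<in> carrier (env_even L)" and x: "x \<in> G i"
  obtain p where p: "p \<in> F0" "u = env_class (even_subalgebra L) p"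
    using R.even.env_carrierE[OF u] by auto
  have "env_map L u \<in> env_part L 0"
    unfolding p(2) env_map_class[OF p(1)] env_part_eq using p(1) F0_homogeneous by blast
  from G_smult[OF this x] show "u \<odot>\<^bsub>res\<^esub> x \<in> G i" by (simp only: res_simps add_0_left)
qed (auto simp: G_carrier G_zero G_add)

lemma graded_submoduleI:
  assumes D: "submodule D (env L) M"
    and comp: "\<And>x. x \<in> D \<Longrightarrow> \<exists>y\<in>D \<inter> G i. \<exists>z\<in>D \<inter> G (i + 1). x = y \<oplus>\<^bsub>M\<^esub> z"
  shows "graded_submodule (env L) M G D"
  unfolding graded_submodule_def
proof (intro conjI D ballI)
  fix x assume "x \<in> D"
  then obtain y z where yz: "y \<in> D \<inter> G i" "z \<in> D \<inter> G (i + 1)" "x = y \<oplus>\<^bsub>M\<^esub> z" using comp by blast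
  show "\<exists>x0\<in>D \<inter> G 0. \<exists>x1\<in>D \<inter> G 1. x = x0 \<oplus>\<^bsub>M\<^esub> x1"
  proof (cases i rule: bit.exhaust)
    case zero then show ?thesis using yz by (intro bexI[of _ y] bexI[of _ z]) simp_all
  next
    case one
    have "x = z \<oplus>\<^bsub>M\<^esub> y"
      using yz G_carrier[of y i] G_carrier[of z "i + 1"] by (simp add: M.M.a_comm)
    then show ?thesis using yz one by (intro bexI[of _ z] bexI[of _ y]) simp_all
  qed
qed

lemma smult_homogeneous_decomposition:
  assumes a: "a \<in> carrier (env L)" and m: "m \<in> G i"
  obtains u v where "u \<in> carrier (env L)" "v \<in> carrier (env L)" "u \<odot>\<^bsub>M\<^esub> m \<in> G i" "v \<odot>\<^bsub>M\<^esub> m \<in> G (i + 1)"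
    "a \<odot>\<^bsub>M\<^esub> m = u \<odot>\<^bsub>M\<^esub> m \<oplus>\<^bsub>M\<^esub> v \<odot>\<^bsub>M\<^esub> m"
proof -
  obtain u v where uv: "u \<in> env_part L 0" "v \<in> env_part L 1" "a = u \<oplus>\<^bsub>env L\<^esub> v"
    using env_part_decomposition[OF a] by blast
  have c: "u \<in> carrier (env L)" "v \<in> carrier (env L)" using uv env_part_closed by auto
  have "u \<odot>\<^bsub>M\<^esub> m \<in> G i" "v \<odot>\<^bsub>M\<^esub> m \<in> G (i + 1)"
    using G_smult[OF uv(1) m] G_smult[OF uv(2) m] by (simp_all only: add_0_left add.commute[of 1])
  moreover have "a \<odot>\<^bsub>M\<^esub> m = u \<odot>\<^bsub>M\<^esub> m \<oplus>\<^bsub>M\<^esub> v \<odot>\<^bsub>M\<^esub> m"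
    unfolding uv(3) by (rule M.smult_l_distr[OF c G_carrier[OF m]])
  ultimately show thesis by (rule that[OF c])
qed

end

text \<open>
  If \<open>K\<close> is an even submodule containing one homogeneous component of \<open>M\<close>, the largest
  submodule of \<open>M\<close> inside \<open>K\<close> is graded.
\<close>

lemma (in graded_env_module) graded_core:
  assumes K: "submodule K (env_even L) res" and GK: "G (i + 1) \<subseteq> K"
  shows "graded_submodule (env L) M G {m \<in> carrier M. \<forall>p\<in>F. poly_act p m \<in> K}" (is "graded_submodule _ _ _ ?D")
proof (rule graded_submoduleI)
  have K': "\<zero>\<^bsub>M\<^esub> \<in> K" "\<And>x y. x \<in> K \<Longrightarrow> y \<in> K \<Longrightarrow> x \<oplus>\<^bsub>M\<^esub> y \<in> K"
    using K unfolding R.M.submodule_iff by auto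
  have Km: "\<ominus>\<^bsub>M\<^esub> x \<in> K" if "x \<in> K" for x
  proof -
    have "\<ominus>\<^bsub>res\<^esub> x \<in> K" using R.M.submodule_minus[OF K that] .
    moreover have "\<ominus>\<^bsub>res\<^esub> x = \<ominus>\<^bsub>M\<^esub> x" by (simp add: res_def a_inv_def m_inv_def)
    ultimately show ?thesis by simp
  qed
  show D: "submodule ?D (env L) M"
    unfolding submodule_iff_poly_act
  proof (intro conjI ballI)
    show "\<zero>\<^bsub>M\<^esub> \<in> ?D" using K' by (simp add: poly_act_def M.smult_zero_right env_class_in)
  next
    fix x y assume "x \<in> ?D" "y \<in> ?D"
    then show "x \<oplus>\<^bsub>M\<^esub> y \<in> ?D" using K' by (simp add: poly_act_add_right)
  next
    fix p x assume p: "p \<in> F" and x: "x \<in> ?D"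
    have "poly_act q (poly_act p x) \<in> K" if "q \<in> F" for q
      using x free_algebra_closed(6)[OF that p] poly_act_mult[OF that p, of x] by auto
    then show "poly_act p x \<in> ?D" using p x by (simp add: poly_act_closed)
  qed auto
  fix x assume x: "x \<in> ?D"
  then have "x \<in> carrier M" by simp
  then obtain y z where yz: "y \<in> G i" "z \<in> G (i + 1)" "x = y \<oplus>\<^bsub>M\<^esub> z" by (rule G_decomposition)
  have c: "y \<in> carrier M" "z \<in> carrier M" using yz G_carrier by auto
  have aK: "a \<odot>\<^bsub>M\<^esub> x \<in> K" if "a \<in> carrier (env L)" for a
    using that x by (elim env_carrierE) (simp add: poly_act_def)
  \<comment> \<open>For homogeneous \<open>a\<close>, one of \<open>a y\<close>, \<open>a z\<close> has the parity that lies in \<open>K\<close>, and so does their sum.\<close>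
  have hom: "a \<odot>\<^bsub>M\<^esub> y \<in> K \<and> a \<odot>\<^bsub>M\<^esub> z \<in> K" if a: "a \<in> env_part L d" for a d
  proof -
    have ac: "a \<in> carrier (env L)" using a env_part_closed by blast
    have cl: "a \<odot>\<^bsub>M\<^esub> y \<in> carrier M" "a \<odot>\<^bsub>M\<^esub> z \<in> carrier M" using ac c M.smult_closed by auto
    have s: "a \<odot>\<^bsub>M\<^esub> y \<oplus>\<^bsub>M\<^esub> a \<odot>\<^bsub>M\<^esub> z \<in> K" using aK[OF ac] M.smult_r_distr[OF ac c] yz(3) by simp
    have e: "a \<odot>\<^bsub>M\<^esub> y = (a \<odot>\<^bsub>M\<^esub> y \<oplus>\<^bsub>M\<^esub> a \<odot>\<^bsub>M\<^esub> z) \<oplus>\<^bsub>M\<^esub> \<ominus>\<^bsub>M\<^esub> (a \<odot>\<^bsub>M\<^esub> z)"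
      "a \<odot>\<^bsub>M\<^esub> z = (a \<odot>\<^bsub>M\<^esub> y \<oplus>\<^bsub>M\<^esub> a \<odot>\<^bsub>M\<^esub> z) \<oplus>\<^bsub>M\<^esub> \<ominus>\<^bsub>M\<^esub> (a \<odot>\<^bsub>M\<^esub> y)"
      using cl by (simp add: M.M.a_assoc M.M.r_neg)
        (use cl in \<open>subst M.M.a_comm[OF cl], simp add: M.M.a_assoc M.M.r_neg\<close>)
    show ?thesis
    proof (cases d rule: bit.exhaust)
      case zero
      then have "a \<odot>\<^bsub>M\<^esub> z \<in> G (i + 1)" using G_smult[OF a yz(2)] by (simp only: add_0_left)
      then have "a \<odot>\<^bsub>M\<^esub> z \<in> K" using GK by blast
      then show ?thesis using K'(2)[OF s Km[of "a \<odot>\<^bsub>M\<^esub> z"]] by (simp only: e(1)[symmetric])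
    next
      case one
      then have "a \<odot>\<^bsub>M\<^esub> y \<in> G (i + 1)" using G_smult[OF a yz(1)] by (simp only: add.commute[of 1])
      then have "a \<odot>\<^bsub>M\<^esub> y \<in> K" using GK by blast
      then show ?thesis using K'(2)[OF s Km[of "a \<odot>\<^bsub>M\<^esub> y"]] by (simp only: e(2)[symmetric])
    qed
  qed
  have all: "poly_act p t \<in> K" if p: "p \<in> F" and t: "t = y \<or> t = z" for p t
  proof -
    have "env_class L p \<in> carrier (env L)" using p by (rule env_class_in)
    then obtain u v where uv: "u \<in> env_part L 0" "v \<in> env_part L 1" "env_class L p = u \<oplus>\<^bsub>env L\<^esub> v"
      using env_part_decomposition by blast
    have "poly_act p t = u \<odot>\<^bsub>M\<^esub> t \<oplus>\<^bsub>M\<^esub> v \<odot>\<^bsub>M\<^esub> t"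
      unfolding poly_act_def uv(3) using uv(1,2) env_part_closed c t by (intro M.smult_l_distr) auto
    then show ?thesis using hom[OF uv(1)] hom[OF uv(2)] t K'(2) by auto
  qed
  show "\<exists>y\<in>?D \<inter> G i. \<exists>z\<in>?D \<inter> G (i + 1). x = y \<oplus>\<^bsub>M\<^esub> z"
    using all c yz by (intro bexI[of _ y] bexI[of _ z]) auto
qed

section \<open>Simple modules as quotients of induced modules\<close>

context env_module begin

abbreviation "orbit m \<equiv> (\<lambda>p. poly_act p m) ` F"

lemma orbit_eq: "orbit m = (\<lambda>a. a \<odot>\<^bsub>M\<^esub> m) ` carrier (env L)"
proof
  show "orbit m \<subseteq> (\<lambda>a. a \<odot>\<^bsub>M\<^esub> m) ` carrier (env L)" using env_class_in by (auto simp: poly_act_def)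
  show "(\<lambda>a. a \<odot>\<^bsub>M\<^esub> m) ` carrier (env L) \<subseteq> orbit m" by (auto simp: poly_act_def elim!: env_carrierE)
qed

lemma submodule_orbit: "m \<in> carrier M \<Longrightarrow> submodule (orbit m) (env L) M"
  unfolding orbit_eq by (rule M.submodule_cyclic)

lemma orbit_self: "m \<in> carrier M \<Longrightarrow> m \<in> orbit m"
  using poly_act_one[of m] by (intro image_eqI[of _ _ 1]) (simp_all add: free_algebra_closed)

end

text \<open>
  A maximal even submodule contains no orbit of a non-zero vector, since the orbit is all of \<open>M\<close>.
  The simple even submodule that exists for that reason generates \<open>M\<close>.
\<close>

lemma (in env_module) simple_module_is_quotient:
  assumes fd: "finite_dimensional L"
    and socle: finite_type_tensor_socles
    and simple: "simple_module (env L) M"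
  shows "\<exists>(P :: (('k, 's) env, 'm) module) f.
    simple_module (env_even L) P \<and> f \<in> left_module_hom (env L) (env_induced L P) M \<and>
    f ` carrier (env_induced L P) = carrier M"
proof -
  have nz: "carrier M \<noteq> {\<zero>\<^bsub>M\<^esub>}"
    and sim: "\<And>N. submodule N (env L) M \<Longrightarrow> N = {\<zero>\<^bsub>M\<^esub>} \<or> N = carrier M"
    using simple by (auto simp: simple_module_def)
  obtain m0 where m0: "m0 \<in> carrier M" "m0 \<noteq> \<zero>\<^bsub>M\<^esub>" using nz M.M.zero_closed by blast
  have "orbit m0 = carrier M" using sim[OF submodule_orbit[OF m0(1)]] orbit_self[OF m0(1)] m0(2) by auto
  then have orbit: "\<exists>p\<in>F. x = poly_act p m0" if "x \<in> carrier M" for x using that by auto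
  have "\<exists>P. submodule P (env_even L) res \<and> P \<subseteq> carrier M \<and> simple_module (env_even L) (sub P)"
  proof (rule restriction_has_simple_submodule[OF fd socle, where ?K0.0 = "{\<zero>\<^bsub>M\<^esub>}"])
    fix K m assume K: "submodule K (env_even L) res" "K \<noteq> carrier M" and m: "m \<in> carrier M" "\<And>p. p \<in> F \<Longrightarrow> poly_act p m \<in> K"
    have "orbit m \<subseteq> K" using m(2) by blast
    moreover have "K \<subseteq> carrier M" using K(1) by (simp add: R.M.submodule_iff)
    ultimately have "orbit m = {\<zero>\<^bsub>M\<^esub>}" using sim[OF submodule_orbit[OF m(1)]] K(2) by auto
    then show "m = \<zero>\<^bsub>M\<^esub>" using orbit_self[OF m(1)] by simp
  next
    show "submodule {\<zero>\<^bsub>M\<^esub>} (env_even L) res" using R.M.submodule_zero by simp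
    show "submodule (carrier M) (env_even L) res" using R.M.submodule_carrier by simp
  qed (use nz m0 orbit in auto)
  then obtain P where P: "submodule P (env_even L) res" "simple_module (env_even L) (sub P)" by blast
  obtain f where f: "f \<in> left_module_hom (env L) (env_induced L (sub P)) M"
    and im: "submodule (f ` carrier (env_induced L (sub P))) (env L) M"
    and gen: "\<And>a m. a \<in> carrier (env L) \<Longrightarrow> m \<in> P \<Longrightarrow>
      induced_tensor (env L) (env_even L) (env_map L) (sub P) a m \<in> carrier (env_induced L (sub P)) \<and>
      f (induced_tensor (env L) (env_even L) (env_map L) (sub P) a m) = a \<odot>\<^bsub>M\<^esub> m"
    by (rule induced_hom[OF P(1)]) (rule that)
  have P0: "P \<noteq> {\<zero>\<^bsub>M\<^esub>}" "\<zero>\<^bsub>M\<^esub> \<in> P" "P \<subseteq> carrier M"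
    using P(2) P(1) unfolding R.M.simple_submodule_iff[OF P(1)] R.M.submodule_iff by auto
  then obtain m where m: "m \<in> P" "m \<noteq> \<zero>\<^bsub>M\<^esub>" by blast
  have "m \<in> f ` carrier (env_induced L (sub P))"
    using gen[OF M.R.one_closed m(1)] M.smult_one[of m] m(1) P0(3) by force
  then have "f ` carrier (env_induced L (sub P)) = carrier M" using sim[OF im] m(2) by blast
  then show ?thesis using P(2) f by blast
qed

text \<open>
  If \<open>G i\<close> is non-zero, a maximal even submodule is chosen to contain the other component \<open>G (i + 1)\<close>.
  The largest submodule of \<open>M\<close> inside it is then graded, hence zero. The simple even submodule is taken
  inside \<open>G i\<close>; being concentrated in one degree, it inherits a grading from \<open>M\<close>.
\<close>

lemma (in graded_env_module) graded_simple_module_is_quotient: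
  assumes fd: "finite_dimensional L"
    and socle: finite_type_tensor_socles
    and simple: "graded_simple_module (env L) (env_part L) M G"
  shows "\<exists>(P :: (('k, 's) env, 'm) module) H f.
    simple_module (env_even L) P \<and> graded_module (env_even L) (env_part (even_subalgebra L)) P H \<and>
    f \<in> left_module_hom (env L) (env_induced L P) M \<and>
    f ` carrier (env_induced L P) = carrier M \<and>
    (\<forall>i. f ` env_induced_grading L P H i \<subseteq> G i)"
proof -
  have nz: "carrier M \<noteq> {\<zero>\<^bsub>M\<^esub>}"
    and sim: "\<And>N. graded_submodule (env L) M G N \<Longrightarrow> N = {\<zero>\<^bsub>M\<^esub>} \<or> N = carrier M"
    using simple by (auto simp: graded_simple_module_def)
  have "\<exists>i. G i \<noteq> {\<zero>\<^bsub>M\<^esub>}"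
  proof (rule ccontr)
    assume "\<not> (\<exists>i. G i \<noteq> {\<zero>\<^bsub>M\<^esub>})"
    then have z: "G i = {\<zero>\<^bsub>M\<^esub>}" for i by blast
    have "x = \<zero>\<^bsub>M\<^esub>" if "x \<in> carrier M" for x
      by (rule G_decomposition[OF that, of 0]) (simp add: z)
    then show False using nz M.M.zero_closed by blast
  qed
  then obtain i where i: "G i \<noteq> {\<zero>\<^bsub>M\<^esub>}" by blast
  then obtain m0 where m0: "m0 \<in> G i" "m0 \<noteq> \<zero>\<^bsub>M\<^esub>" using G_zero by blast
  have m0c: "m0 \<in> carrier M" using m0(1) by (rule G_carrier)
  have "graded_submodule (env L) M G (orbit m0)"
  proof (rule graded_submoduleI[OF submodule_orbit[OF m0c]])
    fix x assume "x \<in> orbit m0"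
    then obtain a where a: "a \<in> carrier (env L)" "x = a \<odot>\<^bsub>M\<^esub> m0" unfolding orbit_eq by (elim imageE) (rule that)
    obtain u v where uv: "u \<in> carrier (env L)" "v \<in> carrier (env L)" "u \<odot>\<^bsub>M\<^esub> m0 \<in> G i"
      "v \<odot>\<^bsub>M\<^esub> m0 \<in> G (i + 1)" "a \<odot>\<^bsub>M\<^esub> m0 = u \<odot>\<^bsub>M\<^esub> m0 \<oplus>\<^bsub>M\<^esub> v \<odot>\<^bsub>M\<^esub> m0"
      by (rule smult_homogeneous_decomposition[OF a(1) m0(1)])
    then have "u \<odot>\<^bsub>M\<^esub> m0 \<in> orbit m0 \<inter> G i" "v \<odot>\<^bsub>M\<^esub> m0 \<in> orbit m0 \<inter> G (i + 1)"
      unfolding orbit_eq by auto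
    then show "\<exists>y\<in>orbit m0 \<inter> G i. \<exists>z\<in>orbit m0 \<inter> G (i + 1). x = y \<oplus>\<^bsub>M\<^esub> z"
      using uv(5) a(2) by (intro bexI) simp_all
  qed
  then have "orbit m0 = carrier M" using sim orbit_self[OF m0c] m0(2) by auto
  then have orbit: "\<exists>p\<in>F. x = poly_act p m0" if "x \<in> carrier M" for x using that by auto
  have "\<exists>P. submodule P (env_even L) res \<and> P \<subseteq> G i \<and> simple_module (env_even L) (sub P)"
  proof (rule restriction_has_simple_submodule[OF fd socle, where ?K0.0 = "G (i + 1)"])
    show "G (i + 1) \<noteq> carrier M" using G_Int[OF m0(1)] m0(2) m0c by blast
    fix K m assume K: "submodule K (env_even L) res" "G (i + 1) \<subseteq> K" "K \<noteq> carrier M"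
      and m: "m \<in> carrier M" "\<And>p. p \<in> F \<Longrightarrow> poly_act p m \<in> K"
    let ?D = "{m \<in> carrier M. \<forall>p\<in>F. poly_act p m \<in> K}"
    have "?D \<subseteq> K" using poly_act_one free_algebra_closed(2) by fastforce
    moreover have "K \<subseteq> carrier M" using K(1) by (simp add: R.M.submodule_iff)
    ultimately have "?D = {\<zero>\<^bsub>M\<^esub>}" using sim[OF graded_core[OF K(1,2)]] K(3) by blast
    then show "m = \<zero>\<^bsub>M\<^esub>" using m by blast
  qed (use i m0c orbit G_submodule in auto)
  then obtain P where P: "submodule P (env_even L) res" "P \<subseteq> G i" "simple_module (env_even L) (sub P)" by blast
  obtain f where f: "f \<in> left_module_hom (env L) (env_induced L (sub P)) M"
    and im: "submodule (f ` carrier (env_induced L (sub P))) (env L) M"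
    and gen: "\<And>a m. a \<in> carrier (env L) \<Longrightarrow> m \<in> P \<Longrightarrow>
      induced_tensor (env L) (env_even L) (env_map L) (sub P) a m \<in> carrier (env_induced L (sub P)) \<and>
      f (induced_tensor (env L) (env_even L) (env_map L) (sub P) a m) = a \<odot>\<^bsub>M\<^esub> m"
    and ind: "\<forall>D. \<zero>\<^bsub>M\<^esub> \<in> D \<longrightarrow> (\<forall>a\<in>carrier (env L). \<forall>m\<in>P. a \<odot>\<^bsub>M\<^esub> m \<in> D) \<longrightarrow>
      (\<forall>x\<in>D. \<forall>y\<in>D. x \<oplus>\<^bsub>M\<^esub> \<ominus>\<^bsub>M\<^esub> y \<in> D) \<longrightarrow> f ` carrier (env_induced L (sub P)) \<subseteq> D"
    and ab: "abelian_group (env_induced L (sub P))"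
    by (rule induced_hom[OF P(1)]) (rule that)
  let ?im = "f ` carrier (env_induced L (sub P))"
  have P0: "P \<noteq> {\<zero>\<^bsub>M\<^esub>}" "\<zero>\<^bsub>M\<^esub> \<in> P" "P \<subseteq> carrier M"
    using P(3) P(1) unfolding R.M.simple_submodule_iff[OF P(1)] R.M.submodule_iff by auto
  then obtain m where m: "m \<in> P" "m \<noteq> \<zero>\<^bsub>M\<^esub>" by blast
  have imI: "a \<odot>\<^bsub>M\<^esub> m \<in> ?im" if "a \<in> carrier (env L)" "m \<in> P" for a m
    using gen[OF that] by force
  have im0: "\<zero>\<^bsub>M\<^esub> \<in> ?im" and im_add: "\<And>x y. x \<in> ?im \<Longrightarrow> y \<in> ?im \<Longrightarrow> x \<oplus>\<^bsub>M\<^esub> y \<in> ?im"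
    using im unfolding M.submodule_iff by blast+
  have "graded_submodule (env L) M G ?im"
  proof (rule graded_submoduleI[OF im])
    let ?D = "{x. \<exists>y\<in>?im \<inter> G i. \<exists>z\<in>?im \<inter> G (i + 1). x = y \<oplus>\<^bsub>M\<^esub> z}"
    have "?im \<subseteq> ?D"
    proof (rule ind[rule_format])
      have "\<zero>\<^bsub>M\<^esub> = \<zero>\<^bsub>M\<^esub> \<oplus>\<^bsub>M\<^esub> \<zero>\<^bsub>M\<^esub>" by simp
      then show "\<zero>\<^bsub>M\<^esub> \<in> ?D" using im0 G_zero by blast
    next
      fix a m assume a: "a \<in> carrier (env L)" and m: "m \<in> P"
      then have mG: "m \<in> G i" using P(2) by blast
      obtain u v where uv: "u \<in> carrier (env L)" "v \<in> carrier (env L)" "u \<odot>\<^bsub>M\<^esub> m \<in> G i"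
        "v \<odot>\<^bsub>M\<^esub> m \<in> G (i + 1)" "a \<odot>\<^bsub>M\<^esub> m = u \<odot>\<^bsub>M\<^esub> m \<oplus>\<^bsub>M\<^esub> v \<odot>\<^bsub>M\<^esub> m"
        by (rule smult_homogeneous_decomposition[OF a mG])
      then have "u \<odot>\<^bsub>M\<^esub> m \<in> ?im \<inter> G i" "v \<odot>\<^bsub>M\<^esub> m \<in> ?im \<inter> G (i + 1)"
        using imI[OF uv(1) m] imI[OF uv(2) m] by simp_all
      then show "a \<odot>\<^bsub>M\<^esub> m \<in> ?D" using uv(5) by (intro CollectI bexI)
    next
      fix x y assume "x \<in> ?D" "y \<in> ?D"
      then obtain x0 x1 y0 y1 where *: "x0 \<in> ?im" "x0 \<in> G i" "x1 \<in> ?im" "x1 \<in> G (i + 1)" "x = x0 \<oplus>\<^bsub>M\<^esub> x1"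
        "y0 \<in> ?im" "y0 \<in> G i" "y1 \<in> ?im" "y1 \<in> G (i + 1)" "y = y0 \<oplus>\<^bsub>M\<^esub> y1"
        by (elim CollectE bexE IntE) (rule that)
      have c: "x0 \<in> carrier M" "x1 \<in> carrier M" "y0 \<in> carrier M" "y1 \<in> carrier M"
        using * by (auto dest: G_carrier)
      have "x \<oplus>\<^bsub>M\<^esub> \<ominus>\<^bsub>M\<^esub> y = (x0 \<oplus>\<^bsub>M\<^esub> \<ominus>\<^bsub>M\<^esub> y0) \<oplus>\<^bsub>M\<^esub> (x1 \<oplus>\<^bsub>M\<^esub> \<ominus>\<^bsub>M\<^esub> y1)"
        using c by (simp add: *(5,10) M.M.minus_add M.M.a_ac)
      moreover have "x0 \<oplus>\<^bsub>M\<^esub> \<ominus>\<^bsub>M\<^esub> y0 \<in> ?im \<inter> G i" "x1 \<oplus>\<^bsub>M\<^esub> \<ominus>\<^bsub>M\<^esub> y1 \<in> ?im \<inter> G (i + 1)"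
        by (intro IntI im_add M.submodule_minus[OF im] G_add G_minus *)+
      ultimately show "x \<oplus>\<^bsub>M\<^esub> \<ominus>\<^bsub>M\<^esub> y \<in> ?D" by (intro CollectI bexI)
    qed
    moreover fix x assume "x \<in> ?im"
    ultimately show "\<exists>y\<in>?im \<inter> G i. \<exists>z\<in>?im \<inter> G (i + 1). x = y \<oplus>\<^bsub>M\<^esub> z" by (rule subsetD[THEN CollectD])
  qed
  moreover have "m \<in> ?im"
    using imI[OF M.R.one_closed m(1)] M.smult_one[OF subsetD[OF P0(3) m(1)]] by simp
  ultimately have surj: "?im = carrier M" using sim m(2) by blast
  define H where "H d = P \<inter> G d" for d
  have lP: "left_module (env_even L) (sub P)" using P(3) by (simp add: simple_module_def)
  interpret PM: left_module "env_even L" "sub P" by (rule lP)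
  have HP: "submodule (H d) (env_even L) (sub P)" for d
    using R.M.submodule_restrict_iff[OF P(1)] R.M.submodule_Int[OF P(1) G_submodule] by (simp add: H_def)
  have "group_grading (sub P) H"
    unfolding group_grading_def
  proof (intro conjI allI ballI)
    show "subgroup (H d) (add_monoid (sub P))" for d using HP[of d] by (simp add: submodule_def)
    show "H 0 \<inter> H 1 = {\<zero>\<^bsub>sub P\<^esub>}"
      using G_Int[of _ 0] G_zero P0(2) by (auto simp: H_def)
    fix x assume "x \<in> carrier (sub P)"
    then have x: "x \<in> P" "x \<in> G i" "x \<in> carrier M" using P(2) P0(3) by auto
    show "\<exists>x0\<in>H 0. \<exists>x1\<in>H 1. x = x0 \<oplus>\<^bsub>sub P\<^esub> x1"
    proof (cases i rule: bit.exhaust)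
      case zero
      then show ?thesis using x P0(2) G_zero by (intro bexI[of _ x] bexI[of _ "\<zero>\<^bsub>M\<^esub>"]) (simp_all add: H_def)
    next
      case one
      then show ?thesis using x P0(2) G_zero by (intro bexI[of _ "\<zero>\<^bsub>M\<^esub>"] bexI[of _ x]) (simp_all add: H_def)
    qed
  qed
  then have grP: "graded_module (env_even L) (env_part (even_subalgebra L)) (sub P) H"
    unfolding graded_module_def
  proof (intro conjI lP allI ballI)
    fix d e u x assume u: "u \<in> env_part (even_subalgebra L) d" and x: "x \<in> H e"
    have "u \<in> carrier (env_even L)" using u R.even.env_part_closed by blast
    then have "u \<odot>\<^bsub>res\<^esub> x \<in> P" using x P(1) by (auto simp: H_def R.M.submodule_iff)
    moreover have "env_map L u \<odot>\<^bsub>M\<^esub> x \<in> G (d + e)"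
      using G_smult[OF env_map_env_part[OF u]] x by (simp add: H_def)
    ultimately show "u \<odot>\<^bsub>sub P\<^esub> x \<in> H (d + e)" by (simp add: H_def)
  qed
  have gr: "f ` env_induced_grading L (sub P) H d \<subseteq> G d" for d
  proof -
    let ?Ind = "env_induced L (sub P)"
    interpret Ind: abelian_group ?Ind by (rule ab)
    interpret FH: group_hom "add_monoid ?Ind" "add_monoid M" f
      using f by (intro group_hom.intro comm_group.axioms(2)[OF Ind.a_comm_group]
          comm_group.axioms(2)[OF M.M.a_comm_group] group_hom_axioms.intro) (simp add: left_module_hom_def)
    have tens: "t \<in> carrier ?Ind \<and> f t \<in> G d"
      if t: "t \<in> {induced_tensor (env L) (env_even L) (env_map L) (sub P) a m | a m j k.
        a \<in> env_part L j \<and> m \<in> H k \<and> j + k = d}" for t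
    proof -
      obtain a m j k where *: "t = induced_tensor (env L) (env_even L) (env_map L) (sub P) a m"
        "a \<in> env_part L j" "m \<in> H k" "j + k = d" using t by blast
      have "a \<in> carrier (env L)" "m \<in> P" using * env_part_closed by (auto simp: H_def)
      then show ?thesis using gen[of a m] G_smult[OF *(2), of m k] * by (simp add: H_def)
    qed
    have "t \<in> carrier ?Ind \<and> f t \<in> G d" if "t \<in> env_induced_grading L (sub P) H d" for t
      using that unfolding induced_grading_def
    proof (induction rule: generate.induct)
      case one
      have "f \<zero>\<^bsub>?Ind\<^esub> = \<zero>\<^bsub>M\<^esub>" using FH.hom_one by simp
      then show ?case using Ind.zero_closed G_zero by simp
    next
      case (incl t) then show ?case by (rule tens)
    next
      case (inv t)
      note t = tens[OF inv]
      have "f (\<ominus>\<^bsub>?Ind\<^esub> t) = \<ominus>\<^bsub>M\<^esub> f t" using FH.hom_inv[of t] t by (simp add: a_inv_def)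
      then show ?case using t Ind.a_inv_closed[of t] G_minus by (simp add: a_inv_def)
    next
      case (eng s t)
      then have "f (s \<oplus>\<^bsub>?Ind\<^esub> t) = f s \<oplus>\<^bsub>M\<^esub> f t" using FH.hom_mult[of s t] by simp
      then show ?case using eng Ind.a_closed[of s t] G_add by simp
    qed
    then show ?thesis by blast
  qed
  show ?thesis using P(3) grP f surj gr by blast
qed

theorem proposition22:
  fixes \<ss> :: "('k::field, 's::ab_group_add) superalgebra"
  assumes "lie_superalgebra \<ss>" and "finite_dimensional \<ss>"
    and "\<forall>(S :: (('k, 's) env, ('k, 's) free_algebra) module)
          (E :: (('k, 's) env, ('k, 's) free_algebra) module).
      simple_module (env_even \<ss>) S \<and> left_module (env_even \<ss>) E \<and>
      env_finite_dimensional (even_subalgebra \<ss>) E \<longrightarrow>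
      finite_type_socle (env_even \<ss>) (tensor_module (even_subalgebra \<ss>) S E)"
  shows "(\<forall>M :: (('k, 's) env, 'm) module.
      simple_module (env \<ss>) M \<longrightarrow>
      (\<exists>(L :: (('k, 's) env, 'm) module) f.
        simple_module (env_even \<ss>) L \<and>
        f \<in> left_module_hom (env \<ss>) (env_induced \<ss> L) M \<and>
        f ` carrier (env_induced \<ss> L) = carrier M))
    \<and> (\<forall>(M :: (('k, 's) env, 'm) module) G.
      graded_simple_module (env \<ss>) (env_part \<ss>) M G \<longrightarrow>
      (\<exists>(L :: (('k, 's) env, 'm) module) H f.
        simple_module (env_even \<ss>) L \<and>
        graded_module (env_even \<ss>) (env_part (even_subalgebra \<ss>)) L H \<and>
        f \<in> left_module_hom (env \<ss>) (env_induced \<ss> L) M \<and>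
        f ` carrier (env_induced \<ss> L) = carrier M \<and>
        (\<forall>i. f ` env_induced_grading \<ss> L H i \<subseteq> G i)))"
proof (intro conjI allI impI)
  {
    fix M :: "(('k, 's) env, 'm) module"
    assume M: "simple_module (env \<ss>) M"
    then interpret env_module \<ss> M
      by (intro env_module.intro assms(1)) (simp add: simple_module_def)
    show "\<exists>(L :: (('k, 's) env, 'm) module) f.
        simple_module (env_even \<ss>) L \<and>
        f \<in> left_module_hom (env \<ss>) (env_induced \<ss> L) M \<and>
        f ` carrier (env_induced \<ss> L) = carrier M"
      by (rule simple_module_is_quotient[OF assms(2,3) M])
  next
    fix M :: "(('k, 's) env, 'm) module" and G
    assume M: "graded_simple_module (env \<ss>) (env_part \<ss>) M G"
    then interpret graded_env_module \<ss> M G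
      by (intro graded_env_module.intro env_module.intro assms(1) graded_env_module_axioms.intro)
        (simp_all add: graded_simple_module_def graded_module_def)
    show "\<exists>(L :: (('k, 's) env, 'm) module) H f.
        simple_module (env_even \<ss>) L \<and>
        graded_module (env_even \<ss>) (env_part (even_subalgebra \<ss>)) L H \<and>
        f \<in> left_module_hom (env \<ss>) (env_induced \<ss> L) M \<and>
        f ` carrier (env_induced \<ss> L) = carrier M \<and>
        (\<forall>i. f ` env_induced_grading \<ss> L H i \<subseteq> G i)"
      by (rule graded_simple_module_is_quotient[OF assms(2,3) M])
  }
qed

end
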